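(* Let $\mathbf{k}$ be a field, and suppose $S=\mathbf{k}[x_0,\dots,x_n]$ is positively graded by an abelian group $A$. Let $M$ be a finitely generated $A$-graded $S$-module that is generated in degree $\mathbf{0}$, and let $F$ be its minimal $A$-graded free resolution. (1) There exists a unique maximal strongly linear, quasi-split subcomplex $L$ of $F$. (2) The complex $L$ in (1) can be expressed as $L=\mathbf{L}(K)$, where $$K=\ker\Big(M_{\mathbf{0}}\otimes_{\mathbf{k}}\omega_E\xrightarrow{\ \sum_{i=0}^n x_i\otimes e_i\ }\mathbf{R}(M)\Big),$$ regarded as an $E$-module with trivial differential.
   Context: Positive grading: $S$ is $A$-graded with each $x_i$ homogeneous, $S_{\mathbf 0}=\mathbf{k}$ (where $\mathbf 0$ is the identity of $A$), and there is a homomorphism $\theta:A\to\mathbb{Z}$ with $\theta(\deg(x_i))>0$ for all $i$. Twists: $M(a)_b=M_{a+b}$. A morphism $f:G\to G'$ of free $A$-graded $S$-modules is strongly linear if there exist bases of $G$ and $G'$ with respect to which $f$ is a matrix whose entries are $\mathbf{k}$-linear combinations of the variables $x_0,\dots,x_n$. A complex $C$ of free $A$-graded $S$-modules is strongly linear if there is a choice of basis of $C$ with respect to which its differentials are matrices whose entries are $\mathbf{k}$-linear combinations of the variables. A subcomplex $C'$ of a complex $C$ of $A$-graded $S$-modules is quasi-split if $C'$ is a summand of $C$ as an $S$-module (not necessarily as a complex). Maximality is understood in the sense that every strongly linear, quasi-split subcomplex of $F$ is isomorphic to a quasi-split subcomplex of $L$. $E=\Lambda_{\mathbf{k}}(e_0,\dots,e_n)$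 is the exterior algebra with $A\oplus\mathbb{Z}$-grading $\deg(e_i)=(-\deg(x_i);-1)$; the $\mathbb{Z}$-component is the auxiliary degree $\mathrm{aux}$. $E$-modules are $A\oplus\mathbb{Z}$-graded right modules, viewed also as left modules via $em=(-1)^{\mathrm{aux}(e)\mathrm{aux}(m)}me$. $\omega_E=\underline{\mathrm{Hom}}_{\mathbf{k}}(E,\mathbf{k})$ is the graded $\mathbf{k}$-dual of $E$, with $(fe)(e')=f(ee')$; $\omega_E\cong E(-\sum_{i}\deg(x_i);-n-1)$. For an $E$-module $N$ (with trivial differential), $\mathbf{L}(N)$ is the complex of $A$-graded $S$-modules with $\mathbf{L}(N)_j=\bigoplus_{a\in A}S(-a)\otimes_{\mathbf{k}}N_{(a;j)}$ in homological degree $j$ and differential $s\otimes y\mapsto\sum_{i=0}^n x_is\otimes e_iy$. For an $A$-graded $S$-module $M$, $\mathbf{R}(M)=\bigoplus_{a\in A}M_a\otimes_{\mathbf{k}}\omega_E(-a;0)$, with differential $m\otimes f\mapsto\sum_{i=0}^n x_im\otimes e_if$. The map defining $K$ is the restriction of this differential to the summand $M_{\mathbf 0}\otimes_{\mathbf{k}}\omega_E$. *)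

theory Defs
  imports Complex_Main "HOL-Library.Poly_Mapping" "HOL-Library.Function_Algebras"
begin

section \<open>The graded polynomial ring\<close>

text \<open>The variables \<open>x\<^sub>0, \<dots>, x\<^sub>n\<close> are indexed by a finite linearly ordered type \<open>'v\<close> (types are
  nonempty, so \<open>CARD('v) = n + 1\<close> with \<open>n \<ge> 0\<close>); the order only enters the signs of the exterior
  algebra. A polynomial maps exponent vectors to coefficients.\<close>

type_synonym ('v, 'k) mpol = "('v \<Rightarrow>\<^sub>0 nat) \<Rightarrow>\<^sub>0 'k"

definition Const :: "'k \<Rightarrow> ('v, 'k::comm_ring_1) mpol"
  where "Const c = Poly_Mapping.single 0 c"

definition Var :: "'v \<Rightarrow> ('v, 'k::comm_ring_1) mpol"
  where "Var i = Poly_Mapping.single (Poly_Mapping.single i 1) 1"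

definition linear_forms :: "('v::finite, 'k::comm_ring_1) mpol set"
  where "linear_forms = range (\<lambda>c. \<Sum>i\<in>UNIV. Const (c i) * Var i)"

definition mono_deg :: "('v::finite \<Rightarrow> 'a::ab_group_add) \<Rightarrow> ('v \<Rightarrow>\<^sub>0 nat) \<Rightarrow> 'a"
  where "mono_deg deg u = (\<Sum>i\<in>UNIV. \<Sum>_<Poly_Mapping.lookup u i. deg i)"

definition poly_comp ::
    "('v::finite \<Rightarrow> 'a::ab_group_add) \<Rightarrow> 'a \<Rightarrow> ('v, 'k::comm_ring_1) mpol set"
  where "poly_comp deg a = {p. \<forall>u\<in>Poly_Mapping.keys p. mono_deg deg u = a}"

definition positively_graded :: "'k::comm_ring_1 itself \<Rightarrow> ('v::finite \<Rightarrow> 'a::ab_group_add) \<Rightarrow> bool"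
  where "positively_graded _ deg \<longleftrightarrow>
    poly_comp deg 0 = range (Const :: 'k \<Rightarrow> ('v, 'k) mpol) \<and>
    (\<exists>\<theta> :: 'a \<Rightarrow> int. additive \<theta> \<and> (\<forall>i. \<theta> (deg i) > 0))"


section \<open>Graded modules and complexes\<close>

text \<open>A graded module is a family \<open>G\<close> of homogeneous components inside an ambient \<open>S\<close>-module
  with scalar multiplication \<open>sc\<close>. The components are independent, and the module itself is
  \<open>total sc G\<close>, their (direct) sum; it need not exhaust the ambient type.\<close>

definition graded_module ::
    "('v::finite \<Rightarrow> 'a::ab_group_add) \<Rightarrow> (('v, 'k::comm_ring_1) mpol \<Rightarrow> 'm::ab_group_add \<Rightarrow> 'm)
      \<Rightarrow> ('a \<Rightarrow> 'm set) \<Rightarrow> bool"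
  where "graded_module deg sc G \<longleftrightarrow> module sc \<and>
    (\<forall>a. 0 \<in> G a \<and> (\<forall>x\<in>G a. \<forall>y\<in>G a. x + y \<in> G a)) \<and>
    (\<forall>a b. \<forall>s\<in>poly_comp deg a. \<forall>y\<in>G b. sc s y \<in> G (a + b)) \<and>
    (\<forall>X f. finite X \<and> (\<forall>a\<in>X. f a \<in> G a) \<and> (\<Sum>a\<in>X. f a) = 0 \<longrightarrow> (\<forall>a\<in>X. f a = 0))"

definition total ::
    "(('v, 'k::comm_ring_1) mpol \<Rightarrow> 'm::ab_group_add \<Rightarrow> 'm) \<Rightarrow> ('a \<Rightarrow> 'm set) \<Rightarrow> 'm set"
  where "total sc G = module.span sc (\<Union>a. G a)"

definition finitely_generated ::
    "(('v, 'k::comm_ring_1) mpol \<Rightarrow> 'm::ab_group_add \<Rightarrow> 'm) \<Rightarrow> ('a \<Rightarrow> 'm set) \<Rightarrow> bool"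
  where "finitely_generated sc G \<longleftrightarrow>
    (\<exists>X. finite X \<and> X \<subseteq> total sc G \<and> module.span sc X = total sc G)"

definition generated_in_degree ::
    "'a \<Rightarrow> (('v, 'k::comm_ring_1) mpol \<Rightarrow> 'm::ab_group_add \<Rightarrow> 'm) \<Rightarrow> ('a \<Rightarrow> 'm set) \<Rightarrow> bool"
  where "generated_in_degree a sc G \<longleftrightarrow> module.span sc (G a) = total sc G"

definition linear_on ::
    "(('v, 'k::comm_ring_1) mpol \<Rightarrow> 'c::ab_group_add \<Rightarrow> 'c) \<Rightarrow>
     (('v, 'k) mpol \<Rightarrow> 'e::ab_group_add \<Rightarrow> 'e) \<Rightarrow> 'c set \<Rightarrow> ('c \<Rightarrow> 'e) \<Rightarrow> bool"
  where "linear_on sc sc' X f \<longleftrightarrow>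
    (\<forall>x\<in>X. \<forall>y\<in>X. f (x + y) = f x + f y) \<and> (\<forall>s. \<forall>x\<in>X. f (sc s x) = sc' s (f x))"

text \<open>A complex \<open>\<dots> \<rightarrow> C\<^sub>j \<rightarrow> C\<^sub>j\<^sub>-\<^sub>1 \<rightarrow> \<dots>\<close>: \<open>cmp C j a\<close> is the component of degree \<open>a\<close> of \<open>C\<^sub>j\<close>, and
  \<open>dif C j\<close> is the differential starting at \<open>C\<^sub>j\<close>, relevant only on \<open>C\<^sub>j\<close>. All \<open>C\<^sub>j\<close> sit in one
  ambient module, where they may overlap.\<close>

record (overloaded) ('v, 'k, 'a, 'c) gcomplex =
  scl :: "('v, 'k) mpol \<Rightarrow> 'c \<Rightarrow> 'c"
  cmp :: "int \<Rightarrow> 'a \<Rightarrow> 'c set"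
  dif :: "int \<Rightarrow> 'c \<Rightarrow> 'c"

definition cmod :: "('v, 'k::comm_ring_1, 'a, 'c::ab_group_add) gcomplex \<Rightarrow> int \<Rightarrow> 'c set"
  where "cmod C j = total (scl C) (cmp C j)"

definition graded_complex ::
    "('v::finite \<Rightarrow> 'a::ab_group_add) \<Rightarrow> ('v, 'k::comm_ring_1, 'a, 'c::ab_group_add) gcomplex \<Rightarrow> bool"
  where "graded_complex deg C \<longleftrightarrow>
    (\<forall>j. graded_module deg (scl C) (cmp C j)) \<and>
    (\<forall>j. linear_on (scl C) (scl C) (cmod C j) (dif C j)) \<and>
    (\<forall>j a. dif C j ` cmp C j a \<subseteq> cmp C (j - 1) a) \<and>
    (\<forall>j. \<forall>x\<in>cmod C j. dif C (j - 1) (dif C j x) = 0)"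

text \<open>A basis of a graded free module consists of homogeneous elements.\<close>

definition basis_of ::
    "('v, 'k::comm_ring_1, 'a, 'c::ab_group_add) gcomplex \<Rightarrow> int \<Rightarrow> 'c set \<Rightarrow> bool"
  where "basis_of C j B \<longleftrightarrow> B \<subseteq> (\<Union>a. cmp C j a) \<and>
    \<not> module.dependent (scl C) B \<and> module.span (scl C) B = cmod C j"

definition strongly_linear ::
    "('v::finite \<Rightarrow> 'a::ab_group_add) \<Rightarrow> ('v, 'k::comm_ring_1, 'a, 'c::ab_group_add) gcomplex \<Rightarrow> bool"
  where "strongly_linear deg C \<longleftrightarrow> graded_complex deg C \<and>
    (\<exists>B. (\<forall>j. basis_of C j (B j)) \<and>
         (\<forall>j. \<forall>b\<in>B j. \<forall>b'\<in>B (j - 1).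
            module.representation (scl C) (B (j - 1)) (dif C j b) b' \<in> linear_forms))"

definition subcomplex ::
    "('v::finite \<Rightarrow> 'a::ab_group_add) \<Rightarrow> ('v, 'k::comm_ring_1, 'a, 'c::ab_group_add) gcomplex
      \<Rightarrow> ('v, 'k, 'a, 'c) gcomplex \<Rightarrow> bool"
  where "subcomplex deg C' C \<longleftrightarrow> graded_complex deg C' \<and>
    scl C' = scl C \<and> dif C' = dif C \<and> (\<forall>j a. cmp C' j a \<subseteq> cmp C j a)"

definition quasi_split_subcomplex ::
    "('v::finite \<Rightarrow> 'a::ab_group_add) \<Rightarrow> ('v, 'k::comm_ring_1, 'a, 'c::ab_group_add) gcomplex
      \<Rightarrow> ('v, 'k, 'a, 'c) gcomplex \<Rightarrow> bool"
  where "quasi_split_subcomplex deg C' C \<longleftrightarrow> subcomplex deg C' C \<and>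
    (\<forall>j. \<exists>D. module.subspace (scl C) D \<and> cmod C' j \<inter> D = {0} \<and>
             {x + y | x y. x \<in> cmod C' j \<and> y \<in> D} = cmod C j)"

definition complex_iso ::
    "('v, 'k::comm_ring_1, 'a, 'c::ab_group_add) gcomplex
      \<Rightarrow> ('v, 'k, 'a, 'e::ab_group_add) gcomplex \<Rightarrow> bool"
  where "complex_iso C C' \<longleftrightarrow> (\<exists>\<phi> :: int \<Rightarrow> 'c \<Rightarrow> 'e. \<forall>j.
    linear_on (scl C) (scl C') (cmod C j) (\<phi> j) \<and>
    bij_betw (\<phi> j) (cmod C j) (cmod C' j) \<and>
    (\<forall>a. \<phi> j ` cmp C j a = cmp C' j a) \<and>
    (\<forall>x\<in>cmod C j. \<phi> (j - 1) (dif C j x) = dif C' j (\<phi> j x)))"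

definition maximal_strand ::
    "('v::finite \<Rightarrow> 'a::ab_group_add) \<Rightarrow> ('v, 'k::comm_ring_1, 'a, 'c::ab_group_add) gcomplex
      \<Rightarrow> ('v, 'k, 'a, 'c) gcomplex \<Rightarrow> bool"
  where "maximal_strand deg F L \<longleftrightarrow>
    strongly_linear deg L \<and> quasi_split_subcomplex deg L F \<and>
    (\<forall>C. strongly_linear deg C \<and> quasi_split_subcomplex deg C F \<longrightarrow>
         (\<exists>C'. quasi_split_subcomplex deg C' L \<and> complex_iso C C'))"

definition minimal_free_resolution ::
    "('v::finite \<Rightarrow> 'a::ab_group_add) \<Rightarrow> (('v, 'k::comm_ring_1) mpol \<Rightarrow> 'm::ab_group_add \<Rightarrow> 'm)
      \<Rightarrow> ('a \<Rightarrow> 'm set) \<Rightarrow> ('v, 'k, 'a, 'f::ab_group_add) gcomplex \<Rightarrow> ('f \<Rightarrow> 'm) \<Rightarrow> bool"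
  where "minimal_free_resolution deg sM G F \<epsilon> \<longleftrightarrow> graded_complex deg F \<and>
    (\<forall>j<0. cmod F j = {0}) \<and>
    (\<forall>j. \<exists>B. finite B \<and> basis_of F j B) \<and>
    linear_on (scl F) sM (cmod F 0) \<epsilon> \<and>
    (\<forall>a. \<epsilon> ` cmp F 0 a \<subseteq> G a) \<and>
    \<epsilon> ` cmod F 0 = total sM G \<and>
    {x \<in> cmod F 0. \<epsilon> x = 0} = dif F 1 ` cmod F 1 \<and>
    (\<forall>j\<ge>1. {x \<in> cmod F j. dif F j x = 0} = dif F (j + 1) ` cmod F (j + 1)) \<and>
    (\<forall>j. dif F j ` cmod F j \<subseteq> module.span (scl F) {scl F (Var i) y | i y. y \<in> cmod F (j - 1)})"


section \<open>The exterior algebra and its modules\<close>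

text \<open>An element of \<open>E\<close> maps \<open>I = {i\<^sub>1 < \<dots> < i\<^sub>r}\<close> to the coefficient of
  \<open>e\<^sub>I = e\<^bsub>i\<^sub>1\<^esub> \<and> \<dots> \<and> e\<^bsub>i\<^sub>r\<^esub>\<close>.\<close>

type_synonym ('v, 'k) ext = "'v set \<Rightarrow>\<^sub>0 'k"

definition ext_gen :: "'v \<Rightarrow> ('v, 'k::comm_ring_1) ext"
  where "ext_gen i = Poly_Mapping.single {i} 1"

definition ext_scale :: "'k \<Rightarrow> ('v, 'k::comm_ring_1) ext \<Rightarrow> ('v, 'k) ext"
  where "ext_scale c e = Poly_Mapping.map ((*) c) e"

definition ext_sign :: "'v::linorder set \<Rightarrow> 'v set \<Rightarrow> 'k::comm_ring_1"
  where "ext_sign I J =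
    (if I \<inter> J = {} then (- 1) ^ card {(i, j). i \<in> I \<and> j \<in> J \<and> j < i} else 0)"

definition ext_mult :: "('v::linorder, 'k::comm_ring_1) ext \<Rightarrow> ('v, 'k) ext \<Rightarrow> ('v, 'k) ext"
  where "ext_mult x y = (\<Sum>I\<in>Poly_Mapping.keys x. \<Sum>J\<in>Poly_Mapping.keys y.
    Poly_Mapping.single (I \<union> J)
      (ext_sign I J * (Poly_Mapping.lookup x I * Poly_Mapping.lookup y J)))"

definition ext_comp ::
    "('v \<Rightarrow> 'a::ab_group_add) \<Rightarrow> 'a \<Rightarrow> int \<Rightarrow> ('v, 'k::comm_ring_1) ext set"
  where "ext_comp deg a j =
    {e. \<forall>I\<in>Poly_Mapping.keys e. - (\<Sum>i\<in>I. deg i) = a \<and> - int (card I) = j}"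

lemma lookup_ext_scale: "Poly_Mapping.lookup (ext_scale c e) I = c * Poly_Mapping.lookup e I"
  by (simp add: ext_scale_def Poly_Mapping.map.rep_eq when_def)

lemma module_ext_scale: "module ext_scale"
  by standard (auto intro!: poly_mapping_eqI simp: lookup_ext_scale lookup_add algebra_simps)

text \<open>\<open>ecmp N a j\<close> is the component \<open>N\<^bsub>(a;j)\<^esub>\<close>; as for graded modules, only the components matter.\<close>

record (overloaded) ('v, 'k, 'a, 'n) emodule =
  kscl :: "'k \<Rightarrow> 'n \<Rightarrow> 'n"
  ract :: "'n \<Rightarrow> ('v, 'k) ext \<Rightarrow> 'n"
  ecmp :: "'a \<Rightarrow> int \<Rightarrow> 'n set"

text \<open>The left action of \<open>e\<^sub>i\<close> on an element \<open>y\<close> of auxiliary degree \<open>j\<close>: the sign is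
  \<open>(-1)\<close> to the power \<open>aux(e\<^sub>i) aux(y) = -j\<close>.\<close>

definition lact_gen :: "('v, 'k::field, 'a, 'n) emodule \<Rightarrow> int \<Rightarrow> 'v \<Rightarrow> 'n \<Rightarrow> 'n"
  where "lact_gen N j i y = kscl N ((- 1) powi (- j)) (ract N y (ext_gen i))"

text \<open>The graded dual \<open>\<omega>\<^sub>E\<close>: a functional of degree \<open>(a;j)\<close> is one that is supported on
  \<open>E\<^bsub>(-a;-j)\<^esub>\<close>.\<close>

definition omega ::
    "('v::linorder \<Rightarrow> 'a::ab_group_add) \<Rightarrow> ('v, 'k::field, 'a, ('v, 'k) ext \<Rightarrow> 'k) emodule"
  where "omega deg = \<lparr>
    kscl = (\<lambda>c f e. c * f e),
    ract = (\<lambda>f e e'. f (ext_mult e e')),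
    ecmp = (\<lambda>a j. {f. module_hom ext_scale (*) f \<and>
              (\<forall>b l. (b, l) \<noteq> (- a, - j) \<longrightarrow> (\<forall>e\<in>ext_comp deg b l. f e = 0))}) \<rparr>"


section \<open>The functor \<open>\<^bold>L\<close>\<close>

text \<open>For a \<open>\<^bold>k\<close>-vector space \<open>N\<close> (with scalar multiplication \<open>ks\<close>), \<open>S \<otimes>\<^sub>\<^bold>k N\<close> is modelled by the
  finitely supported maps from monomials to \<open>N\<close>, i.e. as the direct sum of copies of \<open>N\<close> indexed
  by the monomial basis of \<open>S\<close>.\<close>

definition tensor_poly ::
    "('k::comm_ring_1 \<Rightarrow> 'n \<Rightarrow> 'n) \<Rightarrow> ('v, 'k) mpol \<Rightarrow> 'n::ab_group_add \<Rightarrow> ('v \<Rightarrow>\<^sub>0 nat) \<Rightarrow>\<^sub>0 'n"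
  where "tensor_poly ks s y =
    (\<Sum>u\<in>Poly_Mapping.keys s. Poly_Mapping.single u (ks (Poly_Mapping.lookup s u) y))"

definition tensor_poly_scale ::
    "('k::comm_ring_1 \<Rightarrow> 'n \<Rightarrow> 'n) \<Rightarrow> ('v, 'k) mpol
      \<Rightarrow> (('v \<Rightarrow>\<^sub>0 nat) \<Rightarrow>\<^sub>0 'n::ab_group_add) \<Rightarrow> ('v \<Rightarrow>\<^sub>0 nat) \<Rightarrow>\<^sub>0 'n"
  where "tensor_poly_scale ks s p =
    (\<Sum>u\<in>Poly_Mapping.keys s. \<Sum>w\<in>Poly_Mapping.keys p.
      Poly_Mapping.single (u + w) (ks (Poly_Mapping.lookup s u) (Poly_Mapping.lookup p w)))"

text \<open>In degree \<open>b\<close>, the summand \<open>S(-a) \<otimes> N\<^bsub>(a;j)\<^esub>\<close> has the component \<open>S\<^bsub>b - a\<^esub> \<otimes> N\<^bsub>(a;j)\<^esub>\<close>.\<close>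

definition LL ::
    "('v::finite \<Rightarrow> 'a::ab_group_add) \<Rightarrow> ('v, 'k::field, 'a, 'n::ab_group_add) emodule
      \<Rightarrow> ('v, 'k, 'a, ('v \<Rightarrow>\<^sub>0 nat) \<Rightarrow>\<^sub>0 'n) gcomplex"
  where "LL deg N = \<lparr>
    scl = tensor_poly_scale (kscl N),
    cmp = (\<lambda>j b. module.span (\<lambda>c. tensor_poly_scale (kscl N) (Const c))
            {tensor_poly (kscl N) s y | a s y. s \<in> poly_comp deg (b - a) \<and> y \<in> ecmp N a j}),
    dif = (\<lambda>j p. \<Sum>i\<in>UNIV. \<Sum>u\<in>Poly_Mapping.keys p.
            Poly_Mapping.single (Poly_Mapping.single i 1 + u)
              (lact_gen N j i (Poly_Mapping.lookup p u))) \<rparr>"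

lemma LL_dif_tensor:
  assumes "vector_space (kscl N)"
    and "\<And>y y' e. ract N (y + y') e = ract N y e + ract N y' e"
    and "\<And>c y e. ract N (kscl N c y) e = kscl N c (ract N y e)"
  shows "dif (LL deg N) j (tensor_poly (kscl N) s y) =
    (\<Sum>i\<in>UNIV. tensor_poly (kscl N) (Var i * s) (lact_gen N j i y))"
proof -
  interpret vector_space "kscl N" by fact
  let ?l = "Poly_Mapping.lookup" and ?T = "tensor_poly (kscl N)"
  have lookup_T: "?l (?T s y) u = kscl N (?l s u) y" for s y u
  proof -
    have "?l (?T s y) u = (\<Sum>w\<in>Poly_Mapping.keys s. if w = u then kscl N (?l s w) y else 0)"
      unfolding tensor_poly_def lookup_sum by (intro sum.cong) (auto simp: lookup_single when_def)
    also have "\<dots> = kscl N (?l s u) y"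
      by (simp add: sum.delta' not_in_keys_iff_lookup_eq_zero)
    finally show ?thesis .
  qed
  have T_add: "?T (s + s') y = ?T s y + ?T s' y" for s s' y
    by (rule poly_mapping_eqI) (simp add: lookup_T lookup_add scale_left_distrib)
  have T_0: "?T 0 y = 0" for y by (simp add: tensor_poly_def)
  have T_single: "?T (Poly_Mapping.single u c) y = Poly_Mapping.single u (kscl N c y)" for u c y
    by (rule poly_mapping_eqI) (simp add: lookup_T lookup_single when_def)
  have T_sum: "?T (\<Sum>x\<in>X. g x) y = (\<Sum>x\<in>X. ?T (g x) y)" for g X y
    by (induction X rule: infinite_finite_induct) (simp_all add: T_0 T_add)
  have s_eq: "s = (\<Sum>u\<in>Poly_Mapping.keys s. Poly_Mapping.single u (?l s u))"
    by (rule poly_mapping_eqI)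
       (simp add: lookup_sum lookup_single when_def sum.delta' not_in_keys_iff_lookup_eq_zero)
  have ract_0: "ract N 0 e = 0" for e using assms(2)[of 0 0 e] by simp
  have lact_0: "lact_gen N j i 0 = 0" for i by (simp add: lact_gen_def ract_0)
  have lact_scale: "lact_gen N j i (kscl N c y) = kscl N c (lact_gen N j i y)" for i c y
    by (simp add: lact_gen_def assms(3) mult.commute)
  have keys_T: "Poly_Mapping.keys (?T s y) \<subseteq> Poly_Mapping.keys s"
    by (auto simp: in_keys_iff lookup_T)
  have "(\<Sum>u\<in>Poly_Mapping.keys (?T s y).
            Poly_Mapping.single (Poly_Mapping.single i 1 + u) (lact_gen N j i (?l (?T s y) u))) =
          ?T (Var i * s) (lact_gen N j i y)" (is "?lhs = ?rhs") for i
  proof -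
    have "?lhs = (\<Sum>u\<in>Poly_Mapping.keys s.
            Poly_Mapping.single (Poly_Mapping.single i 1 + u) (lact_gen N j i (?l (?T s y) u)))"
      using keys_T
      by (intro sum.mono_neutral_left) (auto simp: in_keys_iff lact_0)
    also have "\<dots> = (\<Sum>u\<in>Poly_Mapping.keys s.
            ?T (Var i * Poly_Mapping.single u (?l s u)) (lact_gen N j i y))"
      by (intro sum.cong) (simp_all add: lookup_T lact_scale Var_def mult_single T_single)
    also have "\<dots> = ?rhs"
      by (subst (2) s_eq) (simp add: T_sum sum_distrib_left)
    finally show ?thesis .
  qed
  then show ?thesis by (simp add: LL_def)
qed


section \<open>The kernel \<open>K\<close>\<close>

text \<open>As \<open>E\<close> is finite-dimensional, \<open>M \<otimes>\<^sub>\<^bold>k \<omega>\<^sub>E\<close> is modelled by \<open>\<^bold>k\<close>-linear maps \<open>E \<rightarrow> M\<close>, where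
  \<open>m \<otimes> f\<close> is the map \<open>e \<mapsto> f(e) m\<close>.\<close>

definition tensor_omega ::
    "(('v, 'k::comm_ring_1) mpol \<Rightarrow> 'm \<Rightarrow> 'm) \<Rightarrow> 'm \<Rightarrow> (('v, 'k) ext \<Rightarrow> 'k) \<Rightarrow> ('v, 'k) ext \<Rightarrow> 'm"
  where "tensor_omega sM m f = (\<lambda>e. sM (Const (f e)) m)"

definition fun_kscale ::
    "(('v, 'k::comm_ring_1) mpol \<Rightarrow> 'm \<Rightarrow> 'm) \<Rightarrow> 'k \<Rightarrow> (('v, 'k) ext \<Rightarrow> 'm) \<Rightarrow> ('v, 'k) ext \<Rightarrow> 'm"
  where "fun_kscale sM c \<phi> = (\<lambda>e. sM (Const c) (\<phi> e))"

text \<open>The summand \<open>M\<^sub>a \<otimes>\<^sub>\<^bold>k \<omega>\<^sub>E(-a;0)\<close> of \<open>\<^bold>R(M)\<close>, an \<open>E\<close>-module through its second factor.\<close>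

definition R_summand ::
    "('v::linorder \<Rightarrow> 'a::ab_group_add) \<Rightarrow> (('v, 'k::field) mpol \<Rightarrow> 'm::ab_group_add \<Rightarrow> 'm)
      \<Rightarrow> ('a \<Rightarrow> 'm set) \<Rightarrow> 'a \<Rightarrow> ('v, 'k, 'a, ('v, 'k) ext \<Rightarrow> 'm) emodule"
  where "R_summand deg sM G a = \<lparr>
    kscl = fun_kscale sM,
    ract = (\<lambda>\<phi> e e'. \<phi> (ext_mult e e')),
    ecmp = (\<lambda>b j. module.span (fun_kscale sM)
            {tensor_omega sM m f | m f. m \<in> G a \<and> f \<in> ecmp (omega deg) (b - a) j}) \<rparr>"

text \<open>The differential \<open>\<Sum> x\<^sub>i \<otimes> e\<^sub>i\<close> of \<open>\<^bold>R(M)\<close> on the elements of auxiliary degree \<open>j\<close> of that summand.\<close>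

definition R_dif ::
    "('v::{finite,linorder} \<Rightarrow> 'a::ab_group_add) \<Rightarrow> (('v, 'k::field) mpol \<Rightarrow> 'm::ab_group_add \<Rightarrow> 'm)
      \<Rightarrow> ('a \<Rightarrow> 'm set) \<Rightarrow> 'a \<Rightarrow> int \<Rightarrow> (('v, 'k) ext \<Rightarrow> 'm) \<Rightarrow> ('v, 'k) ext \<Rightarrow> 'm"
  where "R_dif deg sM G a j \<phi> =
    (\<lambda>e. \<Sum>i\<in>UNIV. sM (Var i) (lact_gen (R_summand deg sM G a) j i \<phi> e))"

lemma R_dif_tensor:
  fixes sM :: "('v::{finite,linorder}, 'k::field) mpol \<Rightarrow> 'm::ab_group_add \<Rightarrow> 'm"
  assumes "module sM"
  shows "R_dif deg sM G a j (tensor_omega sM m f) =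
    (\<Sum>i\<in>UNIV. tensor_omega sM (sM (Var i) m) (lact_gen (omega deg) j i f))"
proof -
  interpret module sM by fact
  have "Const c * Const d = (Const (c * d) :: ('v, 'k) mpol)" for c d :: 'k
    by (simp add: Const_def mult_single)
  moreover have "(\<Sum>i\<in>X. g i) e = (\<Sum>i\<in>X. g i e)" for X :: "'v set" and g :: "'v \<Rightarrow> ('v, 'k) ext \<Rightarrow> 'm" and e
    by (induction X rule: infinite_finite_induct) simp_all
  ultimately show ?thesis
    by (intro ext) (simp add: R_dif_def lact_gen_def R_summand_def omega_def tensor_omega_def
      fun_kscale_def scale_left_commute mult.commute scale_sum_right)
qed

definition K_module ::
    "('v::{finite,linorder} \<Rightarrow> 'a::ab_group_add) \<Rightarrow> (('v, 'k::field) mpol \<Rightarrow> 'm::ab_group_add \<Rightarrow> 'm)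
      \<Rightarrow> ('a \<Rightarrow> 'm set) \<Rightarrow> ('v, 'k, 'a, ('v, 'k) ext \<Rightarrow> 'm) emodule"
  where "K_module deg sM G = (R_summand deg sM G 0)\<lparr>
    ecmp := (\<lambda>b j. {\<phi> \<in> ecmp (R_summand deg sM G 0) b j. R_dif deg sM G 0 j \<phi> = 0}) \<rparr>"

end

theory Submission
  imports Defs
begin

text \<open>Lifting step by step along the acyclic complex \<open>F\<close> yields \<open>\<^bold>k\<close>-linear
  maps \<open>\<psi>\<^sub>j : K\<^sub>j \<rightarrow> F\<^sub>j\<close> with \<open>d(\<psi> y) = \<Sum> x\<^sub>i \<psi>(e\<^sub>i y)\<close>, i.e. a chain map \<open>\<^bold>L(K) \<rightarrow> F\<close>. Minimality of \<open>F\<close> makes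
  \<open>\<psi>\<close> injective modulo the irrelevant ideal \<open>m\<close>: if \<open>\<psi> y \<in> mF\<close>, then \<open>\<Sum> x\<^sub>i \<psi>(e\<^sub>i y) \<in> m\<^sup>2F\<close>, so by induction
  all \<open>e\<^sub>i y\<close> vanish and hence \<open>y = 0\<close>. By graded Nakayama the image is quasi-split. Conversely, the differential
  of a strongly linear quasi-split subcomplex \<open>C\<close> with basis \<open>B\<close> turns the \<open>\<^bold>k\<close>-span \<open>V\<close> of \<open>B\<close> into an
  \<open>E\<close>-module, and \<open>v \<mapsto> (e \<mapsto> \<plusminus>\<epsilon>(e v))\<close> embeds \<open>V\<close> into \<open>K\<close>, so that \<open>C \<cong> \<^bold>L(N)\<close> for a submodule
  \<open>N \<subseteq> K\<close>. Thus \<open>\<^bold>L(K)\<close> is maximal, and a dimension count modulo \<open>m\<close> shows \<open>N = K\<close> for every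
  maximal \<open>C\<close>.\<close>

section \<open>Polynomials\<close>

text \<open>No quotient F/mF is ever formed. Reduction modulo m is expressed by the constant terms
  of coordinates in a basis, and S \<otimes> N by its coefficients at monomials, so that every
  statement modulo m becomes a comparison of coefficients. Generation in degree 0 starts both
  halves: it gives M_0 \<inter> mM = 0, the base of the injectivity of \<psi>, and it concentrates
  F_0 in degree 0 modulo m, which gives the functional of v its values in M_0 and its degree. That y
  = 0 once all e_i y vanish holds outside auxiliary degree 0, because the socle of \<omega>_E sits
  in that degree; there \<epsilon> takes over. The characteristic is arbitrary, so anticommutation
  alone does not make squares vanish, and the relation e_i e_i = 0 is carried along separately. The
  dimension count is done in each bidegree; its finiteness comes from embedding the components of K
  into F_j modulo m, which has a finite basis. Maps are given only on subsets of ambient types;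
  where linear algebra is applied to them, they are first extended linearly to the whole
  type.\<close>

abbreviation lookup :: "('u \<Rightarrow>\<^sub>0 'b::zero) \<Rightarrow> 'u \<Rightarrow> 'b"
  where "lookup \<equiv> Poly_Mapping.lookup"

abbreviation single :: "'u \<Rightarrow> 'b::zero \<Rightarrow> 'u \<Rightarrow>\<^sub>0 'b"
  where "single \<equiv> Poly_Mapping.single"

abbreviation keys :: "('u \<Rightarrow>\<^sub>0 'b::zero) \<Rightarrow> 'u set"
  where "keys \<equiv> Poly_Mapping.keys"

abbreviation mon :: "('v \<Rightarrow>\<^sub>0 nat) \<Rightarrow> ('v, 'k::comm_ring_1) mpol"
  where "mon u \<equiv> single u 1"

lemma Const_0 [simp]: "Const 0 = 0"
  by (simp add: Const_def)

lemma Const_1 [simp]: "Const 1 = 1"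
  by (simp add: Const_def)

lemma Const_add: "Const (c + d) = Const c + Const d"
  by (simp add: Const_def single_add)

lemma Const_mult: "Const (c * d) = Const c * Const d"
  by (simp add: Const_def mult_single)

lemma Const_mult_single: "Const c * single u d = single u (c * d)"
  by (simp add: Const_def mult_single)

lemma mon_mult: "mon u * mon w = mon (u + w)"
  by (simp add: mult_single)

text \<open>Supports change under addition, so sums over \<open>keys\<close> are moved to a common
  finite index set before they are compared.\<close>

lemma sum_keys_eq:
  assumes "finite U" "keys p \<subseteq> U" "\<And>u. f u 0 = 0"
  shows "(\<Sum>u\<in>keys p. f u (lookup p u)) =
    (\<Sum>u\<in>U. f u (lookup p u))"
  using assms by (intro sum.mono_neutral_left) (auto simp: in_keys_iff)

lemma poly_mapping_sum_singles:
  "p = (\<Sum>u\<in>keys p. single u (lookup p u))"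
  by (rule poly_mapping_eqI)
     (simp add: lookup_sum lookup_single when_def sum.delta' not_in_keys_iff_lookup_eq_zero)

text \<open>Identities that are additive in \<open>p\<close> reduce to a single coefficient. The
  zero map is covered by \<open>single u 0\<close>.\<close>

lemma poly_mapping_additive_induct [case_names single add]:
  assumes "\<And>u y. P (single u y)" and "\<And>p q. P p \<Longrightarrow> P q \<Longrightarrow> P (p + q)"
  shows "P (p :: 'u \<Rightarrow>\<^sub>0 'n::ab_group_add)"
proof -
  have P0: "P 0" using assms(1)[of undefined 0] by simp
  have "P (\<Sum>u\<in>U. single u (g u))" if "finite U" for U g
    using that by induction (auto intro: P0 assms)
  then show ?thesis by (subst poly_mapping_sum_singles) simp
qed

lemma lookup_single_mult:
  fixes s :: "('v, 'k::comm_ring_1) mpol"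
  shows "lookup (single u c * s) (u + t) = c * lookup s t"
  by (induction s rule: poly_mapping_additive_induct)
     (auto simp: mult_single lookup_single when_def distrib_left lookup_add)

lemma lookup_single_mult_0:
  fixes s :: "('v, 'k::comm_ring_1) mpol"
  assumes "\<And>t. w \<noteq> u + t"
  shows "lookup (single u c * s) w = 0"
  using assms by (induction s rule: poly_mapping_additive_induct)
    (auto simp: mult_single lookup_single when_def distrib_left lookup_add)

text \<open>The standard degree, independent of the grading by \<open>'a\<close>; it orders the
  monomials in the comparisons of coefficients.\<close>

definition total_deg :: "('v::finite \<Rightarrow>\<^sub>0 nat) \<Rightarrow> nat"
  where "total_deg u = (\<Sum>i\<in>UNIV. lookup u i)"

lemma total_deg_add: "total_deg (u + w) = total_deg u + total_deg w"
  by (simp add: total_deg_def lookup_add sum.distrib)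

lemma total_deg_eq_0_iff: "total_deg u = 0 \<longleftrightarrow> u = 0"
  by (auto simp: total_deg_def intro!: poly_mapping_eqI)

lemma total_deg_single [simp]: "total_deg (single i n) = n"
  by (simp add: total_deg_def lookup_single when_def)

lemma monomial_add_eq_0_iff: "u + w = 0 \<longleftrightarrow> u = 0 \<and> w = (0 :: 'v::finite \<Rightarrow>\<^sub>0 nat)"
  by (metis add_is_0 total_deg_add total_deg_eq_0_iff)

lemma monomial_nonzero_E:
  fixes u :: "'v \<Rightarrow>\<^sub>0 nat"
  assumes "u \<noteq> 0"
  obtains i w where "u = single i 1 + w"
proof -
  obtain i where i: "lookup u i \<noteq> 0"
    using assms by (metis lookup_zero poly_mapping_eqI)
  have "u = single i 1 + (u - single i 1)"
    using i by (intro poly_mapping_eqI) (auto simp: lookup_add lookup_minus lookup_single when_def)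
  then show thesis using that by blast
qed

text \<open>Nonzero exponent vectors have no inverses, so only the two constant terms contribute.
  Taking constant terms is thus a ring homomorphism: reduction modulo m.\<close>

lemma lookup_mult_0:
  fixes s t :: "('v::finite, 'k::comm_ring_1) mpol"
  shows "lookup (s * t) 0 = lookup s 0 * lookup t 0"
proof (induction s rule: poly_mapping_additive_induct)
  case (single u c)
  show ?case
  proof (cases "u = 0")
    case True
    then show ?thesis using lookup_single_mult[of u c t 0] by simp
  next
    case False
    then have "0 \<noteq> u + w" for w by (metis monomial_add_eq_0_iff)
    then show ?thesis using False by (simp add: lookup_single_mult_0 lookup_single)
  qed
qed (simp add: lookup_add algebra_simps)

lemma lookup_Const_mult:
  fixes s :: "('v, 'k::comm_ring_1) mpol"
  shows "lookup (Const c * s) u = c * lookup s u"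
  using lookup_single_mult[of 0 c s u] by (simp add: Const_def)

lemma lookup_Var_0: "lookup (Var i) 0 = 0"
proof -
  have "single i (1::nat) \<noteq> 0"
    by (metis lookup_single_eq lookup_zero one_neq_zero)
  then show ?thesis by (simp add: Var_def lookup_single)
qed

lemma linear_forms_Const_Var:
  "Const c * Var i \<in> (linear_forms :: ('v::finite, 'k::comm_ring_1) mpol set)"
proof -
  have "(Const c * Var i :: ('v, 'k) mpol) = (\<Sum>k\<in>UNIV. Const (if k = i then c else 0) * Var k)"
    by (subst sum.remove[of _ i]) auto
  then show ?thesis
    unfolding linear_forms_def by (intro image_eqI[where x = "\<lambda>k. if k = i then c else 0"]) auto
qed

lemma linear_forms_0: "0 \<in> linear_forms"
  using linear_forms_Const_Var[of 0] by simp

lemma linear_forms_add: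
  assumes "s \<in> linear_forms" "t \<in> linear_forms" shows "s + t \<in> linear_forms"
proof -
  obtain c d where "s = (\<Sum>i\<in>UNIV. Const (c i) * Var i)" "t = (\<Sum>i\<in>UNIV. Const (d i) * Var i)"
    using assms unfolding linear_forms_def by auto
  then have "s + t = (\<Sum>i\<in>UNIV. Const (c i + d i) * Var i)"
    by (simp add: Const_add distrib_right sum.distrib)
  then show ?thesis
    unfolding linear_forms_def by (intro image_eqI[where x = "\<lambda>i. c i + d i"]) auto
qed

lemma linear_forms_sum: "(\<And>x. x \<in> X \<Longrightarrow> f x \<in> linear_forms) \<Longrightarrow> (\<Sum>x\<in>X. f x) \<in> linear_forms"
  by (induction X rule: infinite_finite_induct) (auto intro: linear_forms_0 linear_forms_add)

lemma lookup_linear_form: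
  fixes c :: "'v::finite \<Rightarrow> 'k::comm_ring_1"
  shows "lookup (\<Sum>i\<in>UNIV. Const (c i) * Var i) (single k 1) = c k"
proof -
  have "single i (1::nat) = single k 1 \<longleftrightarrow> i = k" for i :: 'v
    by (metis lookup_single_eq lookup_single_not_eq zero_neq_one)
  then show ?thesis
    by (simp add: lookup_sum Var_def Const_mult_single lookup_single when_def)
qed

text \<open>Recovers the coefficients that membership in \<open>linear_forms\<close> hides; \<delta>
  is later read off the differential in this way.\<close>

lemma linear_form_expand:
  fixes s :: "('v::finite, 'k::comm_ring_1) mpol"
  assumes "s \<in> linear_forms"
  shows "s = (\<Sum>i\<in>UNIV. Const (lookup s (single i 1)) * Var i)"
proof -
  obtain c where "s = (\<Sum>i\<in>UNIV. Const (c i) * Var i)"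
    using assms unfolding linear_forms_def by auto
  then show ?thesis by (simp only: lookup_linear_form)
qed

lemma mono_deg_0 [simp]: "mono_deg deg 0 = 0"
  by (simp add: mono_deg_def)

lemma mono_deg_add: "mono_deg deg (u + w) = mono_deg deg u + mono_deg deg w"
proof -
  have *: "(\<Sum>_<m + n. a) = (\<Sum>_<m. a) + (\<Sum>_<n. a)" for m n :: nat and a :: 'a
    by (induction n) (auto simp: algebra_simps)
  show ?thesis by (simp add: mono_deg_def lookup_add * sum.distrib)
qed

lemma mono_deg_single [simp]: "mono_deg deg (single i 1) = deg i"
proof -
  have "mono_deg deg (single i 1) = (\<Sum>k\<in>UNIV. if k = i then deg i else 0)"
    unfolding mono_deg_def by (intro sum.cong) (auto simp: lookup_single when_def)
  then show ?thesis by simp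
qed

lemma poly_comp_0 [simp]: "0 \<in> poly_comp deg a"
  by (simp add: poly_comp_def)

lemma poly_comp_add: "s \<in> poly_comp deg a \<Longrightarrow> t \<in> poly_comp deg a \<Longrightarrow> s + t \<in> poly_comp deg a"
  using keys_add[of s t] by (auto simp: poly_comp_def)

lemma poly_comp_sum: "(\<And>x. x \<in> X \<Longrightarrow> f x \<in> poly_comp deg a) \<Longrightarrow> (\<Sum>x\<in>X. f x) \<in> poly_comp deg a"
  by (induction X rule: infinite_finite_induct) (auto intro: poly_comp_add)

lemma single_poly_comp: "mono_deg deg u = a \<Longrightarrow> single u c \<in> poly_comp deg a"
  by (simp add: poly_comp_def)

lemma Const_poly_comp: "Const c \<in> poly_comp deg 0"
  by (simp add: Const_def single_poly_comp)

lemma Var_poly_comp: "Var i \<in> poly_comp deg (deg i)"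
  unfolding Var_def by (rule single_poly_comp) (rule mono_deg_single)

lemma lookup_poly_comp:
  "s \<in> poly_comp deg a \<Longrightarrow> lookup s u \<noteq> 0 \<Longrightarrow> mono_deg deg u = a"
  by (simp add: poly_comp_def in_keys_iff)


section \<open>Modules over the polynomial ring\<close>

locale mpol_module = module sc
  for sc :: "('v::finite, 'k::field) mpol \<Rightarrow> 'c::ab_group_add \<Rightarrow> 'c"
begin

text \<open>Restriction of scalars along \<open>Const\<close>. The notions over the field are then
  told apart from those over the polynomial ring by the prefix \<open>k\<close>.\<close>

definition ks :: "'k \<Rightarrow> 'c \<Rightarrow> 'c"
  where "ks c x = sc (Const c) x"

sublocale k: vector_space ks
  by standard (simp_all add: ks_def scale_right_distrib scale_left_distrib Const_add Const_mult)

text \<open>This is mN, as the variables generate m; applied twice it gives m^2 N.\<close>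

definition mm :: "'c set \<Rightarrow> 'c set"
  where "mm N = span {sc (Var i) y | i y. y \<in> N}"

text \<open>The coordinate of \<open>x\<close> modulo m in the basis \<open>B\<close>.\<close>

abbreviation ccoeff :: "'c set \<Rightarrow> 'c \<Rightarrow> 'c \<Rightarrow> 'k"
  where "ccoeff B x b \<equiv> lookup (representation B x b) 0"

lemma subspace_k: "subspace N \<Longrightarrow> k.subspace N"
  by (auto simp: subspace_def k.subspace_def ks_def)

lemma span_k_subset: "k.span X \<subseteq> span X"
  by (rule k.span_minimal) (auto simp: subspace_k span_base)

lemma subspace_mm: "subspace (mm N)"
  by (simp add: mm_def)

lemma mm_subset: "subspace N \<Longrightarrow> mm N \<subseteq> N"
  unfolding mm_def by (rule span_minimal) (auto simp: subspace_scale)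

lemma sc_eq_sum_mon:
  "sc s y = (\<Sum>u\<in>keys s. sc (mon u) (ks (lookup s u) y))"
  by (subst poly_mapping_sum_singles[of s])
     (simp add: scale_sum_left ks_def Const_mult_single mult.commute[of _ "Const _"])

text \<open>Every monomial of \<open>s\<close> is divisible by a variable, which can be pulled
  out.\<close>

lemma sc_mm:
  assumes "subspace N" "y \<in> N" "lookup s 0 = 0"
  shows "sc s y \<in> mm N"
proof -
  have "sc (mon u) (ks (lookup s u) y) \<in> mm N" if "u \<in> keys s" for u
  proof -
    have "u \<noteq> 0" using that assms(3) by (auto simp: in_keys_iff)
    then obtain i w where u: "u = single i 1 + w" by (rule monomial_nonzero_E)
    have "sc (mon w) (ks (lookup s u) y) \<in> N"
      using assms by (auto simp: ks_def subspace_scale)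
    moreover have "sc (mon u) z = sc (Var i) (sc (mon w) z)" for z
      by (simp add: u Var_def mon_mult)
    ultimately show ?thesis unfolding mm_def by (intro span_base) blast
  qed
  then show ?thesis unfolding sc_eq_sum_mon[of s] by (rule subspace_sum[OF subspace_mm])
qed

lemma sum_representation:
  assumes "independent B" "x \<in> span B"
  shows "x = (\<Sum>b | representation B x b \<noteq> 0. sc (representation B x b) b)"
  using sum_nonzero_representation_eq[OF assms] by simp

lemma sum_representation_finite:
  assumes "independent B" "x \<in> span B" "finite B"
  shows "(\<Sum>b\<in>B. sc (representation B x b) b) = x"
  using assms by (intro sum_representation_eq) auto

text \<open>The criterion that replaces the quotient by m. Vanishing constant terms define a
  submodule that contains all \<open>sc (Var i) y\<close>; conversely, each term of the basis
  expansion of such an \<open>x\<close> lies in mN.\<close>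

lemma mm_span_iff:
  assumes "independent B"
  shows "x \<in> mm (span B) \<longleftrightarrow> x \<in> span B \<and> (\<forall>b. ccoeff B x b = 0)"
proof
  let ?N = "{x \<in> span B. \<forall>b. ccoeff B x b = 0}"
  assume "x \<in> mm (span B)"
  moreover have "subspace ?N"
    using assms by (intro subspaceI)
      (auto simp: representation_zero span_zero span_add representation_add lookup_add span_scale
        representation_scale lookup_mult_0)
  then have "mm (span B) \<subseteq> ?N"
    unfolding mm_def using assms
    by (intro span_minimal) (auto simp: span_scale representation_scale lookup_mult_0
      lookup_Var_0)
  ultimately show "x \<in> span B \<and> (\<forall>b. ccoeff B x b = 0)" by blast
next
  assume x: "x \<in> span B \<and> (\<forall>b. ccoeff B x b = 0)"
  have "sc (representation B x b) b \<in> mm (span B)" if "representation B x b \<noteq> 0" for b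
    using x representation_ne_zero[OF that] by (intro sc_mm) (auto simp: span_base)
  then have "(\<Sum>b | representation B x b \<noteq> 0. sc (representation B x b) b) \<in> mm (span B)"
    by (intro subspace_sum[OF subspace_mm]) auto
  then show "x \<in> mm (span B)" using sum_representation[OF assms] x by simp
qed

text \<open>The S-linear extension of \<psi> to S \<otimes> N, sending s \<otimes> y to s \<psi>(y),
  in the model by finitely supported maps. For \<open>id\<close> it multiplies out coefficients
  taken from the module itself.\<close>

definition lin_ext :: "('n::ab_group_add \<Rightarrow> 'c) \<Rightarrow> (('v \<Rightarrow>\<^sub>0 nat) \<Rightarrow>\<^sub>0 'n) \<Rightarrow> 'c"
  where "lin_ext \<psi> p = (\<Sum>u\<in>keys p. sc (mon u) (\<psi> (lookup p u)))"

text \<open>Compare the coefficients at a monomial of least total degree: they see \<open>p\<close> only through its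
  values modulo the irrelevant ideal.\<close>

lemma lin_ext_id_inject:
  assumes B: "independent B"
    and p: "\<And>u. lookup p u \<in> span B"
      "\<And>u. lookup p u \<in> mm (span B) \<Longrightarrow> lookup p u = 0"
    and 0: "lin_ext id p = 0"
  shows "p = 0"
proof (rule ccontr)
  assume "p \<noteq> 0"
  then have "\<exists>u. u \<in> keys p" by (metis ex_in_conv keys_eq_empty)
  then obtain u where u: "u \<in> keys p"
    and least: "\<And>w. w \<in> keys p \<Longrightarrow> total_deg u \<le> total_deg w"
    using ex_has_least_nat[of "\<lambda>u. u \<in> keys p" _ total_deg] by metis
  let ?r = "\<lambda>w b. representation B (lookup p w) b"
  have "ccoeff B (lookup p u) b = 0" for b
  proof -
    have "0 = representation B (lin_ext id p) b" by (simp add: 0 representation_zero)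
    also have "\<dots> = (\<Sum>w\<in>keys p. mon w * ?r w b)"
      unfolding lin_ext_def using B p(1)
      by (simp add: representation_sum representation_scale span_scale)
    finally have "lookup 0 u =
        lookup (\<Sum>w\<in>keys p. mon w * ?r w b) u"
      by (rule arg_cong)
    then have "0 = (\<Sum>w\<in>keys p. lookup (mon w * ?r w b) u)"
      by (simp add: lookup_sum)
    also have "\<dots> = (\<Sum>w\<in>{u}. lookup (mon w * ?r w b) u)"
    proof (rule sum.mono_neutral_right)
      show "\<forall>w\<in>keys p - {u}. lookup (mon w * ?r w b) u = 0"
      proof
        fix w assume w: "w \<in> keys p - {u}"
        \<comment> \<open>No other monomial w of the support divides u: minimality would force t = 0
          and hence w = u.\<close>
        have "u \<noteq> w + t" for t
          using w least[of w] by (auto simp: total_deg_add total_deg_eq_0_iff)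
        then show "lookup (mon w * ?r w b) u = 0" by (rule lookup_single_mult_0)
      qed
    qed (use u in auto)
    also have "\<dots> = ccoeff B (lookup p u) b"
      using lookup_single_mult[of u 1 "?r u b" 0] by simp
    finally show ?thesis by simp
  qed
  then have "lookup p u = 0" using p(1) by (intro p(2)) (simp add: mm_span_iff[OF B])
  then show False using u by (simp add: in_keys_iff)
qed

end

lemma lookup_tensor_poly:
  assumes "vector_space kn"
  shows "lookup (tensor_poly kn s y) u = kn (lookup s u) y"
proof -
  interpret vector_space kn by fact
  have "lookup (tensor_poly kn s y) u =
      (\<Sum>w\<in>keys s. if w = u then kn (lookup s w) y else 0)"
    unfolding tensor_poly_def lookup_sum by (intro sum.cong) (auto simp: lookup_single when_def)
  then show ?thesis by (simp add: sum.delta' not_in_keys_iff_lookup_eq_zero)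
qed

context mpol_module begin

lemma lin_ext_superset:
  assumes "finite U" "keys p \<subseteq> U" "\<psi> 0 = 0"
  shows "lin_ext \<psi> p = (\<Sum>u\<in>U. sc (mon u) (\<psi> (lookup p u)))"
  unfolding lin_ext_def using assms by (intro sum_keys_eq) auto

lemma lin_ext_add:
  assumes "\<psi> 0 = 0" "\<And>x y. \<psi> (x + y) = \<psi> x + \<psi> y"
  shows "lin_ext \<psi> (p + q) = lin_ext \<psi> p + lin_ext \<psi> q"
proof -
  let ?U = "keys p \<union> keys q"
  have "lin_ext \<psi> r = (\<Sum>u\<in>?U. sc (mon u) (\<psi> (lookup r u)))" if "r \<in> {p, q, p + q}" for r
    using that keys_add[of p q] assms by (intro lin_ext_superset) auto
  then show ?thesis by (simp add: lookup_add assms scale_right_distrib sum.distrib)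
qed

lemma lin_ext_single: "\<psi> 0 = 0 \<Longrightarrow> lin_ext \<psi> (single u y) = sc (mon u) (\<psi> y)"
  by (simp add: lin_ext_def)

lemma lin_ext_0 [simp]: "lin_ext \<psi> 0 = 0"
  by (simp add: lin_ext_def)

lemma lin_ext_sum:
  assumes "\<psi> 0 = 0" "\<And>x y. \<psi> (x + y) = \<psi> x + \<psi> y"
  shows "lin_ext \<psi> (\<Sum>x\<in>X. f x) = (\<Sum>x\<in>X. lin_ext \<psi> (f x))"
  by (induction X rule: infinite_finite_induct) (auto simp: lin_ext_add assms)

lemma lin_ext_tensor_poly:
  assumes "Vector_Spaces.linear kn ks \<psi>"
  shows "lin_ext \<psi> (tensor_poly kn s y) = sc s (\<psi> y)"
proof -
  interpret \<psi>: Vector_Spaces.linear kn ks \<psi> by fact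
  show ?thesis
    unfolding tensor_poly_def
    by (simp add: lin_ext_sum \<psi>.add lin_ext_single \<psi>.scale sc_eq_sum_mon[of s])
qed

text \<open>A relation over S is an element of S \<otimes> \<open>k.span X\<close> that multiplies
  out to zero. Its coefficients lie in a space that meets mN trivially, so it vanishes, and
  independence over the field kills the coefficients of the relation.\<close>

lemma independent_of_mod_mm:
  assumes B: "independent B" and X: "X \<subseteq> span B" "k.independent X" "k.span X \<inter> mm (span B) \<subseteq> {0}"
  shows "independent X"
  unfolding dependent_explicit
proof (safe)
  fix t r v assume t: "finite t" "t \<subseteq> X" "(\<Sum>x\<in>t. sc (r x) x) = 0" and v: "v \<in> t" "r v \<noteq> 0"
  have vs: "vector_space ks" by unfold_locales
  have lin: "Vector_Spaces.linear ks ks id" by (rule k.linear_id)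
  define p where "p = (\<Sum>x\<in>t. tensor_poly ks (r x) x)"
  have lookup_p: "lookup p u = (\<Sum>x\<in>t. ks (lookup (r x) u) x)" for u
    by (simp add: p_def lookup_sum lookup_tensor_poly[OF vs])
  have in_span: "lookup p u \<in> k.span X" for u
    unfolding lookup_p using t(2) by (intro k.span_sum k.span_scale k.span_base) auto
  have "lin_ext id p = (\<Sum>x\<in>t. sc (r x) x)"
    unfolding p_def by (subst lin_ext_sum) (auto simp: lin_ext_tensor_poly[OF lin])
  then have "lin_ext id p = 0" using t(3) by simp
  moreover have "k.span X \<subseteq> span B"
    using span_k_subset[of X] span_minimal[OF X(1)] by auto
  ultimately have "p = 0"
    using in_span X(3) by (intro lin_ext_id_inject[OF B]) blast+
  then have "(\<Sum>x\<in>t. ks (lookup (r x) u) x) = 0" for u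
    using lookup_p[of u] by simp
  then have "lookup (r v) u = 0" for u
    using k.independentD[OF X(2) t(1,2), of "\<lambda>x. lookup (r x) u"] v(1) by blast
  then have "r v = 0" by (intro poly_mapping_eqI) simp
  then show False using v(2) by simp
qed

end


lemma linear_on_mm:
  assumes "mpol_module s1" "mpol_module s2" and N: "module.subspace s1 N"
    and f: "linear_on s1 s2 N f" "f ` N \<subseteq> N'" and x: "x \<in> mpol_module.mm s1 N"
  shows "f x \<in> mpol_module.mm s2 N'"
proof -
  interpret m1: mpol_module s1 by fact
  interpret m2: mpol_module s2 by fact
  have f0: "f 0 = 0"
    using f(1) m1.subspace_0[OF N] m1.scale_zero_left[of 0] m2.scale_zero_left[of "f 0"]
    unfolding linear_on_def by metis
  let ?S = "{x \<in> N. f x \<in> m2.mm N'}"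
  have "m1.subspace ?S"
    using f(1) N m2.subspace_mm[of N'] by (intro m1.subspaceI)
      (auto simp: linear_on_def f0 m1.subspace_0 m1.subspace_add m1.subspace_scale
        m2.subspace_0 m2.subspace_add m2.subspace_scale)
  moreover have "s1 (Var i) y \<in> ?S" if y: "y \<in> N" for i y
  proof -
    have "s2 (Var i) (f y) \<in> m2.mm N'"
      unfolding m2.mm_def using y f(2) by (intro m2.span_base) blast
    moreover have "f (s1 (Var i) y) = s2 (Var i) (f y)"
      using f(1) y by (simp add: linear_on_def)
    ultimately show ?thesis using m1.subspace_scale[OF N y] by simp
  qed
  ultimately have "m1.mm N \<subseteq> ?S" unfolding m1.mm_def by (intro m1.span_minimal) auto
  then show ?thesis using x by blast
qed

section \<open>Graded modules\<close>

text \<open>Each \<theta>(deg i) is a positive integer, so \<theta> of a monomial is at least its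
  total degree.\<close>

lemma positively_graded_theta:
  fixes deg :: "'v::finite \<Rightarrow> 'a::ab_group_add"
  assumes "positively_graded TYPE('k::comm_ring_1) deg"
  obtains \<theta> :: "'a \<Rightarrow> int" where "additive \<theta>" "\<And>u. u \<noteq> 0 \<Longrightarrow> \<theta> (mono_deg deg u) > 0"
proof -
  obtain \<theta> :: "'a \<Rightarrow> int" where add: "additive \<theta>" and pos: "\<And>i. \<theta> (deg i) > 0"
    using assms unfolding positively_graded_def by auto
  have "\<theta> (mono_deg deg u) > 0" if "u \<noteq> 0" for u
  proof -
    have "int (total_deg u) \<le> (\<Sum>i\<in>UNIV. \<Sum>_<lookup u i. \<theta> (deg i))"
      unfolding total_deg_def of_nat_sum
    proof (rule sum_mono)
      fix i
      have "int (lookup u i) = (\<Sum>_<lookup u i. 1)" by simp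
      also have "\<dots> \<le> (\<Sum>_<lookup u i. \<theta> (deg i))"
        using pos[of i] by (intro sum_mono) linarith
      finally show "int (lookup u i) \<le> \<dots>" .
    qed
    also have "\<dots> = \<theta> (mono_deg deg u)"
      by (simp only: mono_deg_def additive.sum[OF add])
    finally show ?thesis using that total_deg_eq_0_iff[of u] by linarith
  qed
  with add show thesis by (rule that)
qed

text \<open>Replaces a map known to be linear only on \<open>W\<close> by one that is linear on the
  whole type, extended from a basis of \<open>W\<close>.\<close>

lemma (in vector_space_pair) linear_extension_on:
  assumes W: "vs1.subspace W"
    and add: "\<And>x y. x \<in> W \<Longrightarrow> y \<in> W \<Longrightarrow> f (x + y) = f x + f y"
    and scale: "\<And>c x. x \<in> W \<Longrightarrow> f (s1 c x) = s2 c (f x)"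
  obtains g where "Vector_Spaces.linear s1 s2 g" "\<And>x. x \<in> W \<Longrightarrow> g x = f x"
proof -
  obtain X where X: "X \<subseteq> W" "vs1.independent X" "W \<subseteq> vs1.span X"
    by (rule vs1.basis_exists[of W])
  obtain g where g: "Vector_Spaces.linear s1 s2 g" "\<And>x. x \<in> X \<Longrightarrow> g x = f x"
    using linear_independent_extend[OF X(2)] by blast
  interpret g: Vector_Spaces.linear s1 s2 g by fact
  have f0: "f 0 = 0" using add[of 0 0] W vs1.subspace_0 by fastforce
  have "vs1.subspace {x \<in> W. g x = f x}"
    using W by (intro vs1.subspaceI)
      (auto simp: f0 add scale g.add g.scale vs1.subspace_0 vs1.subspace_add vs1.subspace_scale)
  then have "vs1.span X \<subseteq> {x \<in> W. g x = f x}"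
    using X g by (intro vs1.span_minimal) auto
  then show thesis using that g(1) X(3) by blast
qed

locale graded_mod = mpol_module sc
  for sc :: "('v::finite, 'k::field) mpol \<Rightarrow> 'c::ab_group_add \<Rightarrow> 'c" +
  fixes deg :: "'v \<Rightarrow> 'a::ab_group_add" and G :: "'a \<Rightarrow> 'c set"
  assumes graded: "graded_module deg sc G"
begin

lemma G_scale: "s \<in> poly_comp deg a \<Longrightarrow> y \<in> G b \<Longrightarrow> sc s y \<in> G (a + b)"
  using graded by (simp add: graded_module_def)

lemma G_indep:
  "finite X \<Longrightarrow> (\<And>a. a \<in> X \<Longrightarrow> f a \<in> G a) \<Longrightarrow> (\<Sum>a\<in>X. f a) = 0 \<Longrightarrow> a \<in> X \<Longrightarrow> f a = 0"
  using graded unfolding graded_module_def by blast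

lemma subspace_G: "k.subspace (G a)"
proof (rule k.subspaceI)
  show "ks c x \<in> G a" if "x \<in> G a" for c x
    using G_scale[OF Const_poly_comp that] by (simp add: ks_def)
qed (use graded in \<open>auto simp: graded_module_def\<close>)

lemmas G_0 = k.subspace_0[OF subspace_G]
  and G_add = k.subspace_add[OF subspace_G]
  and G_diff = k.subspace_diff[OF subspace_G]
  and G_ks = k.subspace_scale[OF subspace_G]
  and G_sum = k.subspace_sum[OF subspace_G]

lemma G_mon: "y \<in> G (a - mono_deg deg u) \<Longrightarrow> sc (mon u) y \<in> G a"
  using G_scale[OF single_poly_comp[of deg u, OF refl]] by fastforce

text \<open>By independence of the components, the terms of every other degree cancel among
  themselves.\<close>

lemma component_sum:
  assumes I: "finite I" "\<And>i. i \<in> I \<Longrightarrow> y i \<in> G (d i)" and x: "(\<Sum>i\<in>I. y i) \<in> G a"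
  shows "(\<Sum>i\<in>I. y i) = (\<Sum>i | i \<in> I \<and> d i = a. y i)"
proof -
  let ?s = "\<Sum>i\<in>I. y i"
  \<comment> \<open>The degree c part of the formal sum minus the value of the sum placed in degree
    a: these differences add up to zero, hence each of them vanishes.\<close>
  define f where "f c = (\<Sum>i | i \<in> I \<and> d i = c. y i) - (if c = a then ?s else 0)" for c
  have "f c \<in> G c" for c
    unfolding f_def using I x
    by (intro G_diff G_sum)
       (auto simp: G_0)
  moreover have "(\<Sum>c\<in>insert a (d ` I). f c) = 0"
  proof -
    have "(\<Sum>c\<in>insert a (d ` I). \<Sum>i | i \<in> I \<and> d i = c. y i) = ?s"
      using I by (intro sum.group) auto
    then show ?thesis using I by (simp add: f_def sum_subtractf)
  qed
  ultimately have "f a = 0" using I(1)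
    by (intro G_indep[where X = "insert a (d ` I)" and f = f and a = a]) auto
  then show ?thesis by (simp add: f_def)
qed

text \<open>Monomials and constants preserve homogeneity, so the span over the field is already a
  submodule.\<close>

lemma total_eq_span: "total sc G = k.span (\<Union>a. G a)"
proof
  let ?U = "k.span (\<Union>a. G a)"
  have "sc s x \<in> ?U" if "x \<in> ?U" for s x
    using that
  proof (induction rule: k.span_induct_alt)
    case (step c x y)
    then obtain b where x: "x \<in> G b" by auto
    have "sc (mon u) (ks e x) \<in> ?U" for u e
      using G_scale[OF single_poly_comp[of deg u, OF refl] k.subspace_scale[OF subspace_G x]]
      by (blast intro: k.span_base)
    then have "sc s x \<in> ?U" unfolding sc_eq_sum_mon[of s] by (intro k.span_sum)
    then have "ks c (sc s x) + sc s y \<in> ?U" using step by (intro k.span_add k.span_scale)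
    moreover have "sc s (ks c x + y) = ks c (sc s x) + sc s y"
      by (simp add: scale_right_distrib ks_def mult.commute)
    ultimately show ?case by simp
  qed (simp add: k.span_zero)
  then have "subspace ?U"
    by (intro subspaceI) (auto intro: k.span_zero k.span_add)
  then show "total sc G \<subseteq> ?U" unfolding total_def by (intro span_minimal k.span_superset)
  show "?U \<subseteq> total sc G" unfolding total_def by (rule span_k_subset)
qed

lemma subspace_total: "subspace (total sc G)"
  by (simp add: total_def)

lemma G_subset_total: "G a \<subseteq> total sc G"
  unfolding total_def by (auto intro: span_base)

lemma homogeneous_decomposition:
  assumes "x \<in> total sc G"
  obtains I :: "'c set" and y d where "finite I" "\<And>i. i \<in> I \<Longrightarrow> y i \<in> G (d i)" "x = (\<Sum>i\<in>I. y i)"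
proof -
  obtain I r where I: "finite I" "I \<subseteq> (\<Union>a. G a)" "x = (\<Sum>i\<in>I. ks (r i) i)"
    using assms unfolding total_eq_span k.span_explicit by auto
  have "\<forall>i\<in>I. \<exists>a. i \<in> G a" using I(2) by auto
  then obtain d where d: "\<And>i. i \<in> I \<Longrightarrow> i \<in> G (d i)" by metis
  show thesis using I d G_ks that[of I "\<lambda>i. ks (r i) i" d] by auto
qed

text \<open>Cutting every coordinate down to its terms of degree \<open>a - dg b\<close> still
  represents \<open>x\<close>, since \<open>x\<close> is homogeneous; uniqueness of coordinates
  shows that nothing was cut.\<close>

lemma representation_homogeneous:
  assumes B: "independent B" "\<And>b. b \<in> B \<Longrightarrow> b \<in> G (dg b)" and x: "x \<in> G a" "x \<in> span B"
    and b: "b \<in> B"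
  shows "representation B x b \<in> poly_comp deg (a - dg b)"
proof -
  let ?r = "representation B x"
  let ?I = "{b. ?r b \<noteq> 0}"
  let ?l = "\<lambda>b u. single u (lookup (?r b) u)"
  define h where "h b = (\<Sum>u | u \<in> keys (?r b) \<and> mono_deg deg u + dg b = a. ?l b u)" for b
  have fin: "finite ?I" by (rule finite_representation)
  have IB: "?I \<subseteq> B" by (auto dest: representation_ne_zero)
  have x_eq: "x = (\<Sum>b\<in>?I. sc (?r b) b)" by (rule sum_representation[OF B(1) x(2)])
  also have "\<dots> = (\<Sum>b\<in>?I. \<Sum>u\<in>keys (?r b). sc (?l b u) b)"
    by (intro sum.cong refl, subst poly_mapping_sum_singles) (simp add: scale_sum_left)
  also have "\<dots> = (\<Sum>(b, u)\<in>Sigma ?I (\<lambda>b. keys (?r b)). sc (?l b u) b)"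
    using fin by (subst sum.Sigma) auto
  also have "\<dots> = (\<Sum>bu | bu \<in> Sigma ?I (\<lambda>b. keys (?r b)) \<and>
      mono_deg deg (snd bu) + dg (fst bu) = a. case bu of (b, u) \<Rightarrow> sc (?l b u) b)"
  proof (rule component_sum)
    show "(\<Sum>(b, u)\<in>Sigma ?I (\<lambda>b. keys (?r b)). sc (?l b u) b) \<in> G a"
      using x(1) calculation by simp
  qed (use fin IB B(2) in \<open>auto intro!: G_scale single_poly_comp\<close>)
  also have "\<dots> = (\<Sum>(b, u)\<in>Sigma ?I (\<lambda>b. {u. u \<in> keys (?r b) \<and>
      mono_deg deg u + dg b = a}). sc (?l b u) b)"
    by (intro sum.cong) auto
  also have "\<dots> = (\<Sum>b\<in>?I. sc (h b) b)"
    using fin by (subst sum.Sigma[symmetric]) (auto simp: h_def scale_sum_left)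
  finally have "(\<Sum>b\<in>?I. sc (?r b - h b) b) = 0"
    using x_eq by (simp add: scale_left_diff_distrib sum_subtractf)
  then have "?r b - h b = 0" if "b \<in> ?I" for b
    using independentD[OF B(1) fin IB, of "\<lambda>b. ?r b - h b"] that by blast
  moreover have "h b = 0" if "b \<notin> ?I"
    using that by (auto simp: h_def)
  ultimately have "?r b = h b" by (cases "b \<in> ?I") auto
  moreover have "h b \<in> poly_comp deg (a - dg b)"
    unfolding h_def by (intro poly_comp_sum single_poly_comp) auto
  ultimately show ?thesis by simp
qed

end

text \<open>Discarding the terms of wrong degree from an arbitrary preimage leaves a preimage, by
  independence of the components of the target.\<close>

lemma lift_homogeneous:
  fixes s1 :: "('v::finite, 'k::field) mpol \<Rightarrow> 'c::ab_group_add \<Rightarrow> 'c"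
    and s2 :: "('v, 'k) mpol \<Rightarrow> 'e::ab_group_add \<Rightarrow> 'e"
  assumes "graded_mod s1 deg G1" "graded_mod s2 deg G2"
    and f: "linear_on s1 s2 (total s1 G1) f" "\<And>x a. x \<in> G1 a \<Longrightarrow> f x \<in> G2 a"
    and z: "z \<in> G2 a" "z \<in> f ` total s1 G1"
  shows "z \<in> f ` G1 a"
proof -
  interpret m1: graded_mod s1 deg G1 by fact
  interpret m2: graded_mod s2 deg G2 by fact
  obtain w where w: "w \<in> total s1 G1" "z = f w" using z(2) by blast
  obtain I :: "'c set" and y d where I: "finite I" "\<And>i. i \<in> I \<Longrightarrow> y i \<in> G1 (d i)" "w = (\<Sum>i\<in>I. y i)"
    using m1.homogeneous_decomposition[OF w(1)] by blast
  have "f (\<Sum>i\<in>I'. y i) = (\<Sum>i\<in>I'. f (y i)) \<and> (\<Sum>i\<in>I'. y i) \<in> total s1 G1"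
    if "finite I'" "I' \<subseteq> I" for I'
    using that
  proof (induction I')
    case empty
    have "f (s1 0 0) = s2 0 (f 0)"
      using f(1) m1.subspace_0[OF m1.subspace_total] unfolding linear_on_def by blast
    then show ?case by (simp add: m1.subspace_0[OF m1.subspace_total])
  next
    case (insert i I')
    then have "y i \<in> total s1 G1" using I(2) m1.G_subset_total by blast
    with insert show ?case
      using f(1) by (simp add: linear_on_def m1.subspace_add[OF m1.subspace_total])
  qed
  then have sum: "f (\<Sum>i\<in>I'. y i) = (\<Sum>i\<in>I'. f (y i))" if "I' \<subseteq> I" for I'
    using that finite_subset[OF that I(1)] by blast
  have "z = (\<Sum>i\<in>I. f (y i))" by (simp add: w(2) I(3) sum)
  also have "\<dots> = (\<Sum>i | i \<in> I \<and> d i = a. f (y i))"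
    using I z(1) calculation by (intro m2.component_sum) (auto intro: f(2))
  also have "\<dots> = f (\<Sum>i | i \<in> I \<and> d i = a. y i)" by (rule sum[symmetric]) auto
  finally show ?thesis using I(2) by (auto intro!: m1.G_sum)
qed

section \<open>Coordinates over the field and constant parts\<close>

context mpol_module begin

lemma independent_k:
  assumes "independent B" shows "k.independent B"
proof
  assume "k.dependent B"
  then obtain t r v where *: "finite t" "t \<subseteq> B" "(\<Sum>x\<in>t. sc (Const (r x)) x) = 0" "v \<in> t" "r v \<noteq> 0"
    unfolding k.dependent_explicit ks_def by blast
  have "(Const (r v) :: ('v, 'k) mpol) = 0"
    by (rule independentD[OF assms *(1-2) _ *(4), of "\<lambda>x. Const (r x)"]) (rule *(3))
  then show False using *(5) by (metis Const_def lookup_single_eq lookup_zero)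
qed

lemma representation_k_span:
  assumes B: "independent B" and x: "x \<in> k.span B"
  shows "representation B x b = Const (ccoeff B x b)"
proof -
  let ?S = "{x \<in> span B. \<forall>b. representation B x b = Const (ccoeff B x b)}"
  have "k.subspace ?S"
    using B by (intro k.subspaceI) (auto simp: representation_zero span_zero span_add
      representation_add lookup_add Const_add ks_def representation_scale span_scale
      lookup_Const_mult Const_mult)
  moreover have "B \<subseteq> ?S"
  proof
    fix y assume y: "y \<in> B"
    have "Const (lookup (Const e :: ('v, 'k) mpol) 0) = (Const e :: ('v, 'k) mpol)" for e
      by (simp add: Const_def)
    from this[of 0] this[of 1] show "y \<in> ?S"
      using y B by (simp add: representation_basis span_base)
  qed
  ultimately have "k.span B \<subseteq> ?S" by (intro k.span_minimal)
  then show ?thesis using x by blast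
qed

lemma span_independent_disjoint:
  assumes X: "independent (T \<union> B)" "T \<inter> B = {}"
  shows "span T \<inter> span B = {0}"
proof -
  have "v = 0" if "v \<in> span T" "v \<in> span B" for v
  proof -
    have T: "representation (T \<union> B) v = representation T v"
      by (rule representation_extend[OF X(1) that(1)]) auto
    have B: "representation (T \<union> B) v = representation B v"
      by (rule representation_extend[OF X(1) that(2)]) auto
    have "representation T v b = 0" for b
      using representation_ne_zero[of T v b] representation_ne_zero[of B v b] X(2) T B by auto
    moreover have "independent T" by (rule independent_mono[OF X(1)]) auto
    ultimately show "v = 0" using sum_representation[of T v] that by simp
  qed
  then show ?thesis by (auto intro: span_zero)
qed

text \<open>On \<open>span B\<close> this is the projection onto \<open>k.span B\<close> with kernel
  m \<open>span B\<close>: a linear model of reduction modulo m inside the module itself.\<close>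

lemma constant_part:
  assumes B: "independent B" "finite B"
  obtains \<kappa> where "Vector_Spaces.linear ks ks \<kappa>"
    "\<And>x. x \<in> span B \<Longrightarrow> \<kappa> x = (\<Sum>b\<in>B. ks (ccoeff B x b) b)"
    "\<And>b. b \<in> B \<Longrightarrow> \<kappa> b = b"
    "\<And>x. x \<in> span B \<Longrightarrow> \<kappa> x = 0 \<longleftrightarrow> x \<in> mm (span B)"
proof -
  interpret p: vector_space_pair ks ks by unfold_locales
  let ?\<kappa> = "\<lambda>x. \<Sum>b\<in>B. ks (ccoeff B x b) b"
  have add: "?\<kappa> (x + y) = ?\<kappa> x + ?\<kappa> y" if "x \<in> span B" "y \<in> span B" for x y
    using B(1) that by (simp add: representation_add lookup_add k.scale_left_distrib sum.distrib)
  have scale: "?\<kappa> (ks c x) = ks c (?\<kappa> x)" if "x \<in> span B" for c x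
    using B(1) that by (simp add: ks_def[of c x] representation_scale lookup_Const_mult k.scale_sum_right)
  have sub: "k.subspace (span B)" by (simp add: subspace_k)
  obtain \<kappa> where \<kappa>: "Vector_Spaces.linear ks ks \<kappa>" "\<And>x. x \<in> span B \<Longrightarrow> \<kappa> x = ?\<kappa> x"
    using p.linear_extension_on[of "span B" ?\<kappa>, OF sub add scale] by blast
  have fixB: "?\<kappa> b = b" if "b \<in> B" for b
  proof -
    have "?\<kappa> b = (\<Sum>b'\<in>B. if b' = b then b else 0)"
      using B that by (intro sum.cong) (auto simp: representation_basis)
    then show ?thesis using B that by simp
  qed
  have "\<kappa> x = 0 \<longleftrightarrow> x \<in> mm (span B)" if x: "x \<in> span B" for x
  proof -
    have "\<kappa> x = 0 \<longleftrightarrow> (\<forall>b\<in>B. ccoeff B x b = 0)"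
      using k.independentD[OF independent_k[OF B(1)] B(2) order.refl, of "ccoeff B x"] \<kappa>(2)[OF x]
      by auto
    also have "\<dots> \<longleftrightarrow> (\<forall>b. ccoeff B x b = 0)"
      using representation_ne_zero[of B x] by (metis lookup_zero)
    finally show ?thesis using x by (simp add: mm_span_iff[OF B(1)])
  qed
  with \<kappa> fixB show thesis by (intro that[of \<kappa>]) (auto simp: span_base)
qed

end

context graded_mod begin

text \<open>Graded Nakayama: \<open>T\<close> is completed by elements of \<open>B\<close> to a basis modulo the irrelevant ideal,
  and induction on the \<open>\<theta>\<close>-degree of the basis elements shows that this is a generating set.\<close>

lemma complement_of_mod_mm:
  assumes pos: "positively_graded TYPE('k) deg"
    and B: "finite B" "B \<subseteq> (\<Union>a. G a)" "independent B" "span B = total sc G"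
    and T: "T \<subseteq> (\<Union>a. G a)" "k.independent T" "k.span T \<inter> mm (span B) \<subseteq> {0}"
  obtains D where "subspace D" "span T \<inter> D = {0}"
    "{x + y | x y. x \<in> span T \<and> y \<in> D} = span B"
proof -
  obtain \<theta> :: "'a \<Rightarrow> int" where \<theta>: "additive \<theta>" "\<And>u. u \<noteq> 0 \<Longrightarrow> \<theta> (mono_deg deg u) > 0"
    using positively_graded_theta[OF pos] by blast
  obtain \<kappa> where \<kappa>: "Vector_Spaces.linear ks ks \<kappa>"
    "\<And>x. x \<in> span B \<Longrightarrow> \<kappa> x = (\<Sum>b\<in>B. ks (ccoeff B x b) b)"
    "\<And>b. b \<in> B \<Longrightarrow> \<kappa> b = b"
    "\<And>x. x \<in> span B \<Longrightarrow> \<kappa> x = 0 \<longleftrightarrow> x \<in> mm (span B)"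
    using constant_part[OF B(3,1)] by blast
  interpret \<kappa>: Vector_Spaces.linear ks ks \<kappa> by (rule \<kappa>(1))
  have G_span: "G a \<subseteq> span B" for a unfolding B(4) by (rule G_subset_total)
  have T_span: "k.span T \<subseteq> span B"
    using T(1) G_span by (intro k.span_minimal) (auto simp: subspace_k)
  have inj_T: "inj_on \<kappa> (k.span T)"
    using T(3) T_span \<kappa>(4) by (auto simp: \<kappa>.inj_on_iff_eq_0[OF k.subspace_span])
  \<comment> \<open>Exchange modulo m: the image of T is independent because \<kappa> is injective
    on the span of T, and it is filled up by elements of B.\<close>
  obtain E where E: "\<kappa> ` T \<subseteq> E" "E \<subseteq> \<kappa> ` T \<union> B" "k.independent E" "\<kappa> ` T \<union> B \<subseteq> k.span E"
    using k.maximal_independent_subset_extend[of "\<kappa> ` T" "\<kappa> ` T \<union> B"]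
      \<kappa>.independent_injective_image[OF T(2) inj_T] by blast
  define B' where "B' = E - \<kappa> ` T"
  define X where "X = T \<union> B'"
  have B': "B' \<subseteq> B" using E by (auto simp: B'_def)
  have "\<kappa> ` B' = id ` B'" using B' \<kappa>(3) by (intro image_cong) auto
  then have \<kappa>B': "\<kappa> ` B' = B'" by simp
  have \<kappa>X: "\<kappa> ` X = E" unfolding X_def image_Un \<kappa>B' using E(1) by (auto simp: B'_def)
  have disj: "T \<inter> B' = {}"
  proof -
    have "False" if "t \<in> T" "t \<in> B'" for t
    proof -
      \<comment> \<open>An element of B is its own constant part, so it would lie in the image of T,
        which \<open>B'\<close> avoids.\<close>
      have "t \<in> B" using that B' by blast
      then have "t \<in> \<kappa> ` T" using \<kappa>(3)[of t] that(1) by (metis imageI)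
      then show False using that(2) by (simp add: B'_def)
    qed
    then show ?thesis by blast
  qed
  have "inj_on \<kappa> T" using inj_T by (rule inj_on_subset) (rule k.span_superset)
  moreover have "inj_on \<kappa> B'" using B' \<kappa>(3) by (metis inj_onI subset_iff)
  moreover have "\<kappa> ` T \<inter> \<kappa> ` B' = {}"
    unfolding \<kappa>B' by (auto simp: B'_def)
  ultimately have injX: "inj_on \<kappa> X" using disj by (auto simp: X_def inj_on_Un)
  have inj_span: "inj_on \<kappa> (k.span X)"
    using \<kappa>.inj_on_span_independent_image[OF _ injX] \<kappa>X E(3) by simp
  have X_indep: "k.independent X"
  proof
    assume "k.dependent X"
    then obtain x where x: "x \<in> X" "x \<in> k.span (X - {x})" unfolding k.dependent_def by auto
    then have "\<kappa> x \<in> k.span (\<kappa> ` (X - {x}))" by (simp add: \<kappa>.span_image)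
    also have "\<kappa> ` (X - {x}) = E - {\<kappa> x}" using injX x(1) \<kappa>X by (auto simp: inj_on_def)
    finally show False using E(3) x(1) \<kappa>X unfolding k.dependent_def by blast
  qed
  have X_G: "X \<subseteq> (\<Union>a. G a)" using T(1) B' B(2) by (auto simp: X_def)
  have X_span: "X \<subseteq> span B" using X_G G_span by blast
  have kX_span: "k.span X \<subseteq> span B" by (rule k.span_minimal[OF X_span]) (simp add: subspace_k)
  have "k.span X \<inter> mm (span B) \<subseteq> {0}"
  proof
    fix v assume "v \<in> k.span X \<inter> mm (span B)"
    then have "\<kappa> v = \<kappa> 0" "v \<in> k.span X" using \<kappa>(4) kX_span by auto
    then show "v \<in> {0}" using inj_onD[OF inj_span, of v 0] by (simp add: k.span_zero)
  qed
  then have X: "independent X" by (rule independent_of_mod_mm[OF B(3) X_span X_indep])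
  have "\<forall>x\<in>X \<union> B. \<exists>a. x \<in> G a" using X_G B(2) by blast
  then obtain dg where dg: "\<And>x. x \<in> X \<union> B \<Longrightarrow> x \<in> G (dg x)" by metis
  have \<kappa>G: "\<kappa> x \<in> G a" if x: "x \<in> G a" for x a
  proof -
    have "ks (ccoeff B x b) b \<in> G a" if b: "b \<in> B" for b
    proof (cases "ccoeff B x b = 0")
      case True
      then show ?thesis by (simp add: G_0)
    next
      case False
      have "representation B x b \<in> poly_comp deg (a - dg b)"
        using x b dg G_span by (intro representation_homogeneous[OF B(3)]) auto
      then have "mono_deg deg 0 = a - dg b" using False by (rule lookup_poly_comp)
      then show ?thesis using dg[of b] b by (simp add: G_ks)
    qed
    then show ?thesis
      using x G_span by (subst \<kappa>(2)) (auto intro: G_sum)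
  qed
  \<comment> \<open>A lower bound for the \<theta>-degrees in B, so that the induction can run over
    natural numbers; the inserted 0 covers an empty B.\<close>
  define m where "m = Min (insert 0 ((\<lambda>b. \<theta> (dg b)) ` B))"
  have "b \<in> span X" if "b \<in> B" for b
    using that
  proof (induction b rule: measure_induct_rule[of "\<lambda>b. nat (\<theta> (dg b) - m)"])
    case (less b)
    let ?a = "dg b"
    have "b \<in> k.span E" using E(4) less.prems by blast
    then have "\<kappa> b \<in> k.span (\<kappa> ` X)" by (simp add: \<kappa>(3)[OF less.prems] \<kappa>X)
    then obtain n where n: "n \<in> k.span X" "\<kappa> b = \<kappa> n" unfolding \<kappa>.span_image by blast
    then obtain t r where t: "finite t" "t \<subseteq> X" "n = (\<Sum>x\<in>t. ks (r x) x)"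
      unfolding k.span_explicit by auto
    \<comment> \<open>The part of n in the degree of b. It has the same constant part as n and makes
      \<open>b - n'\<close> homogeneous.\<close>
    define n' where "n' = (\<Sum>x | x \<in> t \<and> dg x = ?a. ks (r x) x)"
    have \<kappa>n: "\<kappa> n = (\<Sum>x\<in>t. ks (r x) (\<kappa> x))" by (simp add: t(3) \<kappa>.sum \<kappa>.scale)
    also have "\<dots> = (\<Sum>x | x \<in> t \<and> dg x = ?a. ks (r x) (\<kappa> x))"
    proof (rule component_sum[OF t(1)])
      show "(\<Sum>x\<in>t. ks (r x) (\<kappa> x)) \<in> G ?a"
        using \<kappa>G[OF dg[of b]] less.prems n(2) \<kappa>n by simp
      show "ks (r x) (\<kappa> x) \<in> G (dg x)" if "x \<in> t" for x
        using t(2) that dg \<kappa>G by (blast intro: G_ks)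
    qed
    finally have "\<kappa> n = \<kappa> n'" by (simp add: n'_def \<kappa>.sum \<kappa>.scale)
    then have 0: "\<kappa> (b - n') = 0" using n(2) by (simp add: \<kappa>.diff)
    have "n' \<in> G ?a" unfolding n'_def
      using t dg by (intro G_sum G_ks) force
    then have bn: "b - n' \<in> G ?a" using dg[of b] less.prems by (intro G_diff) auto
    then have bn_span: "b - n' \<in> span B" using G_span by auto
    then have mm0: "ccoeff B (b - n') b' = 0" for b'
      using 0 \<kappa>(4) mm_span_iff[OF B(3)] by blast
    \<comment> \<open>A coordinate without constant term contains only nontrivial monomials, so
      homogeneity gives b' a smaller \<theta>-degree than b whenever the coordinate is
      nonzero.\<close>
    have "sc (representation B (b - n') b') b' \<in> span X" if b': "b' \<in> B" for b'
    proof (cases "representation B (b - n') b' = 0")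
      case False
      then obtain u where u: "lookup (representation B (b - n') b') u \<noteq> 0"
        by (metis lookup_zero poly_mapping_eqI)
      then have "u \<noteq> 0" using mm0[of b'] by metis
      have "representation B (b - n') b' \<in> poly_comp deg (?a - dg b')"
        using dg bn bn_span b' by (intro representation_homogeneous[OF B(3)]) auto
      then have "mono_deg deg u = ?a - dg b'" using u by (rule lookup_poly_comp)
      then have "\<theta> (?a - dg b') > 0" using \<theta>(2)[OF \<open>u \<noteq> 0\<close>] by simp
      then have "\<theta> ?a > \<theta> (dg b')" by (simp add: additive.diff[OF \<theta>(1)])
      moreover have "m \<le> \<theta> (dg b')" unfolding m_def using B(1) b' by (intro Min_le) auto
      ultimately have "b' \<in> span X" using b' by (intro less.IH) auto
      then show ?thesis by (rule span_scale)
    qed (simp add: span_zero)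
    then have "(\<Sum>b'\<in>B. sc (representation B (b - n') b') b') \<in> span X" by (rule span_sum)
    then have "b - n' \<in> span X" by (simp add: sum_representation_finite[OF B(3) bn_span B(1)])
    moreover have "n' \<in> span X"
      unfolding n'_def ks_def using t by (intro span_sum span_scale span_base) auto
    ultimately show ?case using span_add[of "b - n'" X n'] by simp
  qed
  then have "span B \<subseteq> span X" by (intro span_minimal) auto
  then have XB: "span X = span B" using span_minimal[OF X_span] by auto
  show thesis
  proof (rule that)
    show "subspace (span B')" by simp
    show "span T \<inter> span B' = {0}"
      using X disj by (intro span_independent_disjoint) (simp_all add: X_def)
    show "{x + y | x y. x \<in> span T \<and> y \<in> span B'} = span B"
      unfolding XB[symmetric] X_def span_Un by simp
  qed
qed

end


section \<open>The complex \<open>\<^bold>L(N)\<close>\<close>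

lemma tensor_poly_scale_add_right:
  assumes "vector_space kn"
  shows "tensor_poly_scale kn s (p + q) = tensor_poly_scale kn s p + tensor_poly_scale kn s q"
proof -
  interpret kn: vector_space kn by fact
  let ?U = "keys p \<union> keys q"
  have "tensor_poly_scale kn s r = (\<Sum>u\<in>keys s. \<Sum>w\<in>?U.
      single (u + w) (kn (lookup s u) (lookup r w)))"
    if "r \<in> {p, q, p + q}" for r
    unfolding tensor_poly_scale_def using that keys_add[of p q]
    by (intro sum.cong refl sum_keys_eq[where f = "\<lambda>w y. single (_ + w) (kn _ y)"]) auto
  then show ?thesis
    by (simp add: lookup_add kn.scale_right_distrib single_add sum.distrib)
qed

lemma tensor_poly_scale_add_left:
  assumes "vector_space kn"
  shows "tensor_poly_scale kn (s + t) p = tensor_poly_scale kn s p + tensor_poly_scale kn t p"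
proof -
  interpret kn: vector_space kn by fact
  let ?U = "keys s \<union> keys t"
  have "tensor_poly_scale kn r p = (\<Sum>u\<in>?U. \<Sum>w\<in>keys p.
      single (u + w) (kn (lookup r u) (lookup p w)))"
    if "r \<in> {s, t, s + t}" for r
    unfolding tensor_poly_scale_def using that keys_add[of s t]
    by (intro sum_keys_eq[where f = "\<lambda>u c. \<Sum>w\<in>keys p.
      single (u + w) (kn c (lookup p w))"]) auto
  then show ?thesis
    by (simp add: lookup_add kn.scale_left_distrib single_add sum.distrib)
qed

lemma tensor_poly_scale_single_single:
  assumes "vector_space kn"
  shows "tensor_poly_scale kn (single u c) (single w y) =
    single (u + w) (kn c y)"
proof -
  interpret kn: vector_space kn by fact
  show ?thesis by (simp add: tensor_poly_scale_def)
qed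

text \<open>Both sides of each axiom are additive in every argument, so it suffices to compare
  single terms.\<close>

lemma module_tensor_poly_scale:
  fixes kn :: "'k::field \<Rightarrow> 'n::ab_group_add \<Rightarrow> 'n"
  assumes "vector_space kn"
  shows "module (tensor_poly_scale kn :: ('v, 'k) mpol \<Rightarrow> _)"
proof
  interpret kn: vector_space kn by fact
  fix s t :: "('v, 'k) mpol" and p q :: "('v \<Rightarrow>\<^sub>0 nat) \<Rightarrow>\<^sub>0 'n"
  note add = tensor_poly_scale_add_left[OF assms] tensor_poly_scale_add_right[OF assms]
  show "tensor_poly_scale kn s (p + q) = tensor_poly_scale kn s p + tensor_poly_scale kn s q"
    "tensor_poly_scale kn (s + t) p = tensor_poly_scale kn s p + tensor_poly_scale kn t p"
    by (fact add)+
  show "tensor_poly_scale kn 1 p = p"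
  proof (induction p rule: poly_mapping_additive_induct)
    case (single u y)
    show ?case using tensor_poly_scale_single_single[OF assms, of 0 1 u y] by simp
  qed (simp add: add)
  show "tensor_poly_scale kn s (tensor_poly_scale kn t p) = tensor_poly_scale kn (s * t) p"
  proof (induction s rule: poly_mapping_additive_induct)
    case s: (single u c)
    show ?case
    proof (induction t rule: poly_mapping_additive_induct)
      case t: (single w d)
      show ?case
        by (induction p rule: poly_mapping_additive_induct)
           (simp_all add: add tensor_poly_scale_single_single[OF assms] mult_single add.assoc)
    qed (simp add: add distrib_left)
  qed (simp add: add distrib_right)
qed

lemma (in mpol_module) lin_ext_scale:
  assumes "Vector_Spaces.linear kn ks \<psi>"
  shows "lin_ext \<psi> (tensor_poly_scale kn s p) = sc s (lin_ext \<psi> p)"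
proof -
  interpret \<psi>: Vector_Spaces.linear kn ks \<psi> by fact
  have vs: "vector_space kn" by unfold_locales
  note add = tensor_poly_scale_add_left[OF vs] tensor_poly_scale_add_right[OF vs]
    lin_ext_add[of \<psi>, OF \<psi>.zero \<psi>.add]
  show ?thesis
  proof (induction s rule: poly_mapping_additive_induct)
    case s: (single u c)
    show ?case
      by (induction p rule: poly_mapping_additive_induct)
         (simp_all add: add tensor_poly_scale_single_single[OF vs] lin_ext_single \<psi>.scale ks_def
           mult_single Const_mult_single mult.commute[of _ "Const _"] scale_right_distrib)
  qed (simp add: add scale_left_distrib)
qed

lemma (in mpol_module) module_hom_lin_ext:
  assumes "Vector_Spaces.linear kn ks \<psi>"
  shows "module_hom (tensor_poly_scale kn) sc (lin_ext \<psi>)"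
proof -
  interpret \<psi>: Vector_Spaces.linear kn ks \<psi> by fact
  have vs: "vector_space kn" by unfold_locales
  interpret tp: module "tensor_poly_scale kn :: ('v, 'k) mpol \<Rightarrow> _"
    by (rule module_tensor_poly_scale[OF vs])
  show ?thesis
    by unfold_locales (simp_all add: lin_ext_add \<psi>.add lin_ext_scale[OF assms])
qed

text \<open>Collects what the construction of L(N) uses of an E-module: scalars, grading and the
  degree shift by the generators. It applies to K and to its graded submodules alike; d d = 0 is
  inherited from F once L(N) is mapped there.\<close>

locale linear_emodule =
  fixes deg :: "'v::finite \<Rightarrow> 'a::ab_group_add"
    and N :: "('v, 'k::field, 'a, 'n::ab_group_add) emodule"
  assumes vector_space_kscl: "vector_space (kscl N)"
    and ract_add: "ract N (y + y') e = ract N y e + ract N y' e"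
    and ract_scale: "ract N (kscl N c y) e = kscl N c (ract N y e)"
    and subspace_ecmp: "module.subspace (kscl N) (ecmp N a j)"
    and lact_gen_ecmp: "y \<in> ecmp N a j \<Longrightarrow> lact_gen N j i y \<in> ecmp N (a - deg i) (j - 1)"
begin

sublocale n: vector_space "kscl N"
  by (rule vector_space_kscl)

lemmas ecmp_0 = n.subspace_0[OF subspace_ecmp]
  and ecmp_add = n.subspace_add[OF subspace_ecmp]
  and ecmp_scale = n.subspace_scale[OF subspace_ecmp]
  and ecmp_sum = n.subspace_sum[OF subspace_ecmp]

text \<open>N_j with all degrees in \<open>'a\<close> taken together; L(N)_j will be S \<otimes>
  N_j.\<close>

definition layer :: "int \<Rightarrow> 'n set"
  where "layer j = n.span (\<Union>a. ecmp N a j)"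

lemma subspace_layer: "n.subspace (layer j)"
  by (simp add: layer_def)

lemma ecmp_layer: "y \<in> ecmp N a j \<Longrightarrow> y \<in> layer j"
  unfolding layer_def by (auto intro: n.span_base)

lemma linear_lact_gen: "Vector_Spaces.linear (kscl N) (kscl N) (lact_gen N j i)"
  by unfold_locales
     (simp_all add: lact_gen_def ract_add ract_scale n.scale_right_distrib mult.commute)

lemma lact_gen_layer:
  assumes "y \<in> layer j" shows "lact_gen N j i y \<in> layer (j - 1)"
proof -
  interpret l: Vector_Spaces.linear "kscl N" "kscl N" "lact_gen N j i" by (rule linear_lact_gen)
  have "lact_gen N j i ` layer j = n.span (lact_gen N j i ` (\<Union>a. ecmp N a j))"
    unfolding layer_def by (rule l.span_image[symmetric])
  also have "\<dots> \<subseteq> layer (j - 1)"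
    by (intro n.span_minimal subspace_layer) (auto dest: lact_gen_ecmp ecmp_layer)
  finally show ?thesis using assms by blast
qed

sublocale tp: module "tensor_poly_scale (kscl N) :: ('v, 'k) mpol \<Rightarrow> _"
  by (rule module_tensor_poly_scale[OF vector_space_kscl])

lemma scl_LL [simp]: "scl (LL deg N) = tensor_poly_scale (kscl N)"
  by (simp add: LL_def)

lemma lookup_tensor_poly_scale_Const:
  "lookup (tensor_poly_scale (kscl N) (Const c) p) u =
    kscl N c (lookup p u)"
  by (induction p rule: poly_mapping_additive_induct)
     (simp_all add: Const_def tensor_poly_scale_single_single[OF vector_space_kscl]
       tensor_poly_scale_add_right[OF vector_space_kscl] n.scale_right_distrib lookup_add
       lookup_single when_def)

lemma tensor_poly_mon: "tensor_poly (kscl N) (mon u) y = single u y"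
  by (simp add: tensor_poly_def)

text \<open>Turns membership in a component into a condition on each coefficient: the monomial u
  uses up \<open>mono_deg deg u\<close> of the degree b, and N supplies the rest.\<close>

lemma cmp_LL: "cmp (LL deg N) j b = {p. \<forall>u. lookup p u \<in> ecmp N (b - mono_deg deg u) j}"
proof -
  interpret tpc: vector_space "\<lambda>c. tensor_poly_scale (kscl N) (Const c :: ('v, 'k) mpol)"
    by standard (simp_all add: tp.scale_right_distrib tp.scale_left_distrib Const_add Const_mult)
  let ?X = "{tensor_poly (kscl N) s y | a s y. s \<in> poly_comp deg (b - a) \<and> y \<in> ecmp N a j}"
  let ?P = "{p. \<forall>u. lookup p u \<in> ecmp N (b - mono_deg deg u) j}"
  have "tpc.subspace ?P"
    by (intro tpc.subspaceI)
       (auto simp: lookup_add lookup_tensor_poly_scale_Const intro: ecmp_0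
         ecmp_add ecmp_scale)
  moreover have "?X \<subseteq> ?P"
  proof safe
    fix a y u and s :: "('v, 'k) mpol" assume s: "s \<in> poly_comp deg (b - a)" and y: "y \<in> ecmp N a j"
    show "lookup (tensor_poly (kscl N) s y) u \<in> ecmp N (b - mono_deg deg u) j"
    proof (cases "lookup s u = 0")
      case True
      then show ?thesis
        by (simp add: lookup_tensor_poly[OF vector_space_kscl] ecmp_0)
    next
      case False
      then have "mono_deg deg u = b - a" by (rule lookup_poly_comp[OF s])
      then show ?thesis using y
        by (simp add: lookup_tensor_poly[OF vector_space_kscl] ecmp_scale)
    qed
  qed
  ultimately have "tpc.span ?X \<subseteq> ?P" by (intro tpc.span_minimal)
  moreover have "?P \<subseteq> tpc.span ?X"
  proof
    fix p assume p: "p \<in> ?P"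
    have "single u (lookup p u) \<in> tpc.span ?X" for u
    proof (rule tpc.span_base)
      have "mon u \<in> poly_comp deg (b - (b - mono_deg deg u))" by (intro single_poly_comp) simp
      then show "single u (lookup p u) \<in> ?X"
        unfolding tensor_poly_mon[symmetric] using p by blast
    qed
    then show "p \<in> tpc.span ?X" by (subst poly_mapping_sum_singles) (intro tpc.span_sum)
  qed
  ultimately show ?thesis by (simp add: LL_def)
qed

lemma single_cmp_LL: "y \<in> ecmp N a j \<Longrightarrow> single 0 y \<in> cmp (LL deg N) j a"
  by (auto simp: cmp_LL lookup_single when_def ecmp_0)

lemma cmp_LL_scale:
  assumes s: "s \<in> poly_comp deg a" and p: "p \<in> cmp (LL deg N) j b"
  shows "tensor_poly_scale (kscl N) s p \<in> cmp (LL deg N) j (a + b)"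
proof -
  have "tensor_poly_scale (kscl N) s p = (\<Sum>u\<in>keys s. \<Sum>w\<in>keys p.
      single (u + w) (kscl N (lookup s u) (lookup p w)))"
    by (simp add: tensor_poly_scale_def)
  moreover have "lookup (single (u + w)
      (kscl N (lookup s u) (lookup p w))) v
      \<in> ecmp N (a + b - mono_deg deg v) j" if u: "u \<in> keys s" for u w v
  proof (cases "v = u + w")
    case True
    have "mono_deg deg u = a" using s u by (simp add: poly_comp_def)
    then have eq: "a + b - mono_deg deg v = b - mono_deg deg w" by (simp add: True mono_deg_add)
    have "lookup p w \<in> ecmp N (b - mono_deg deg w) j" using p by (simp add: cmp_LL)
    then show ?thesis
      unfolding eq unfolding True by (simp add: ecmp_scale)
  qed (simp add: lookup_single when_def ecmp_0)
  ultimately show ?thesis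
    by (auto simp: cmp_LL lookup_sum intro!: ecmp_sum)
qed

lemma cmod_LL_subset: "cmod (LL deg N) j \<subseteq> {p. \<forall>u. lookup p u \<in> layer j}"
  (is "_ \<subseteq> ?P")
proof -
  have "tp.subspace ?P"
  proof (rule tp.subspaceI)
    fix s and p :: "('v \<Rightarrow>\<^sub>0 nat) \<Rightarrow>\<^sub>0 'n" assume p: "p \<in> ?P"
    show "tensor_poly_scale (kscl N) s p \<in> ?P"
      using p by (auto simp: tensor_poly_scale_def lookup_sum lookup_single when_def
        intro!: n.subspace_sum[OF subspace_layer] n.subspace_scale[OF subspace_layer]
          n.subspace_0[OF subspace_layer])
  qed (auto simp: lookup_add intro: n.subspace_0[OF subspace_layer] n.subspace_add[OF subspace_layer])
  then show ?thesis
    unfolding cmod_def total_def scl_LL by (intro tp.span_minimal) (auto simp: cmp_LL intro: ecmp_layer)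
qed

lemma dif_LL_cmp:
  assumes "p \<in> cmp (LL deg N) j b"
  shows "dif (LL deg N) j p \<in> cmp (LL deg N) (j - 1) b"
proof -
  have "lookup (single (single i 1 + u)
      (lact_gen N j i (lookup p u))) v \<in> ecmp N (b - mono_deg deg v) (j - 1)" for i u v
  proof (cases "v = single i 1 + u")
    case True
    have eq: "b - mono_deg deg v = b - mono_deg deg u - deg i"
      by (simp only: True mono_deg_add mono_deg_single) simp
    have "lookup p u \<in> ecmp N (b - mono_deg deg u) j" using assms by (simp add: cmp_LL)
    then show ?thesis unfolding eq unfolding True by (simp add: lact_gen_ecmp)
  qed (simp add: lookup_single when_def ecmp_0)
  moreover have "dif (LL deg N) j p = (\<Sum>i\<in>UNIV. \<Sum>u\<in>keys p.
      single (single i 1 + u) (lact_gen N j i (lookup p u)))"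
    by (simp add: LL_def)
  ultimately show ?thesis
    unfolding cmp_LL by (simp only: lookup_sum mem_Collect_eq) (intro allI ecmp_sum)
qed

lemma basis_layer_exists:
  obtains \<beta> where "\<beta> \<subseteq> (\<Union>a. ecmp N a j)" "n.independent \<beta>" "n.span \<beta> = layer j"
proof -
  obtain \<beta> where \<beta>: "\<beta> \<subseteq> (\<Union>a. ecmp N a j)" "n.independent \<beta>" "(\<Union>a. ecmp N a j) \<subseteq> n.span \<beta>"
    by (rule n.maximal_independent_subset)
  have "n.span \<beta> = layer j"
    unfolding layer_def using \<beta> by (simp add: n.span_eq) (meson n.span_superset order_trans)
  with \<beta> show thesis by (intro that)
qed

end


section \<open>Realizing \<open>\<^bold>L(N)\<close> inside a minimal free complex\<close>

locale free_complex =
  fixes deg :: "'v::finite \<Rightarrow> 'a::ab_group_add"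
    and F :: "('v, 'k::field, 'a, 'f::ab_group_add) gcomplex"
  assumes positively_graded: "positively_graded TYPE('k) deg"
    and graded_complex: "graded_complex deg F"
    and finite_basis: "\<exists>B. finite B \<and> basis_of F j B"
begin

sublocale gr: graded_mod "scl F" deg "cmp F j" for j
proof -
  have "graded_module deg (scl F) (cmp F j)" for j
    using graded_complex by (simp add: graded_complex_def)
  then show "graded_mod (scl F) deg (cmp F j)" for j
    by (simp add: graded_mod_def graded_mod_axioms_def mpol_module_def graded_module_def)
qed

lemma dif_add: "x \<in> cmod F j \<Longrightarrow> y \<in> cmod F j \<Longrightarrow> dif F j (x + y) = dif F j x + dif F j y"
  and dif_scale: "x \<in> cmod F j \<Longrightarrow> dif F j (scl F s x) = scl F s (dif F j x)"
  and dif_cmp: "x \<in> cmp F j a \<Longrightarrow> dif F j x \<in> cmp F (j - 1) a"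
  and dif_dif: "x \<in> cmod F j \<Longrightarrow> dif F (j - 1) (dif F j x) = 0"
  using graded_complex by (simp_all add: graded_complex_def linear_on_def image_subset_iff)

lemma cmod_subspace: "gr.subspace (cmod F j)"
  by (simp add: cmod_def gr.subspace_total)

lemmas cmod_0 = gr.subspace_0[OF cmod_subspace]
  and cmod_add = gr.subspace_add[OF cmod_subspace]
  and cmod_neg = gr.subspace_neg[OF cmod_subspace]
  and cmod_scale = gr.subspace_scale[OF cmod_subspace]
  and cmod_sum = gr.subspace_sum[OF cmod_subspace]

lemma cmp_cmod: "x \<in> cmp F j a \<Longrightarrow> x \<in> cmod F j"
  unfolding cmod_def using gr.G_subset_total by blast

lemma dif_0: "dif F j 0 = 0"
  using dif_scale[of 0 j 0] cmod_0 by simp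

lemma dif_sum: "(\<And>x. x \<in> X \<Longrightarrow> f x \<in> cmod F j) \<Longrightarrow> dif F j (\<Sum>x\<in>X. f x) = (\<Sum>x\<in>X. dif F j (f x))"
  by (induction X rule: infinite_finite_induct)
     (auto simp: dif_0 dif_add cmod_sum)

end

text \<open>Although stated on homogeneous elements of N only, \<open>dif_\<psi>\<close> makes the
  S-linear extension of \<psi> a chain map L(N) \<rightarrow> F.\<close>

locale strand_map = free_complex deg F + linear_emodule deg N
  for deg :: "'v::finite \<Rightarrow> 'a::ab_group_add"
    and F :: "('v, 'k::field, 'a, 'f::ab_group_add) gcomplex"
    and N :: "('v, 'k, 'a, 'n::ab_group_add) emodule" +
  fixes \<psi> :: "int \<Rightarrow> 'n \<Rightarrow> 'f"
  assumes linear_\<psi>: "Vector_Spaces.linear (kscl N) gr.ks (\<psi> j)"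
    and \<psi>_cmp: "y \<in> ecmp N a j \<Longrightarrow> \<psi> j y \<in> cmp F j a"
    and dif_\<psi>: "y \<in> ecmp N a j \<Longrightarrow>
      dif F j (\<psi> j y) = (\<Sum>i\<in>UNIV. scl F (Var i) (\<psi> (j - 1) (lact_gen N j i y)))"
begin

sublocale \<psi>: Vector_Spaces.linear "kscl N" gr.ks "\<psi> j" for j
  by (rule linear_\<psi>)

lemma \<psi>_cmod: "y \<in> layer j \<Longrightarrow> \<psi> j y \<in> cmod F j"
proof -
  have "\<psi> j ` layer j \<subseteq> cmod F j"
    unfolding layer_def \<psi>.span_image[symmetric]
    by (intro gr.k.span_minimal gr.subspace_k[OF cmod_subspace]) (auto intro: cmp_cmod[OF \<psi>_cmp])
  then show "y \<in> layer j \<Longrightarrow> \<psi> j y \<in> cmod F j" by blast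
qed

lemma dif_\<psi>_layer:
  assumes "y \<in> layer j"
  shows "dif F j (\<psi> j y) = (\<Sum>i\<in>UNIV. scl F (Var i) (\<psi> (j - 1) (lact_gen N j i y)))"
proof -
  interpret l: Vector_Spaces.linear "kscl N" "kscl N" "lact_gen N j i" for i by (rule linear_lact_gen)
  let ?S = "{y \<in> layer j. dif F j (\<psi> j y) =
    (\<Sum>i\<in>UNIV. scl F (Var i) (\<psi> (j - 1) (lact_gen N j i y)))}"
  have ks: "dif F j (gr.ks c x) = gr.ks c (dif F j x)" if "x \<in> cmod F j" for c x
    using dif_scale[OF that] by (simp add: gr.ks_def)
  have "n.subspace ?S"
  proof (rule n.subspaceI)
    show "kscl N c x \<in> ?S" if "x \<in> ?S" for c x
      using that by (auto simp: \<psi>.scale l.scale ks \<psi>_cmod n.subspace_scale[OF subspace_layer]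
        gr.k.scale_sum_right) (simp add: gr.ks_def mult.commute)
  qed (auto simp: n.subspace_0[OF subspace_layer] dif_0 n.subspace_add[OF subspace_layer]
    \<psi>.add l.add dif_add \<psi>_cmod gr.scale_right_distrib sum.distrib)
  then have "layer j \<subseteq> ?S"
    unfolding layer_def by (rule n.span_minimal[rotated]) (auto simp: dif_\<psi> layer_def[symmetric] ecmp_layer)
  then show ?thesis using assms by blast
qed

end

text \<open>The added condition is injectivity of N_j \<rightarrow> F_j/mF_j, which will make L(N)
  \<rightarrow> F an embedding with quasi-split image.\<close>

locale strand_data = strand_map deg F N \<psi>
  for deg :: "'v::finite \<Rightarrow> 'a::ab_group_add"
    and F :: "('v, 'k::field, 'a, 'f::ab_group_add) gcomplex"
    and N :: "('v, 'k, 'a, 'n::ab_group_add) emodule"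
    and \<psi> :: "int \<Rightarrow> 'n \<Rightarrow> 'f" +
  assumes \<psi>_mod_mm: "y \<in> layer j \<Longrightarrow> \<psi> j y \<in> gr.mm (cmod F j) \<Longrightarrow> y = 0"
begin

abbreviation \<phi> :: "int \<Rightarrow> (('v \<Rightarrow>\<^sub>0 nat) \<Rightarrow>\<^sub>0 'n) \<Rightarrow> 'f"
  where "\<phi> j \<equiv> gr.lin_ext (\<psi> j)"

definition strand :: "('v, 'k, 'a, 'f) gcomplex"
  where "strand = F\<lparr>cmp := (\<lambda>j a. \<phi> j ` cmp (LL deg N) j a)\<rparr>"

lemma strand_simps [simp]:
  "scl strand = scl F" "dif strand = dif F" "cmp strand j a = \<phi> j ` cmp (LL deg N) j a"
  by (simp_all add: strand_def)

sublocale \<phi>: module_hom "tensor_poly_scale (kscl N)" "scl F" "\<phi> j" for j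
  by (rule gr.module_hom_lin_ext[OF linear_\<psi>])

lemma dif_\<phi>:
  assumes p: "p \<in> cmod (LL deg N) j"
  shows "dif F j (\<phi> j p) = \<phi> (j - 1) (dif (LL deg N) j p)"
proof -
  have p': "lookup p u \<in> layer j" for u using p cmod_LL_subset by blast
  have "dif F j (\<phi> j p) =
      (\<Sum>u\<in>keys p. scl F (mon u) (dif F j (\<psi> j (lookup p u))))"
    unfolding gr.lin_ext_def using p'
    by (simp add: dif_sum dif_scale \<psi>_cmod cmod_scale)
  also have "\<dots> = (\<Sum>u\<in>keys p. \<Sum>i\<in>UNIV. scl F (mon (single i 1 + u))
      (\<psi> (j - 1) (lact_gen N j i (lookup p u))))"
    by (simp add: dif_\<psi>_layer[OF p'] gr.scale_sum_right Var_def mult_single add.commute)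
  also have "\<dots> = \<phi> (j - 1) (dif (LL deg N) j p)"
    unfolding LL_def by (subst sum.swap) (simp add: \<phi>.sum gr.lin_ext_single)
  finally show ?thesis .
qed

lemma basis_exists:
  obtains B where "finite B" "B \<subseteq> (\<Union>a. cmp F j a)" "gr.independent B" "gr.span B = cmod F j"
  using finite_basis[of j] unfolding basis_of_def by blast

text \<open>Pushing the coefficients of \<open>p\<close> through \<psi> gives a \<open>q\<close>
  that multiplies out to zero. None of its nonzero coefficients lies in mF, so \<open>q\<close> is
  zero, and injectivity of \<psi> returns to \<open>p\<close>.\<close>

lemma \<phi>_eq_0:
  assumes p: "\<And>u. lookup p u \<in> layer j" and 0: "\<phi> j p = 0"
  shows "p = 0"
proof -
  obtain B where B: "finite B" "B \<subseteq> (\<Union>a. cmp F j a)" "gr.independent B" "gr.span B = cmod F j"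
    by (rule basis_exists)
  define q where "q = (\<Sum>u\<in>keys p. single u (\<psi> j (lookup p u)))"
  have q: "lookup q u = \<psi> j (lookup p u)" for u
    by (simp add: q_def lookup_sum lookup_single when_def not_in_keys_iff_lookup_eq_zero)
  have "gr.lin_ext id q = gr.lin_ext (\<psi> j) p"
    unfolding q_def by (subst gr.lin_ext_sum) (auto simp: gr.lin_ext_single gr.lin_ext_def[of "\<psi> j"])
  then have "gr.lin_ext id q = 0" using 0 by simp
  then have "q = 0"
  proof (rule gr.lin_ext_id_inject[OF B(3), rotated 2])
    show "lookup q u \<in> gr.span B" for u by (simp add: q B(4) \<psi>_cmod p)
    show "lookup q u = 0" if "lookup q u \<in> gr.mm (gr.span B)" for u
      using \<psi>_mod_mm[OF p, of u] that by (simp add: q B(4))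
  qed
  then have "\<psi> j (lookup p u) = 0" for u using q[of u] by simp
  then have "lookup p u = 0" for u
    using \<psi>_mod_mm[OF p, of u] by (simp add: gr.subspace_0[OF gr.subspace_mm])
  then show ?thesis by (intro poly_mapping_eqI) simp
qed

lemma inj_on_\<phi>: "inj_on (\<phi> j) (cmod (LL deg N) j)"
proof -
  have "tp.subspace (cmod (LL deg N) j)" by (simp add: cmod_def total_def)
  then show ?thesis
    using cmod_LL_subset[of j] by (auto simp: \<phi>.inj_on_iff_eq_0 intro!: \<phi>_eq_0)
qed

lemma cmod_strand: "cmod strand j = \<phi> j ` cmod (LL deg N) j"
  unfolding cmod_def total_def by (simp add: \<phi>.span_image[symmetric] image_UN)

lemma cmp_strand_subset: "cmp strand j a \<subseteq> cmp F j a"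
proof
  fix x assume "x \<in> cmp strand j a"
  then obtain p where p: "p \<in> cmp (LL deg N) j a" "x = \<phi> j p" by auto
  show "x \<in> cmp F j a"
    unfolding p(2) gr.lin_ext_def using p(1)
    by (intro gr.G_sum gr.G_mon \<psi>_cmp) (simp add: cmp_LL)
qed

lemma cmod_strand_subset: "cmod strand j \<subseteq> cmod F j"
  unfolding cmod_def total_def strand_simps(1)
  using cmp_strand_subset by (intro gr.span_mono) blast

text \<open>Closure properties are transported from L(N) along the linear map; independence of
  components and d d = 0 are inherited from F.\<close>

lemma graded_complex_strand: "graded_complex deg strand"
  unfolding graded_complex_def
proof (intro conjI allI)
  fix j
  show "graded_module deg (scl strand) (cmp strand j)"
    unfolding graded_module_def
  proof (intro conjI allI ballI impI)
    show "module (scl strand)" unfolding strand_simps by unfold_locales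
    show "0 \<in> cmp strand j a" for a
    proof -
      have "0 \<in> cmp (LL deg N) j a" by (simp add: cmp_LL ecmp_0)
      then show ?thesis using \<phi>.zero[of j] by (auto intro!: image_eqI[of _ _ 0])
    qed
    show "x + y \<in> cmp strand j a" if xy: "x \<in> cmp strand j a" "y \<in> cmp strand j a" for a x y
    proof -
      obtain p q where "p \<in> cmp (LL deg N) j a" "q \<in> cmp (LL deg N) j a" "x = \<phi> j p" "y = \<phi> j q"
        using xy by auto
      then show ?thesis using \<phi>.add[of j p q]
        by (auto simp: cmp_LL lookup_add ecmp_add intro!: image_eqI[of _ _ "p + q"])
    qed
    show "scl strand s y \<in> cmp strand j (a + b)"
      if s: "s \<in> poly_comp deg a" and y: "y \<in> cmp strand j b" for a b s y
    proof -
      obtain p where "p \<in> cmp (LL deg N) j b" "y = \<phi> j p" using y by auto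
      then show ?thesis using cmp_LL_scale[OF s, of p] \<phi>.scale[of j s p]
        by (auto intro!: image_eqI[of _ _ "tensor_poly_scale (kscl N) s p"])
    qed
    show "f a = 0" if "finite X \<and> (\<forall>a\<in>X. f a \<in> cmp strand j a) \<and> sum f X = 0" "a \<in> X" for X f a
      using that cmp_strand_subset by (intro gr.G_indep[where X = X and f = f and a = a and j = j]) blast+
  qed
  show "linear_on (scl strand) (scl strand) (cmod strand j) (dif strand j)"
    using cmod_strand_subset[of j] by (auto simp: linear_on_def intro!: dif_add dif_scale)
  show "dif strand j ` cmp strand j a \<subseteq> cmp strand (j - 1) a" for a
  proof
    fix x assume "x \<in> dif strand j ` cmp strand j a"
    then obtain p where p: "p \<in> cmp (LL deg N) j a" "x = dif F j (\<phi> j p)" by auto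
    have "p \<in> cmod (LL deg N) j"
      unfolding cmod_def total_def using p(1) by (auto intro: tp.span_base)
    then show "x \<in> cmp strand (j - 1) a" using p dif_LL_cmp by (simp add: dif_\<phi>)
  qed
  show "\<forall>x\<in>cmod strand j. dif strand (j - 1) (dif strand j x) = 0"
    using cmod_strand_subset[of j] by (auto intro: dif_dif)
qed

definition layer_basis :: "int \<Rightarrow> 'n set"
  where "layer_basis j = (SOME \<beta>. \<beta> \<subseteq> (\<Union>a. ecmp N a j) \<and> n.independent \<beta> \<and> n.span \<beta> = layer j)"

lemma layer_basis:
  "layer_basis j \<subseteq> (\<Union>a. ecmp N a j)" "n.independent (layer_basis j)"
  "n.span (layer_basis j) = layer j"
proof -
  obtain \<beta> where "\<beta> \<subseteq> (\<Union>a. ecmp N a j)" "n.independent \<beta>" "n.span \<beta> = layer j"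
    by (rule basis_layer_exists)
  then have "\<exists>\<beta>. \<beta> \<subseteq> (\<Union>a. ecmp N a j) \<and> n.independent \<beta> \<and> n.span \<beta> = layer j" by blast
  from someI_ex[OF this, folded layer_basis_def] show
    "layer_basis j \<subseteq> (\<Union>a. ecmp N a j)" "n.independent (layer_basis j)"
    "n.span (layer_basis j) = layer j" by blast+
qed

abbreviation strand_basis :: "int \<Rightarrow> 'f set"
  where "strand_basis j \<equiv> \<psi> j ` layer_basis j"

lemma span_k_strand_basis: "gr.k.span (strand_basis j) = \<psi> j ` layer j"
  by (simp add: \<psi>.span_image layer_basis(3))

lemma strand_basis_cmp: "strand_basis j \<subseteq> (\<Union>a. cmp F j a)"
proof
  fix x assume "x \<in> strand_basis j"
  then obtain y a where "x = \<psi> j y" "y \<in> ecmp N a j" using layer_basis(1)[of j] by blast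
  then show "x \<in> (\<Union>a. cmp F j a)" using \<psi>_cmp by blast
qed

lemma strand_basis_mod_mm: "gr.k.span (strand_basis j) \<inter> gr.mm (cmod F j) \<subseteq> {0}"
proof
  fix x assume "x \<in> gr.k.span (strand_basis j) \<inter> gr.mm (cmod F j)"
  then obtain y where y: "x = \<psi> j y" "y \<in> layer j" "\<psi> j y \<in> gr.mm (cmod F j)"
    by (auto simp: span_k_strand_basis)
  then show "x \<in> {0}" using \<psi>_mod_mm[of y j] \<psi>.zero by simp
qed

lemma strand_basis_independent_k: "gr.k.independent (strand_basis j)"
proof (rule \<psi>.independent_injective_image[OF layer_basis(2)])
  show "inj_on (\<psi> j) (n.span (layer_basis j))"
    unfolding layer_basis(3) \<psi>.inj_on_iff_eq_0[OF subspace_layer]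
    by (auto intro!: \<psi>_mod_mm gr.subspace_0[OF gr.subspace_mm])
qed

lemma strand_basis_independent: "gr.independent (strand_basis j)"
proof -
  obtain B where B: "finite B" "B \<subseteq> (\<Union>a. cmp F j a)" "gr.independent B" "gr.span B = cmod F j"
    by (rule basis_exists)
  have "strand_basis j \<subseteq> gr.span B"
    unfolding B(4) using strand_basis_cmp cmp_cmod by blast
  then show ?thesis
    using strand_basis_mod_mm[of j] strand_basis_independent_k
    by (intro gr.independent_of_mod_mm[OF B(3)]) (auto simp: B(4))
qed

lemma strand_basis_cmp_strand: "strand_basis j \<subseteq> (\<Union>a. cmp strand j a)"
proof
  fix x assume "x \<in> strand_basis j"
  then obtain y a where y: "x = \<psi> j y" "y \<in> ecmp N a j" using layer_basis(1)[of j] by blast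
  then have "x = \<phi> j (single 0 y)" by (simp add: gr.lin_ext_single)
  then show "x \<in> (\<Union>a. cmp strand j a)" using single_cmp_LL[OF y(2)] by auto
qed

lemma span_strand_basis: "gr.span (strand_basis j) = cmod strand j"
proof
  show "gr.span (strand_basis j) \<subseteq> cmod strand j"
    unfolding cmod_def total_def strand_simps(1) by (rule gr.span_mono[OF strand_basis_cmp_strand])
  show "cmod strand j \<subseteq> gr.span (strand_basis j)"
  proof
    fix x assume "x \<in> cmod strand j"
    then obtain p where p: "p \<in> cmod (LL deg N) j" "x = \<phi> j p" unfolding cmod_strand by auto
    have "\<psi> j (lookup p u) \<in> gr.span (strand_basis j)" for u
      using p(1) cmod_LL_subset[of j] gr.span_k_subset[of "strand_basis j"]
      unfolding span_k_strand_basis by blast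
    then show "x \<in> gr.span (strand_basis j)"
      unfolding p(2) gr.lin_ext_def by (intro gr.span_sum gr.span_scale)
  qed
qed

lemma basis_of_strand: "basis_of strand j (strand_basis j)"
  unfolding basis_of_def strand_simps(1)
  by (intro conjI strand_basis_independent span_strand_basis strand_basis_cmp_strand)

text \<open>For y in N_j, d(\<psi> y) = \<Sum> x_i \<psi>(e_i y), and each \<psi>(e_i y) has
  constant coordinates in the image of a basis of N_(j-1). The entries are therefore sums of
  constants times variables.\<close>

lemma strongly_linear_strand: "strongly_linear deg strand"
  unfolding strongly_linear_def
proof (intro conjI exI[of _ strand_basis] allI ballI)
  fix j b b' assume b: "b \<in> strand_basis j" and b': "b' \<in> strand_basis (j - 1)"
  obtain y where y: "y \<in> layer_basis j" "b = \<psi> j y" using b by blast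
  then have "y \<in> layer j" using layer_basis(3)[of j] n.span_base by blast
  note dif = dif_\<psi>_layer[OF this]
  let ?B = "strand_basis (j - 1)"
  let ?z = "\<lambda>i. \<psi> (j - 1) (lact_gen N j i y)"
  have z: "?z i \<in> gr.k.span ?B" for i
    using lact_gen_layer[OF \<open>y \<in> layer j\<close>] by (simp add: span_k_strand_basis)
  have z': "?z i \<in> gr.span ?B" for i using z gr.span_k_subset by blast
  have "gr.representation ?B (dif F j b) b' = (\<Sum>i\<in>UNIV. Var i * gr.representation ?B (?z i) b')"
    unfolding y(2) dif
    by (simp add: gr.representation_sum gr.representation_scale strand_basis_independent z' gr.span_scale)
  also have "\<dots> = (\<Sum>i\<in>UNIV. Const (gr.ccoeff ?B (?z i) b') * Var i)"
    by (intro sum.cong refl, subst gr.representation_k_span[OF strand_basis_independent z])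
       (rule mult.commute)
  finally show "module.representation (scl strand) ?B (dif strand j b) b' \<in> linear_forms"
    by (simp add: linear_forms_sum linear_forms_Const_Var)
qed (fact graded_complex_strand basis_of_strand)+

text \<open>Graded Nakayama, applied to the image under \<psi> of a homogeneous basis of
  N_j.\<close>

lemma split_strand:
  obtains D where "gr.subspace D" "cmod strand j \<inter> D = {0}"
    "{x + y |x y. x \<in> cmod strand j \<and> y \<in> D} = cmod F j"
proof -
  obtain B where B: "finite B" "B \<subseteq> (\<Union>a. cmp F j a)" "gr.independent B" "gr.span B = cmod F j"
    by (rule basis_exists)
  have "gr.span B = total (scl F) (cmp F j)"
    "gr.k.span (strand_basis j) \<inter> gr.mm (gr.span B) \<subseteq> {0}"
    using B(4) strand_basis_mod_mm[of j] by (simp_all add: cmod_def)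
  note * = gr.complement_of_mod_mm[OF positively_graded B(1-3) this(1) strand_basis_cmp
      strand_basis_independent_k this(2)]
  show thesis
    by (rule *, rule that) (simp_all add: span_strand_basis B(4))
qed

lemma quasi_split_strand: "quasi_split_subcomplex deg strand F"
proof -
  have "\<exists>D. gr.subspace D \<and> cmod strand j \<inter> D = {0} \<and>
    {x + y |x y. x \<in> cmod strand j \<and> y \<in> D} = cmod F j" for j
    by (rule split_strand[of j]) blast
  moreover have "subcomplex deg strand F"
    using graded_complex_strand cmp_strand_subset by (auto simp: subcomplex_def)
  ultimately show ?thesis by (simp add: quasi_split_subcomplex_def)
qed

lemma complex_iso_strand: "complex_iso (LL deg N) strand"
  unfolding complex_iso_def
proof (intro exI[of _ \<phi>] allI conjI ballI)
  fix j
  show "linear_on (scl (LL deg N)) (scl strand) (cmod (LL deg N) j) (\<phi> j)"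
    by (simp add: linear_on_def \<phi>.add \<phi>.scale)
  show "bij_betw (\<phi> j) (cmod (LL deg N) j) (cmod strand j)"
    using inj_on_\<phi> cmod_strand by (auto simp: bij_betw_def)
qed (simp_all add: dif_\<phi>)

end


section \<open>The \<open>E\<close>-module \<open>K\<close>\<close>

text \<open>The sign in \<open>lact_gen\<close>. Being its own inverse, it will cancel against the
  same factor in \<open>func\<close>.\<close>

definition aux_sign :: "int \<Rightarrow> 'k::field"
  where "aux_sign j = (- 1) powi (- j)"

lemma aux_sign_nonzero [simp]: "aux_sign j \<noteq> 0"
  by (simp add: aux_sign_def)

lemma aux_sign_square [simp]: "aux_sign j * aux_sign j = (1 :: 'k::field)"
  unfolding aux_sign_def by (simp flip: power_int_mult_distrib)

text \<open>Moving e_i to its place in e_J passes exactly the elements of J below i.\<close>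

lemma ext_sign_singleton:
  "ext_sign {i} J = (if i \<in> J then 0 else (- 1) ^ card {j \<in> J. j < i})"
proof -
  have "{(a, j). a \<in> {i} \<and> j \<in> J \<and> j < a} = Pair i ` {j \<in> J. j < i}" by auto
  then have "card {(a, j). a \<in> {i} \<and> j \<in> J \<and> j < a} = card {j \<in> J. j < i}"
    by (simp add: card_image inj_on_def)
  then show ?thesis by (simp add: ext_sign_def)
qed

lemma ext_sign_insert_less:
  fixes J :: "'v::{finite,linorder} set"
  assumes "m < i" "m \<notin> J"
  shows "ext_sign {i} (insert m J) = - ext_sign {i} J"
proof -
  have "{j \<in> insert m J. j < i} = insert m {j \<in> J. j < i}" using assms by auto
  then show ?thesis using assms by (auto simp: ext_sign_singleton)
qed

lemma ext_sign_insert_greater: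
  assumes "i < m"
  shows "ext_sign {i} (insert m J) = ext_sign {i} J"
proof -
  have "{j \<in> insert m J. j < i} = {j \<in> J. j < i}" using assms by auto
  then show ?thesis using assms by (auto simp: ext_sign_singleton)
qed

text \<open>The relation e_i e_k = - e_k e_i in coordinates: inserting the smaller index into J
  flips the sign belonging to the larger one, and not conversely. Repeated indices make both sides
  zero.\<close>

lemma ext_sign_anticommute:
  fixes J :: "'v::{finite,linorder} set"
  shows "ext_sign {k} J * ext_sign {i} (insert k J) =
    - (ext_sign {i} J * ext_sign {k} (insert i J) :: 'k::comm_ring_1)"
proof (cases "i = k \<or> i \<in> J \<or> k \<in> J")
  case True
  then show ?thesis by (auto simp: ext_sign_singleton)
next
  case False
  then show ?thesis
    by (cases i k rule: linorder_cases)
       (simp_all add: ext_sign_insert_less ext_sign_insert_greater)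
qed

lemma lookup_ext_gen: "lookup (ext_gen i) I = (if I = {i} then 1 else 0)"
  by (simp add: ext_gen_def lookup_single when_def)

lemma ext_mult_gen:
  "ext_mult (ext_gen i) (e :: ('v::linorder, 'k::comm_ring_1) ext) = (\<Sum>J\<in>keys e.
    single (insert i J) (ext_sign {i} J * lookup e J))"
proof -
  have "keys (ext_gen i :: ('v, 'k) ext) = {{i}}" by (simp add: ext_gen_def)
  then show ?thesis by (simp add: ext_mult_def lookup_ext_gen)
qed

lemma sum_fun_apply: "(\<Sum>x\<in>X. f x) e = (\<Sum>x\<in>X. f x e)"
  by (induction X rule: infinite_finite_induct) auto

locale koszul = graded_mod sM deg M
  for sM :: "('v::{finite,linorder}, 'k::field) mpol \<Rightarrow> 'm::ab_group_add \<Rightarrow> 'm"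
    and deg :: "'v \<Rightarrow> 'a::ab_group_add" and M :: "'a \<Rightarrow> 'm set"
begin

text \<open>An element of \<open>M \<otimes> \<omega>\<^sub>E\<close> is encoded by its values on the monomial basis of \<open>E\<close>.\<close>

definition hat :: "('v set \<Rightarrow> 'm) \<Rightarrow> ('v, 'k) ext \<Rightarrow> 'm"
  where "hat g e = (\<Sum>I\<in>UNIV. ks (lookup e I) (g I))"

lemma hat_single [simp]: "hat g (single I c) = ks c (g I)"
proof -
  have "hat g (single I c) = (\<Sum>J\<in>UNIV. if J = I then ks c (g I) else 0)"
    unfolding hat_def by (intro sum.cong) (auto simp: lookup_single when_def)
  then show ?thesis by simp
qed

lemma hat_inject: "hat g = hat g' \<longleftrightarrow> g = g'"
proof
  assume "hat g = hat g'"
  then have "hat g (single I 1) = hat g' (single I 1)" for I by simp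
  then show "g = g'" by (intro ext) simp
qed simp

lemma hat_add: "hat (\<lambda>I. g I + g' I) = hat g + hat g'"
  by (intro ext) (simp add: hat_def k.scale_right_distrib sum.distrib)

lemma hat_0: "hat (\<lambda>_. 0) = 0"
  by (intro ext) (simp add: hat_def)

lemma hat_scale: "hat (\<lambda>I. ks c (g I)) = fun_kscale sM c (hat g)"
proof
  fix e
  have "ks (lookup e I) (ks c (g I)) = ks c (ks (lookup e I) (g I))" for I
    by (simp add: mult.commute)
  then have "hat (\<lambda>I. ks c (g I)) e = ks c (hat g e)" by (simp only: hat_def k.scale_sum_right)
  then show "hat (\<lambda>I. ks c (g I)) e = fun_kscale sM c (hat g) e"
    by (simp add: fun_kscale_def ks_def)
qed

lemma hat_eq_0_iff: "hat g = 0 \<longleftrightarrow> (\<forall>I. g I = 0)"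
  using hat_inject[of g "\<lambda>_. 0"] by (auto simp: hat_0 fun_eq_iff)

lemma hat_arg_add: "hat g (e + e') = hat g e + hat g e'"
  by (simp add: hat_def lookup_add k.scale_left_distrib sum.distrib)

lemma hat_arg_sum: "hat g (\<Sum>x\<in>X. f x) = (\<Sum>x\<in>X. hat g (f x))"
proof -
  have "hat g 0 = 0" by (simp add: hat_def)
  then show ?thesis by (induction X rule: infinite_finite_induct) (auto simp: hat_arg_add)
qed

lemma vector_space_fun_kscale: "vector_space (fun_kscale sM)"
  by standard (auto simp: fun_kscale_def fun_eq_iff scale_right_distrib scale_left_distrib
    Const_add Const_mult)

sublocale fk: vector_space "fun_kscale sM"
  by (rule vector_space_fun_kscale)

lemma subspace_hat:
  assumes "P (\<lambda>_. 0)" "\<And>g g'. P g \<Longrightarrow> P g' \<Longrightarrow> P (\<lambda>I. g I + g' I)"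
    "\<And>c g. P g \<Longrightarrow> P (\<lambda>I. ks c (g I))"
  shows "fk.subspace (hat ` {g. P g})"
proof (rule fk.subspaceI)
  show "0 \<in> hat ` {g. P g}" using assms(1) hat_0 by (force intro!: image_eqI[of _ _ "\<lambda>_. 0"])
  show "x + y \<in> hat ` {g. P g}" if xy: "x \<in> hat ` {g. P g}" "y \<in> hat ` {g. P g}" for x y
  proof -
    obtain g g' where g: "P g" "P g'" "x = hat g" "y = hat g'" using xy by auto
    show ?thesis unfolding g(3,4) hat_add[symmetric] using assms(2)[OF g(1,2)] by blast
  qed
  show "fun_kscale sM c x \<in> hat ` {g. P g}" if x: "x \<in> hat ` {g. P g}" for c x
  proof -
    obtain g where g: "P g" "x = hat g" using x by auto
    show ?thesis unfolding g(2) hat_scale[symmetric] using assms(3)[OF g(1)] by blast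
  qed
qed

text \<open>Contraction by e_i in coordinates, including the sign of the left action on auxiliary
  degree j.\<close>

definition contr :: "int \<Rightarrow> 'v \<Rightarrow> ('v set \<Rightarrow> 'm) \<Rightarrow> 'v set \<Rightarrow> 'm"
  where "contr j i g = (\<lambda>J. ks (aux_sign j * ext_sign {i} J) (g (insert i J)))"

abbreviation K :: "('v, 'k, 'a, ('v, 'k) ext \<Rightarrow> 'm) emodule"
  where "K \<equiv> K_module deg sM M"

lemma K_simps [simp]: "kscl K = fun_kscale sM" "ract K = (\<lambda>\<phi> e e'. \<phi> (ext_mult e e'))"
  by (simp_all add: K_module_def R_summand_def)

lemma hat_ext_gen: "hat g (ext_mult (ext_gen i) e) =
  hat (\<lambda>J. ks (ext_sign {i} J) (g (insert i J))) e"
proof -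
  have "hat g (ext_mult (ext_gen i) e) =
      (\<Sum>J\<in>keys e. ks (ext_sign {i} J * lookup e J) (g (insert i J)))"
    by (simp add: ext_mult_gen hat_arg_sum)
  also have "\<dots> = (\<Sum>J\<in>UNIV. ks (ext_sign {i} J * lookup e J) (g (insert i J)))"
    by (intro sum_keys_eq[where f = "\<lambda>J c. ks (ext_sign {i} J * c) (g (insert i J))"]) auto
  also have "\<dots> = hat (\<lambda>J. ks (ext_sign {i} J) (g (insert i J))) e"
    by (simp add: hat_def mult.commute)
  finally show ?thesis .
qed

lemma lact_gen_hat: "lact_gen K j i (hat g) = hat (contr j i g)"
proof -
  have "lact_gen K j i (hat g) =
      fun_kscale sM (aux_sign j) (hat (\<lambda>J. ks (ext_sign {i} J) (g (insert i J))))"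
    by (simp add: lact_gen_def aux_sign_def hat_ext_gen)
  also have "\<dots> = hat (contr j i g)" by (simp add: hat_scale[symmetric] contr_def)
  finally show ?thesis .
qed

lemma R_dif_hat: "R_dif deg sM M 0 j (hat g) = hat (\<lambda>J. \<Sum>i\<in>UNIV. sM (Var i) (contr j i g J))"
proof
  fix e
  have "lact_gen (R_summand deg sM M 0) j i = lact_gen K j i" for i
    by (intro ext) (simp add: lact_gen_def K_module_def)
  then have "R_dif deg sM M 0 j (hat g) e = (\<Sum>i\<in>UNIV. sM (Var i) (hat (contr j i g) e))"
    by (simp add: R_dif_def lact_gen_hat)
  also have "\<dots> = (\<Sum>i\<in>UNIV. \<Sum>I\<in>UNIV. ks (lookup e I) (sM (Var i) (contr j i g I)))"
    unfolding hat_def by (simp add: scale_sum_right ks_def mult.commute)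
  also have "\<dots> = hat (\<lambda>J. \<Sum>i\<in>UNIV. sM (Var i) (contr j i g J)) e"
    unfolding hat_def by (subst sum.swap) (simp add: k.scale_sum_right)
  finally show "R_dif deg sM M 0 j (hat g) e = \<dots>" .
qed

text \<open>Coordinates of degree (b; j) in M_0 \<otimes> \<omega>_E. The degrees of e_I are
  negative and dualizing negates them again, so degree sum and cardinality appear without
  sign.\<close>

definition support_in :: "'a \<Rightarrow> int \<Rightarrow> ('v set \<Rightarrow> 'm) \<Rightarrow> bool"
  where "support_in b j g \<longleftrightarrow>
    (\<forall>I. g I \<in> M 0 \<and> (g I \<noteq> 0 \<longrightarrow> (\<Sum>i\<in>I. deg i) = b \<and> int (card I) = j))"

lemma support_in_0: "support_in b j (\<lambda>_. 0)"
  by (simp add: support_in_def G_0)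

lemma support_in_add: "support_in b j g \<Longrightarrow> support_in b j g' \<Longrightarrow> support_in b j (\<lambda>I. g I + g' I)"
  unfolding support_in_def by (metis add_0 G_add)

lemma support_in_scale: "support_in b j g \<Longrightarrow> support_in b j (\<lambda>I. ks c (g I))"
  unfolding support_in_def by (auto intro: G_ks)

lemma module_hom_eq_hat:
  assumes "module_hom ext_scale (*) f"
  shows "tensor_omega sM m f = hat (\<lambda>I. ks (f (single I 1)) m)"
proof
  fix e :: "('v, 'k) ext"
  interpret f: module_hom ext_scale "(*)" f by fact
  have "ext_scale c (single I 1) = single I c" for c :: 'k and I :: "'v set"
    by (rule poly_mapping_eqI) (simp add: lookup_ext_scale lookup_single when_def)
  then have single: "f (single I c) = c * f (single I 1)" for c I
    using f.scale[of c "single I 1"] by simp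
  have "f e = f (\<Sum>I\<in>keys e. single I (lookup e I))"
    by (rule arg_cong[OF poly_mapping_sum_singles])
  also have "\<dots> = (\<Sum>I\<in>keys e. lookup e I * f (single I 1))"
    unfolding f.sum by (intro sum.cong refl) (rule single)
  also have "\<dots> = (\<Sum>I\<in>UNIV. lookup e I * f (single I 1))"
    by (intro sum_keys_eq[where f = "\<lambda>I c. c * f (single I 1)"]) auto
  finally have "ks (f e) m = hat (\<lambda>I. ks (f (single I 1)) m) e"
    by (simp add: hat_def k.scale_sum_left)
  then show "tensor_omega sM m f e = hat (\<lambda>I. ks (f (single I 1)) m) e"
    by (simp add: tensor_omega_def ks_def)
qed

lemma ecmp_R_summand: "ecmp (R_summand deg sM M 0) b j = hat ` {g. support_in b j g}"
proof -
  let ?X = "{tensor_omega sM m f | m f. m \<in> M 0 \<and> f \<in> ecmp (omega deg) (b - 0) j}"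
  have "fk.span ?X \<subseteq> hat ` {g. support_in b j g}"
  proof (rule fk.span_minimal)
    show "?X \<subseteq> hat ` {g. support_in b j g}"
    proof safe
      fix m and f :: "('v, 'k) ext \<Rightarrow> 'k" assume m: "m \<in> M 0" and f: "f \<in> ecmp (omega deg) (b - 0) j"
      have hom: "module_hom ext_scale (*) f"
        and 0: "\<And>b' l e. (b', l) \<noteq> (- b, - j) \<Longrightarrow> e \<in> ext_comp deg b' l \<Longrightarrow> f e = 0"
        using f by (auto simp: omega_def)
      have "support_in b j (\<lambda>I. ks (f (single I 1)) m)"
        unfolding support_in_def
      proof (intro allI conjI impI)
        fix I
        show "ks (f (single I 1)) m \<in> M 0" by (rule k.subspace_scale[OF subspace_G m])
        assume "ks (f (single I 1)) m \<noteq> 0"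
        then have "f (single I 1) \<noteq> 0" by auto
        moreover have "single I 1 \<in> ext_comp deg (- (\<Sum>i\<in>I. deg i)) (- int (card I))"
          by (simp add: ext_comp_def)
        ultimately have "(- (\<Sum>i\<in>I. deg i), - int (card I)) = (- b, - j)"
          using 0 by blast
        then show "(\<Sum>i\<in>I. deg i) = b" "int (card I) = j" by auto
      qed
      then show "tensor_omega sM m f \<in> hat ` {g. support_in b j g}"
        unfolding module_hom_eq_hat[OF hom] by blast
    qed
    show "fk.subspace (hat ` {g. support_in b j g})"
      by (intro subspace_hat support_in_0 support_in_add support_in_scale)
  qed
  moreover have "hat ` {g. support_in b j g} \<subseteq> fk.span ?X"
  proof safe
    fix g assume g: "support_in b j g"
    \<comment> \<open>The functionals dual to the monomial basis of E.\<close>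
    let ?f = "\<lambda>I e. lookup e I :: 'k"
    have "tensor_omega sM (g I) (?f I) \<in> fk.span ?X" for I
    proof (cases "g I = 0")
      case True
      then have "tensor_omega sM (g I) (?f I) = 0" by (auto simp: tensor_omega_def)
      then show ?thesis by (simp add: fk.span_zero)
    next
      case False
      then have I: "(\<Sum>i\<in>I. deg i) = b" "int (card I) = j" "g I \<in> M 0"
        using g by (auto simp: support_in_def)
      interpret es: module "ext_scale :: 'k \<Rightarrow> ('v, 'k) ext \<Rightarrow> _" by (rule module_ext_scale)
      have "module_hom ext_scale (*) (?f I)"
        by unfold_locales (auto simp: lookup_ext_scale lookup_add algebra_simps)
      moreover have "lookup e I = 0" if "(b', l) \<noteq> (- b, - j)" "e \<in> ext_comp deg b' l"
        for b' l and e :: "('v, 'k) ext"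
        using that I by (auto simp: ext_comp_def in_keys_iff)
      ultimately have "?f I \<in> ecmp (omega deg) (b - 0) j"
        by (simp add: omega_def)
      then show ?thesis using I(3) by (intro fk.span_base) blast
    qed
    moreover have "hat g = (\<Sum>I\<in>UNIV. tensor_omega sM (g I) (?f I))"
      by (intro ext) (simp add: hat_def sum_fun_apply tensor_omega_def ks_def)
    ultimately show "hat g \<in> fk.span ?X" by (simp add: fk.span_sum)
  qed
  ultimately show ?thesis by (simp add: R_summand_def)
qed

text \<open>The kernel condition that defines K, as one equation in M for each basis element e_J of
  E.\<close>

definition cycle :: "int \<Rightarrow> ('v set \<Rightarrow> 'm) \<Rightarrow> bool"
  where "cycle j g \<longleftrightarrow> (\<forall>J. (\<Sum>i\<in>UNIV. sM (Var i) (contr j i g J)) = 0)"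

lemma ecmp_K: "ecmp K b j = hat ` {g. support_in b j g \<and> cycle j g}"
proof -
  have "ecmp K b j = {\<phi> \<in> ecmp (R_summand deg sM M 0) b j. R_dif deg sM M 0 j \<phi> = 0}"
    by (simp add: K_module_def)
  then show ?thesis by (auto simp: ecmp_R_summand R_dif_hat hat_eq_0_iff cycle_def)
qed

lemma contr_add: "contr j i (\<lambda>I. g I + g' I) = (\<lambda>I. contr j i g I + contr j i g' I)"
  by (simp add: contr_def k.scale_right_distrib)

lemma contr_scale: "contr j i (\<lambda>I. ks c (g I)) = (\<lambda>I. ks c (contr j i g I))"
  by (simp add: contr_def mult.commute mult.left_commute)

lemma cycle_0: "cycle j (\<lambda>_. 0)"
  by (simp add: cycle_def contr_def)

lemma cycle_add: "cycle j g \<Longrightarrow> cycle j g' \<Longrightarrow> cycle j (\<lambda>I. g I + g' I)"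
  by (simp add: cycle_def contr_add scale_right_distrib sum.distrib)

lemma cycle_scale:
  assumes "cycle j g" shows "cycle j (\<lambda>I. ks c (g I))"
  unfolding cycle_def contr_scale
proof
  fix J
  have "(\<Sum>i\<in>UNIV. sM (Var i) (ks c (contr j i g J))) = ks c (\<Sum>i\<in>UNIV. sM (Var i) (contr j i g J))"
    by (simp add: k.scale_sum_right) (simp add: ks_def mult.commute)
  then show "(\<Sum>i\<in>UNIV. sM (Var i) (ks c (contr j i g J))) = 0"
    using assms by (simp add: cycle_def)
qed

text \<open>The auxiliary signs agree in both orders, so this is anticommutation of the exterior
  signs.\<close>

lemma contr_anticommute:
  "contr (j - 1) k (contr j i g) J = - contr (j - 1) i (contr j k g) J"
proof -
  have "contr (j - 1) k (contr j i g) J =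
      ks (aux_sign (j - 1) * aux_sign j * (ext_sign {k} J * ext_sign {i} (insert k J)))
        (g (insert i (insert k J)))" for i k
    by (simp add: contr_def mult_ac)
  then show ?thesis
    by (simp only: ext_sign_anticommute[of k J i] insert_commute[of k i J]) simp
qed

lemma support_in_contr:
  assumes "support_in b j g" shows "support_in (b - deg i) (j - 1) (contr j i g)"
  unfolding support_in_def
proof (intro allI conjI impI)
  fix J
  have g: "g (insert i J) \<in> M 0" using assms by (simp add: support_in_def)
  show "contr j i g J \<in> M 0" unfolding contr_def by (rule k.subspace_scale[OF subspace_G g])
  assume "contr j i g J \<noteq> 0"
  then have "g (insert i J) \<noteq> 0" "i \<notin> J" by (auto simp: contr_def ext_sign_singleton split: if_splits)
  then show "(\<Sum>i\<in>J. deg i) = b - deg i" "int (card J) = j - 1"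
    using assms by (auto simp: support_in_def)
qed

text \<open>Makes K closed under the generators: by anticommutation, the equation at J for the
  contraction is a scalar multiple of the equation at \<open>insert i J\<close> for g.\<close>

lemma cycle_contr:
  assumes "cycle j g" shows "cycle (j - 1) (contr j i g)"
  unfolding cycle_def
proof
  fix J
  have "(\<Sum>k\<in>UNIV. sM (Var k) (contr (j - 1) k (contr j i g) J)) =
      (\<Sum>k\<in>UNIV. - ks (aux_sign (j - 1) * ext_sign {i} J) (sM (Var k) (contr j k g (insert i J))))"
    by (intro sum.cong refl, subst contr_anticommute)
       (simp add: contr_def[of "j - 1"] ks_def mult.commute)
  also have "\<dots> = - ks (aux_sign (j - 1) * ext_sign {i} J)
      (\<Sum>k\<in>UNIV. sM (Var k) (contr j k g (insert i J)))"
    by (simp add: sum_negf k.scale_sum_right)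
  also have "\<dots> = 0" using assms by (simp add: cycle_def)
  finally show "(\<Sum>k\<in>UNIV. sM (Var k) (contr (j - 1) k (contr j i g) J)) = 0" .
qed

lemma linear_emodule_K: "linear_emodule deg K"
proof (rule linear_emodule.intro)
  show "vector_space (kscl K)" by (simp add: vector_space_fun_kscale)
  show "ract K (y + y') e = ract K y e + ract K y' e" for y y' e by (simp add: fun_eq_iff)
  show "ract K (kscl K c y) e = kscl K c (ract K y e)" for c y e
    by (simp add: fun_eq_iff fun_kscale_def)
  show "module.subspace (kscl K) (ecmp K a j)" for a j
    unfolding K_simps ecmp_K
    by (rule subspace_hat) (auto intro: support_in_0 support_in_add support_in_scale
      cycle_0 cycle_add cycle_scale)
  show "lact_gen K j i y \<in> ecmp K (a - deg i) (j - 1)" if y: "y \<in> ecmp K a j" for y a j i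
  proof -
    obtain g where "support_in a j g" "cycle j g" "y = hat g" using y unfolding ecmp_K by blast
    then show ?thesis
      unfolding ecmp_K by (auto simp: lact_gen_hat support_in_contr cycle_contr)
  qed
qed

sublocale Kmod: linear_emodule deg K
  by (rule linear_emodule_K)

text \<open>A layer mixes the degrees in \<open>'a\<close>, so only the cardinality of I remains
  controlled.\<close>

lemma layer_K_E:
  assumes "y \<in> Kmod.layer j"
  obtains g where "y = hat g" "\<And>I. g I \<in> M 0" "\<And>I. g I \<noteq> 0 \<Longrightarrow> int (card I) = j" "cycle j g"
proof -
  let ?S = "hat ` {g. (\<forall>I. g I \<in> M 0 \<and> (g I \<noteq> 0 \<longrightarrow> int (card I) = j)) \<and> cycle j g}"
  have "fk.subspace ?S"
  proof (rule subspace_hat)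
    fix g g' assume g: "(\<forall>I. g I \<in> M 0 \<and> (g I \<noteq> 0 \<longrightarrow> int (card I) = j)) \<and> cycle j g"
      "(\<forall>I. g' I \<in> M 0 \<and> (g' I \<noteq> 0 \<longrightarrow> int (card I) = j)) \<and> cycle j g'"
    then have "\<forall>I. g I + g' I \<in> M 0 \<and> (g I + g' I \<noteq> 0 \<longrightarrow> int (card I) = j)"
      by (metis add_0 G_add)
    then show "(\<forall>I. g I + g' I \<in> M 0 \<and> (g I + g' I \<noteq> 0 \<longrightarrow> int (card I) = j)) \<and>
        cycle j (\<lambda>I. g I + g' I)"
      using g by (auto intro: cycle_add)
  qed (auto intro: cycle_0 cycle_scale G_0 G_ks)
  moreover have "(\<Union>a. ecmp K a j) \<subseteq> ?S"
    unfolding ecmp_K by (auto simp: support_in_def)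
  ultimately have "Kmod.layer j \<subseteq> ?S"
    unfolding Kmod.layer_def K_simps by (intro fk.span_minimal)
  then show thesis using assms that by auto
qed

text \<open>For i in I, the value at I reappears up to sign as the value of the contraction at
  \<open>I - {i}\<close>; \<open>j \<noteq> 0\<close> disposes of the empty I. In other words, the
  socle of K sits in auxiliary degree 0.\<close>

lemma layer_K_eq_0:
  assumes y: "y \<in> Kmod.layer j" and j: "j \<noteq> 0" and 0: "\<And>i. lact_gen K j i y = 0"
  shows "y = 0"
proof -
  obtain g where g: "y = hat g" "\<And>I. g I \<noteq> 0 \<Longrightarrow> int (card I) = j"
    using y by (rule layer_K_E) blast
  have "g I = 0" for I
  proof (cases "I = {}")
    case True
    then show ?thesis using g(2)[of I] j by auto
  next
    case False
    then obtain i where i: "i \<in> I" by auto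
    have "contr j i g (I - {i}) = 0"
      using 0[of i] unfolding g(1) lact_gen_hat by (simp add: hat_eq_0_iff)
    then show ?thesis using i by (auto simp: contr_def ext_sign_singleton insert_absorb)
  qed
  then show ?thesis unfolding g(1) by (simp add: hat_eq_0_iff)
qed

lemma layer_K_neg: "j < 0 \<Longrightarrow> y \<in> Kmod.layer j \<Longrightarrow> y = 0"
proof -
  assume j: "j < 0" and y: "y \<in> Kmod.layer j"
  obtain g where g: "y = hat g" "\<And>I. g I \<noteq> 0 \<Longrightarrow> int (card I) = j"
    using y by (rule layer_K_E) blast
  have "g I = 0" for I using g(2)[of I] j by linarith
  then show "y = 0" unfolding g(1) by (simp add: hat_eq_0_iff)
qed

end


section \<open>Lifting \<open>\<^bold>L(K)\<close> to the resolution\<close>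

text \<open>A linear choice of preimages inside \<open>W\<close>; the linearity of the lifts \<psi>
  rests on it.\<close>

lemma (in vector_space_pair) linear_right_inverse_on:
  assumes W: "vs1.subspace W"
    and add: "\<And>x y. x \<in> W \<Longrightarrow> y \<in> W \<Longrightarrow> f (x + y) = f x + f y"
    and scale: "\<And>c x. x \<in> W \<Longrightarrow> f (s1 c x) = s2 c (f x)"
  obtains g where "Vector_Spaces.linear s2 s1 g" "\<And>y. g y \<in> W" "\<And>w. w \<in> W \<Longrightarrow> f (g (f w)) = f w"
proof -
  obtain f' where f': "Vector_Spaces.linear s1 s2 f'" "\<And>x. x \<in> W \<Longrightarrow> f' x = f x"
    using linear_extension_on[OF W add scale] by blast
  obtain g where g: "g ` UNIV \<subseteq> W" "Vector_Spaces.linear s2 s1 g" "\<forall>v\<in>f' ` W. f' (g v) = v"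
    using linear_exists_right_inverse_on[OF f'(1) W] by blast
  have "g y \<in> W" for y using g(1) by blast
  moreover have "f (g (f w)) = f w" if "w \<in> W" for w
    using g(3) f'(2)[OF that] f'(2)[OF \<open>g (f w) \<in> W\<close>] that by force
  ultimately show thesis using that[OF g(2)] by blast
qed

lemma low_coeffs_mult:
  fixes s t :: "('v::finite, 'k::comm_ring_1) mpol"
  assumes "\<And>w. total_deg w < d \<Longrightarrow> lookup t w = 0" and "total_deg w < d"
  shows "lookup (s * t) w = 0"
proof (induction s rule: poly_mapping_additive_induct)
  case (single u c)
  show ?case
  proof (cases "\<exists>v. w = u + v")
    case True
    then obtain v where v: "w = u + v" by blast
    then have "total_deg v < d" using assms(2) by (simp add: total_deg_add)
    then show ?thesis unfolding v by (simp add: lookup_single_mult assms(1))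
  qed (simp add: lookup_single_mult_0)
qed (simp add: distrib_right lookup_add)

lemma low_coeffs_Var_mult:
  fixes t :: "('v::finite, 'k::comm_ring_1) mpol"
  assumes "lookup t 0 = 0" and "total_deg w < 2"
  shows "lookup (Var i * t) w = 0"
proof (cases "\<exists>v. w = single i 1 + v")
  case True
  then obtain v where v: "w = single i 1 + v" by blast
  then have "total_deg v = 0" using assms(2) unfolding v total_deg_add total_deg_single by simp
  then show ?thesis unfolding v Var_def lookup_single_mult by (simp add: total_deg_eq_0_iff assms(1))
qed (simp add: Var_def lookup_single_mult_0)

text \<open>The terms with i < k cancel those with k < i. The diagonal has its own assumption
  because 2 may be zero.\<close>

lemma sum_antisymmetric_0:
  fixes f :: "'i::{finite,linorder} \<Rightarrow> 'i \<Rightarrow> 'b::ab_group_add"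
  assumes "\<And>i. f i i = 0" "\<And>i k. f i k = - f k i"
  shows "(\<Sum>i\<in>UNIV. \<Sum>k\<in>UNIV. f i k) = 0"
proof -
  have split: "f i k = (if i < k then f i k else 0) - (if k < i then f k i else 0)" for i k
    using assms(1)[of i] assms(2)[of i k] by (cases i k rule: linorder_cases) auto
  have "(\<Sum>i\<in>UNIV. \<Sum>k\<in>UNIV. f i k) =
      (\<Sum>i\<in>UNIV. \<Sum>k\<in>UNIV. if i < k then f i k else 0) -
      (\<Sum>i\<in>UNIV. \<Sum>k\<in>UNIV. if k < i then f k i else 0)"
    by (subst split) (simp add: sum_subtractf)
  also have "\<dots> = 0" by (subst (2) sum.swap) simp
  finally show ?thesis .
qed

section \<open>The square of the irrelevant ideal\<close>

context mpol_module begin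

text \<open>Each of the two factors from m raises the order of every coordinate by one.\<close>

lemma low_coeffs_mm_mm:
  assumes B: "independent B" and x: "x \<in> mm (mm (span B))" and w: "total_deg w < 2"
  shows "lookup (representation B x b) w = 0"
proof -
  let ?S = "{x \<in> span B. \<forall>b w. total_deg w < 2 \<longrightarrow> lookup (representation B x b) w = 0}"
  have "subspace ?S"
    using B by (intro subspaceI)
      (auto simp: representation_zero span_zero span_add representation_add lookup_add span_scale
        representation_scale intro!: low_coeffs_mult[of 2])
  moreover have "sc (Var i) y \<in> ?S" if "y \<in> mm (span B)" for i y
    using that B by (auto simp: mm_span_iff span_scale representation_scale low_coeffs_Var_mult)
  ultimately have "mm (mm (span B)) \<subseteq> ?S"
    unfolding mm_def[of "mm (span B)"] by (intro span_minimal) auto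
  then show ?thesis using x w by blast
qed

text \<open>The coefficient of x_k in a coordinate of the sum is the constant term of that
  coordinate of \<open>v k\<close>; it vanishes because the sum lies in m^2.\<close>

lemma sum_Var_mm_mm:
  assumes B: "independent B" and v: "\<And>i. v i \<in> span B"
    and mm: "(\<Sum>i\<in>UNIV. sc (Var i) (v i)) \<in> mm (mm (span B))"
  shows "v k \<in> mm (span B)"
proof -
  have "ccoeff B (v k) b = 0" for b
  proof -
    let ?r = "\<lambda>i. representation B (v i) b"
    have "lookup (Var i * ?r i) (single k 1) = 0" if "i \<noteq> k" for i
      unfolding Var_def
    proof (rule lookup_single_mult_0)
      fix t show "single k (1::nat) \<noteq> single i 1 + t"
      proof
        assume "single k (1::nat) = single i 1 + t"
        then have "lookup (single k (1::nat)) i =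
            lookup (single i 1 + t) i" by (rule arg_cong)
        then show False using that by (simp add: lookup_add lookup_single)
      qed
    qed
    moreover have "lookup (Var k * ?r k) (single k 1) = ccoeff B (v k) b"
      using lookup_single_mult[of "single k 1" 1 "?r k" 0] by (simp add: Var_def)
    ultimately have "(\<Sum>i\<in>UNIV. lookup (Var i * ?r i) (single k 1)) =
        (\<Sum>i\<in>UNIV. if i = k then ccoeff B (v k) b else 0)"
      by (intro sum.cong) auto
    also have "\<dots> = ccoeff B (v k) b" by simp
    finally have "ccoeff B (v k) b =
        lookup (representation B (\<Sum>i\<in>UNIV. sc (Var i) (v i)) b) (single k 1)"
      using B v by (simp add: representation_sum representation_scale span_scale lookup_sum)
    also have "\<dots> = 0" by (rule low_coeffs_mm_mm[OF B mm]) (simp only: total_deg_single)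
    finally show ?thesis .
  qed
  then show ?thesis using v by (simp add: mm_span_iff[OF B])
qed

end

locale resolution = koszul sM deg M
  for sM :: "('v::{finite,linorder}, 'k::field) mpol \<Rightarrow> 'm::ab_group_add \<Rightarrow> 'm"
    and deg :: "'v \<Rightarrow> 'a::ab_group_add" and M :: "'a \<Rightarrow> 'm set" +
  fixes F :: "('v, 'k, 'a, 'f::ab_group_add) gcomplex" and \<epsilon> :: "'f \<Rightarrow> 'm"
  assumes positively_graded: "positively_graded TYPE('k) deg"
    and generated: "generated_in_degree 0 sM M"
    and resolution: "minimal_free_resolution deg sM M F \<epsilon>"
begin

sublocale free_complex deg F
  using positively_graded resolution
  by unfold_locales (auto simp: minimal_free_resolution_def)

lemma minimal: "x \<in> cmod F j \<Longrightarrow> dif F j x \<in> gr.mm (cmod F (j - 1))"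
  and cmod_neg: "j < 0 \<Longrightarrow> cmod F j = {0}"
  and \<epsilon>_add: "x \<in> cmod F 0 \<Longrightarrow> y \<in> cmod F 0 \<Longrightarrow> \<epsilon> (x + y) = \<epsilon> x + \<epsilon> y"
  and \<epsilon>_scale: "x \<in> cmod F 0 \<Longrightarrow> \<epsilon> (scl F s x) = sM s (\<epsilon> x)"
  and \<epsilon>_cmp: "x \<in> cmp F 0 a \<Longrightarrow> \<epsilon> x \<in> M a"
  and \<epsilon>_image: "\<epsilon> ` cmod F 0 = total sM M"
  and exact_0: "{x \<in> cmod F 0. \<epsilon> x = 0} = dif F 1 ` cmod F 1"
  and exact: "j \<ge> 1 \<Longrightarrow> {x \<in> cmod F j. dif F j x = 0} = dif F (j + 1) ` cmod F (j + 1)"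
  using resolution
  by (simp_all add: minimal_free_resolution_def linear_on_def image_subset_iff gr.mm_def)

lemma \<epsilon>_0: "\<epsilon> 0 = 0"
  using \<epsilon>_scale[of 0 0] cmod_0 by simp

lemma \<epsilon>_sum: "(\<And>x. x \<in> X \<Longrightarrow> f x \<in> cmod F 0) \<Longrightarrow> \<epsilon> (\<Sum>x\<in>X. f x) = (\<Sum>x\<in>X. \<epsilon> (f x))"
  by (induction X rule: infinite_finite_induct)
     (auto simp: \<epsilon>_0 \<epsilon>_add cmod_sum)

lemma \<epsilon>_ks: "x \<in> cmod F 0 \<Longrightarrow> \<epsilon> (gr.ks c x) = ks c (\<epsilon> x)"
  by (simp add: gr.ks_def ks_def \<epsilon>_scale)

lemma dif_ks: "x \<in> cmod F j \<Longrightarrow> dif F j (gr.ks c x) = gr.ks c (dif F j x)"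
  by (simp add: gr.ks_def dif_scale)

text \<open>Exactness turns the kernel into an image, and minimality puts images into mF.\<close>

lemma kernel_\<epsilon>_mm:
  assumes "x \<in> cmod F 0" "\<epsilon> x = 0" shows "x \<in> gr.mm (cmod F 0)"
proof -
  obtain w where "w \<in> cmod F 1" "x = dif F 1 w" using exact_0 assms by blast
  then show ?thesis using minimal[of w 1] by simp
qed

lemma kernel_dif_mm:
  assumes "j \<ge> 1" "x \<in> cmod F j" "dif F j x = 0" shows "x \<in> gr.mm (cmod F j)"
proof -
  obtain w where "w \<in> cmod F (j + 1)" "x = dif F (j + 1) w" using exact[OF assms(1)] assms by auto
  then show ?thesis using minimal[of w "j + 1"] by simp
qed

lemma \<epsilon>_mm:
  assumes "x \<in> gr.mm (cmod F 0)" shows "\<epsilon> x \<in> mm (total sM M)"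
  using \<epsilon>_image by (intro linear_on_mm[OF gr.mpol_module_axioms mpol_module_axioms cmod_subspace _ _ assms])
    (simp_all add: linear_on_def \<epsilon>_add \<epsilon>_scale)

lemma dif_mm:
  assumes "x \<in> gr.mm (cmod F j)" shows "dif F j x \<in> gr.mm (gr.mm (cmod F (j - 1)))"
  using minimal by (intro linear_on_mm[OF gr.mpol_module_axioms gr.mpol_module_axioms cmod_subspace _ _ assms])
    (auto simp: linear_on_def dif_add dif_scale)

text \<open>Because M is generated in degree 0, all monomials together cover M and the nontrivial
  ones cover mM. Keeping the generators in M_0 makes the degree of each term that of its
  monomial.\<close>

definition monspan :: "('v \<Rightarrow>\<^sub>0 nat) set \<Rightarrow> 'm set"
  where "monspan U = k.span {sM (mon u) y | u y. u \<in> U \<and> y \<in> M 0}"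

lemma monspan_scale:
  assumes U: "\<And>u. u \<in> U \<Longrightarrow> w + u \<in> U'" and x: "x \<in> monspan U"
  shows "sM (mon w) x \<in> monspan U'"
  using x unfolding monspan_def
proof (induction rule: k.span_induct_alt)
  case (step c y z)
  then obtain u m where y: "y = sM (mon u) m" "u \<in> U" "m \<in> M 0" by blast
  have "sM (mon (w + u)) m \<in> k.span {sM (mon u) y |u y. u \<in> U' \<and> y \<in> M 0}"
    using y U by (intro k.span_base) blast
  moreover have "sM (mon w) (ks c y + z) = ks c (sM (mon (w + u)) m) + sM (mon w) z"
    unfolding y by (simp add: scale_right_distrib ks_def mult_single Const_mult_single
      mult.commute[of _ "Const _"])
  ultimately show ?case using step by (auto intro: k.span_add k.span_scale)
qed (simp add: k.span_zero)

lemma subspace_monspan: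
  assumes U: "\<And>u w. u \<in> U \<Longrightarrow> w + u \<in> U"
  shows "subspace (monspan U)"
proof (rule subspaceI)
  fix s x assume "x \<in> monspan U"
  then have "ks c x \<in> monspan U" for c unfolding monspan_def by (rule k.span_scale)
  then have "sM (mon u) (ks c x) \<in> monspan U" for u c using monspan_scale[OF U] by blast
  then show "sM s x \<in> monspan U"
    unfolding sc_eq_sum_mon[of s] by (simp add: monspan_def k.span_sum)
qed (auto simp: monspan_def intro: k.span_zero k.span_add)

lemma total_subset_monspan: "total sM M \<subseteq> monspan UNIV"
proof -
  have "y \<in> monspan UNIV" if "y \<in> M 0" for y
  proof -
    have "sM (mon 0) y \<in> monspan UNIV" unfolding monspan_def using that by (intro k.span_base) blast
    then show ?thesis by simp
  qed
  then have "span (M 0) \<subseteq> monspan UNIV" by (intro span_minimal subspace_monspan) auto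
  then show ?thesis using generated by (simp add: generated_in_degree_def)
qed

lemma mm_subset_monspan: "mm (total sM M) \<subseteq> monspan (- {0})"
proof -
  have "sM (Var i) y \<in> monspan (- {0})" if "y \<in> total sM M" for i y
    unfolding Var_def
  proof (rule monspan_scale)
    show "single i 1 + u \<in> - {0}" for u :: "'v \<Rightarrow>\<^sub>0 nat"
      using total_deg_single[of i 1] total_deg_eq_0_iff[of "single i 1"]
      by (auto simp: monomial_add_eq_0_iff)
    show "y \<in> monspan UNIV" using that total_subset_monspan by blast
  qed
  then show ?thesis unfolding mm_def
    by (intro span_minimal subspace_monspan) (auto simp: monomial_add_eq_0_iff)
qed

lemma monspan_component:
  assumes x: "x \<in> M a" "x \<in> monspan U"
  obtains t :: "'m set" and c u y where "finite t" "x = (\<Sum>v\<in>t. ks (c v) (sM (mon (u v)) (y v)))"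
    "\<And>v. v \<in> t \<Longrightarrow> y v \<in> M 0 \<and> u v \<in> U \<and> mono_deg deg (u v) = a"
proof -
  obtain t c where t: "finite t" "t \<subseteq> {sM (mon u) y | u y. u \<in> U \<and> y \<in> M 0}" "x = (\<Sum>v\<in>t. ks (c v) v)"
    using x(2) unfolding monspan_def k.span_explicit by auto
  have "\<forall>v\<in>t. \<exists>u y. v = sM (mon u) y \<and> u \<in> U \<and> y \<in> M 0" using t(2) by blast
  then obtain u y where uy: "\<And>v. v \<in> t \<Longrightarrow> v = sM (mon (u v)) (y v) \<and> u v \<in> U \<and> y v \<in> M 0"
    by metis
  have "v \<in> M (mono_deg deg (u v))" if "v \<in> t" for v
    using G_scale[OF single_poly_comp[of deg "u v", OF refl], of "y v" 0 1] uy[OF that] by simp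
  then have "(\<Sum>v\<in>t. ks (c v) v) = (\<Sum>v | v \<in> t \<and> mono_deg deg (u v) = a. ks (c v) v)"
    using t x(1) by (intro component_sum) (auto intro: G_ks)
  also have "\<dots> = (\<Sum>v | v \<in> t \<and> mono_deg deg (u v) = a. ks (c v) (sM (mon (u v)) (y v)))"
    using uy by (intro sum.cong) auto
  finally show thesis using t uy
    by (intro that[of "{v \<in> t. mono_deg deg (u v) = a}" c u y]) auto
qed

lemma mono_deg_eq_0: "mono_deg deg u = 0 \<Longrightarrow> u = 0"
proof (rule ccontr)
  obtain \<theta> :: "'a \<Rightarrow> int" where \<theta>: "additive \<theta>" "\<And>u. u \<noteq> 0 \<Longrightarrow> \<theta> (mono_deg deg u) > 0"
    using positively_graded_theta[OF positively_graded] by blast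
  assume "mono_deg deg u = 0" "u \<noteq> 0"
  then show False using \<theta>(2)[of u] additive.zero[OF \<theta>(1)] by simp
qed

text \<open>A nontrivial monomial never has degree 0, so no term of an element of mM survives in
  M_0.\<close>

lemma M_0_mm:
  assumes "m \<in> M 0" "m \<in> mm (total sM M)" shows "m = 0"
proof -
  obtain t :: "'m set" and c u y where *: "finite t" "m = (\<Sum>v\<in>t. ks (c v) (sM (mon (u v)) (y v)))"
    "\<And>v. v \<in> t \<Longrightarrow> y v \<in> M 0 \<and> u v \<in> - {0} \<and> mono_deg deg (u v) = 0"
    using monspan_component[OF assms(1), of "- {0}"] assms(2) mm_subset_monspan by blast
  then have "t = {}" using mono_deg_eq_0 by blast
  then show ?thesis using * by simp
qed

text \<open>Here \<epsilon> x is a combination of nontrivial monomials times M_0. Lifting the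
  elements of M_0 gives z in mF_0 with the same image, and x - z lies in the kernel of \<epsilon>,
  hence in mF_0.\<close>

lemma cmp_0_mm:
  assumes x: "x \<in> cmp F 0 a" and a: "a \<noteq> 0"
  shows "x \<in> gr.mm (cmod F 0)"
proof -
  have "\<epsilon> x \<in> monspan UNIV"
    using total_subset_monspan G_subset_total \<epsilon>_cmp[OF x] by blast
  then obtain t :: "'m set" and c u y where
    *: "finite t" "\<epsilon> x = (\<Sum>v\<in>t. ks (c v) (sM (mon (u v)) (y v)))"
    "\<And>v. v \<in> t \<Longrightarrow> y v \<in> M 0 \<and> u v \<in> UNIV \<and> mono_deg deg (u v) = a"
    using monspan_component[OF \<epsilon>_cmp[OF x], of UNIV] by blast
  have "\<forall>v\<in>t. \<exists>f\<in>cmod F 0. y v = \<epsilon> f"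
    using *(3) G_subset_total \<epsilon>_image by blast
  then obtain f where f: "\<And>v. v \<in> t \<Longrightarrow> f v \<in> cmod F 0 \<and> y v = \<epsilon> (f v)" by metis
  define z where "z = (\<Sum>v\<in>t. scl F (single (u v) (c v)) (f v))"
  have "scl F (single (u v) (c v)) (f v) \<in> gr.mm (cmod F 0)" if "v \<in> t" for v
  proof (rule gr.sc_mm[OF cmod_subspace])
    have "u v \<noteq> 0" using *(3)[OF that] a by auto
    then show "lookup (single (u v) (c v)) 0 = 0"
      by (simp add: lookup_single)
  qed (use f that in auto)
  then have z: "z \<in> gr.mm (cmod F 0)" unfolding z_def by (rule gr.subspace_sum[OF gr.subspace_mm])
  then have z': "z \<in> cmod F 0" using gr.mm_subset[OF cmod_subspace] by blast
  have x': "x \<in> cmod F 0" using x by (rule cmp_cmod)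
  have "\<epsilon> z = \<epsilon> x"
    unfolding z_def *(2) using f
    by (simp add: \<epsilon>_sum \<epsilon>_scale cmod_scale ks_def Const_mult_single)
  then have "\<epsilon> (x + scl F (- 1) z) = 0"
    using x' z' by (simp add: \<epsilon>_add \<epsilon>_scale cmod_scale
      cmod_neg del: gr.scale_minus_left)
  then have "x + scl F (- 1) z \<in> gr.mm (cmod F 0)"
    using x' z' by (intro kernel_\<epsilon>_mm cmod_add cmod_scale)
  then have "x + scl F (- 1) z + z \<in> gr.mm (cmod F 0)" using z by (rule gr.subspace_add[OF gr.subspace_mm])
  then show ?thesis by simp
qed

lemma lift_dif_homogeneous:
  assumes "z \<in> cmp F (j - 1) a" "z \<in> dif F j ` cmod F j"
  shows "z \<in> dif F j ` cmp F j a"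
  using assms unfolding cmod_def
  by (intro lift_homogeneous[OF gr.graded_mod_axioms gr.graded_mod_axioms])
     (simp_all add: linear_on_def dif_add dif_scale dif_cmp flip: cmod_def)

lemma lift_\<epsilon>_homogeneous:
  assumes "m \<in> M a" shows "m \<in> \<epsilon> ` cmp F 0 a"
proof (rule lift_homogeneous[OF gr.graded_mod_axioms graded_mod_axioms _ _ assms])
  show "m \<in> \<epsilon> ` total (scl F) (cmp F 0)"
    using assms G_subset_total \<epsilon>_image unfolding cmod_def by blast
qed (simp_all add: linear_on_def \<epsilon>_add \<epsilon>_scale \<epsilon>_cmp flip: cmod_def)

section \<open>Inductive construction of the lift\<close>

abbreviation koszul_sum :: "(_ \<Rightarrow> 'f) \<Rightarrow> int \<Rightarrow> _ \<Rightarrow> 'f"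
  where "koszul_sum \<psi> j y \<equiv> \<Sum>i\<in>UNIV. scl F (Var i) (\<psi> (lact_gen K j i y))"

text \<open>The induction invariant. The third condition is the solvability of the next lifting
  problem; the last one normalizes the start, so that \<epsilon> recovers the value on the unit of
  E.\<close>

definition liftable :: "int \<Rightarrow> ((('v, 'k) ext \<Rightarrow> 'm) \<Rightarrow> 'f) \<Rightarrow> bool"
  where "liftable j \<psi> \<longleftrightarrow> Vector_Spaces.linear (fun_kscale sM) gr.ks \<psi> \<and>
    (\<forall>a. \<forall>y\<in>ecmp K a j. \<psi> y \<in> cmp F j a) \<and>
    (\<forall>a. \<forall>y\<in>ecmp K a (j + 1). koszul_sum \<psi> (j + 1) y \<in> dif F (j + 1) ` cmod F (j + 1)) \<and>
    (j = 0 \<longrightarrow> (\<forall>g. g {} \<in> M 0 \<longrightarrow> \<epsilon> (\<psi> (hat g)) = g {}))"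

lemma koszul_sum_cmp:
  assumes \<psi>: "\<And>a y. y \<in> ecmp K a (j - 1) \<Longrightarrow> \<psi> y \<in> cmp F (j - 1) a" and y: "y \<in> ecmp K a j"
  shows "koszul_sum \<psi> j y \<in> cmp F (j - 1) a"
proof (intro gr.G_sum)
  fix i
  have "\<psi> (lact_gen K j i y) \<in> cmp F (j - 1) (a - deg i)"
    using Kmod.lact_gen_ecmp[OF y] by (rule \<psi>)
  from gr.G_scale[OF Var_poly_comp[where i = i] this] show "scl F (Var i) (\<psi> (lact_gen K j i y)) \<in> cmp F (j - 1) a"
    by simp
qed

lemma liftable_0_exists: "\<exists>\<psi>. liftable 0 \<psi>"
proof -
  interpret p: vector_space_pair gr.ks ks by unfold_locales
  obtain \<sigma> where \<sigma>: "Vector_Spaces.linear ks gr.ks \<sigma>" "\<And>m. \<sigma> m \<in> cmp F 0 0"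
    "\<And>w. w \<in> cmp F 0 0 \<Longrightarrow> \<epsilon> (\<sigma> (\<epsilon> w)) = \<epsilon> w"
  proof (rule p.linear_right_inverse_on[of "cmp F 0 0" \<epsilon>])
    show "gr.k.subspace (cmp F 0 0)" by (rule gr.subspace_G)
  qed (auto intro: \<epsilon>_add \<epsilon>_ks cmp_cmod)
  interpret \<sigma>: Vector_Spaces.linear ks gr.ks \<sigma> by (rule \<sigma>(1))
  have \<epsilon>\<sigma>: "\<epsilon> (\<sigma> m) = m" if "m \<in> M 0" for m
    using lift_\<epsilon>_homogeneous[OF that] \<sigma>(3) by auto
  \<comment> \<open>The value on the unit of E, followed by a linear section of \<epsilon> in degree
    0.\<close>
  let ?\<psi> = "\<lambda>y. \<sigma> (y (single {} 1))"
  have "Vector_Spaces.linear (fun_kscale sM) gr.ks ?\<psi>"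
    by unfold_locales (auto simp: \<sigma>.add fun_kscale_def \<sigma>.scale simp flip: ks_def)
  moreover have "?\<psi> y \<in> cmp F 0 a" if y: "y \<in> ecmp K a 0" for a y
  proof -
    obtain g where g: "support_in a 0 g" "y = hat g" using y unfolding ecmp_K by blast
    show ?thesis
    proof (cases "g {} = 0")
      case True
      then show ?thesis using g(2) by (simp add: gr.G_0)
    next
      case False
      then have "a = 0" using g(1) by (auto simp: support_in_def)
      then show ?thesis using \<sigma>(2) by simp
    qed
  qed
  moreover have "koszul_sum ?\<psi> 1 y \<in> dif F 1 ` cmod F 1" if y: "y \<in> ecmp K a 1" for a y
  proof -
    obtain g where g: "support_in a 1 g" "cycle 1 g" "y = hat g" using y unfolding ecmp_K by blast
    have c: "contr 1 i g {} \<in> M 0" for i using support_in_contr[OF g(1)] by (simp add: support_in_def)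
    have \<sigma>_cmod: "\<sigma> m \<in> cmod F 0" for m using \<sigma>(2) by (rule cmp_cmod)
    have eq: "koszul_sum ?\<psi> 1 y = (\<Sum>i\<in>UNIV. scl F (Var i) (\<sigma> (contr 1 i g {})))"
      unfolding g(3) lact_gen_hat by simp
    \<comment> \<open>The obstruction to the first lift is the equation defining K at J = {};
      exactness at F_0 does the rest.\<close>
    have "\<epsilon> (koszul_sum ?\<psi> 1 y) = (\<Sum>i\<in>UNIV. sM (Var i) (contr 1 i g {}))"
      unfolding eq using c
      by (simp add: \<epsilon>_sum \<epsilon>_scale \<epsilon>\<sigma> \<sigma>_cmod cmod_scale)
    also have "\<dots> = 0" using g(2) by (simp add: cycle_def)
    finally have "koszul_sum ?\<psi> 1 y \<in> {x \<in> cmod F 0. \<epsilon> x = 0}"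
      unfolding eq by (simp add: cmod_sum \<sigma>_cmod cmod_scale)
    then show ?thesis unfolding exact_0 .
  qed
  moreover have "\<epsilon> (?\<psi> (hat g)) = g {}" if "g {} \<in> M 0" for g
    using that by (simp add: \<epsilon>\<sigma>)
  ultimately have "liftable 0 ?\<psi>" by (simp add: liftable_def)
  then show ?thesis by (rule exI[of _ ?\<psi>])
qed

text \<open>The projection to degree a, realized by restricting the argument to the e_I of matching
  degree. It is linear on the whole function type, so sections chosen degree by degree add up to one
  linear map.\<close>

definition deg_part :: "'a \<Rightarrow> (('v, 'k) ext \<Rightarrow> 'm) \<Rightarrow> ('v, 'k) ext \<Rightarrow> 'm"
  where "deg_part a y = (\<lambda>e. y (\<Sum>I | (\<Sum>i\<in>I. deg i) = a. single I (lookup e I)))"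

lemma deg_part_ecmp:
  assumes "y \<in> ecmp K b j" shows "deg_part a y = (if a = b then y else 0)"
proof
  fix e
  obtain g where g: "support_in b j g" "y = hat g" using assms unfolding ecmp_K by blast
  have "deg_part a y e = (\<Sum>I | (\<Sum>i\<in>I. deg i) = a. ks (lookup e I) (g I))"
    unfolding deg_part_def g(2) by (simp add: hat_arg_sum)
  also have "\<dots> = (if a = b then y else 0) e"
  proof (cases "a = b")
    case True
    then show ?thesis using g unfolding g(2) hat_def
      by (auto simp: support_in_def intro!: sum.mono_neutral_left)
  next
    case False
    then show ?thesis using g by (auto simp: support_in_def intro!: sum.neutral)
  qed
  finally show "deg_part a y e = (if a = b then y else 0) e" .
qed

lemma linear_deg_part: "Vector_Spaces.linear (fun_kscale sM) (fun_kscale sM) (deg_part a)"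
  by unfold_locales (auto simp: deg_part_def fun_kscale_def fun_eq_iff)

text \<open>Lifts come from linear sections of d in each degree. The next obstruction is \<Sum> x_i
  x_k \<psi>(e_k e_i y), which antisymmetry annihilates, so exactness makes the following problem
  solvable.\<close>

lemma liftable_step:
  assumes j: "j \<ge> 0" and \<psi>: "liftable j \<psi>"
  shows "\<exists>\<psi>'. liftable (j + 1) \<psi>' \<and>
    (\<forall>a. \<forall>y\<in>ecmp K a (j + 1). dif F (j + 1) (\<psi>' y) = koszul_sum \<psi> (j + 1) y)"
proof -
  have lin: "Vector_Spaces.linear (fun_kscale sM) gr.ks \<psi>"
    and cmp: "\<And>a y. y \<in> ecmp K a j \<Longrightarrow> \<psi> y \<in> cmp F j a"
    and lift: "\<And>a y. y \<in> ecmp K a (j + 1) \<Longrightarrow> koszul_sum \<psi> (j + 1) y \<in> dif F (j + 1) ` cmod F (j + 1)"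
    using \<psi> by (auto simp: liftable_def)
  interpret \<psi>: Vector_Spaces.linear "fun_kscale sM" gr.ks \<psi> by (rule lin)
  interpret p: vector_space_pair gr.ks gr.ks by unfold_locales
  have "\<exists>\<sigma>. Vector_Spaces.linear gr.ks gr.ks \<sigma> \<and> (\<forall>z. \<sigma> z \<in> cmp F (j + 1) a) \<and>
    (\<forall>w\<in>cmp F (j + 1) a. dif F (j + 1) (\<sigma> (dif F (j + 1) w)) = dif F (j + 1) w)" for a
  proof (rule p.linear_right_inverse_on[of "cmp F (j + 1) a" "dif F (j + 1)"])
    show "gr.k.subspace (cmp F (j + 1) a)" by (rule gr.subspace_G)
  qed (auto intro: dif_add dif_ks cmp_cmod)
  then obtain \<sigma> where \<sigma>: "\<And>a. Vector_Spaces.linear gr.ks gr.ks (\<sigma> a)" "\<And>a z. \<sigma> a z \<in> cmp F (j + 1) a"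
    "\<And>a w. w \<in> cmp F (j + 1) a \<Longrightarrow> dif F (j + 1) (\<sigma> a (dif F (j + 1) w)) = dif F (j + 1) w"
    by metis
  interpret \<sigma>: Vector_Spaces.linear gr.ks gr.ks "\<sigma> a" for a by (rule \<sigma>(1))
  interpret dp: Vector_Spaces.linear "fun_kscale sM" "fun_kscale sM" "deg_part a" for a
    by (rule linear_deg_part)
  interpret l: Vector_Spaces.linear "fun_kscale sM" "fun_kscale sM" "lact_gen K (j + 1) i" for i
    using Kmod.linear_lact_gen by simp
  \<comment> \<open>K has no nonzero homogeneous elements of degree outside this finite set.\<close>
  let ?D = "range (\<lambda>I. \<Sum>i\<in>I. deg i)"
  have fin: "finite ?D" by simp
  define \<psi>' where "\<psi>' y = (\<Sum>a\<in>?D. \<sigma> a (koszul_sum \<psi> (j + 1) (deg_part a y)))" for y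
  have ks_sum: "koszul_sum \<psi> (j + 1) (fun_kscale sM c y) = gr.ks c (koszul_sum \<psi> (j + 1) y)" for c y
    by (simp add: \<psi>.scale l.scale gr.k.scale_sum_right) (simp add: gr.ks_def mult.commute)
  have add_sum: "koszul_sum \<psi> (j + 1) (x + y) = koszul_sum \<psi> (j + 1) x + koszul_sum \<psi> (j + 1) y" for x y
    by (simp add: \<psi>.add l.add gr.scale_right_distrib sum.distrib)
  have sum_0: "koszul_sum \<psi> (j + 1) 0 = 0" by simp
  have lin': "Vector_Spaces.linear (fun_kscale sM) gr.ks \<psi>'"
  proof
    show "\<psi>' (x + y) = \<psi>' x + \<psi>' y" for x y
      by (simp only: \<psi>'_def dp.add add_sum \<sigma>.add sum.distrib)
    show "\<psi>' (fun_kscale sM c y) = gr.ks c (\<psi>' y)" for c y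
      unfolding \<psi>'_def dp.scale ks_sum \<sigma>.scale by (rule gr.k.scale_sum_right[symmetric])
  qed
  have \<psi>': "\<psi>' y = \<sigma> b (koszul_sum \<psi> (j + 1) y)" if y: "y \<in> ecmp K b (j + 1)" for b y
  proof -
    have "\<psi>' y = (\<Sum>a\<in>?D. if a = b then \<sigma> b (koszul_sum \<psi> (j + 1) y) else 0)"
      unfolding \<psi>'_def deg_part_ecmp[OF y] by (intro sum.cong) auto
    also have "\<dots> = (if b \<in> ?D then \<sigma> b (koszul_sum \<psi> (j + 1) y) else 0)"
      using fin by (simp add: sum.delta')
    also have "\<dots> = \<sigma> b (koszul_sum \<psi> (j + 1) y)"
    proof (cases "b \<in> ?D")
      case False
      obtain g where "support_in b (j + 1) g" "y = hat g" using y unfolding ecmp_K by blast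
      with False have "y = 0" by (auto simp: support_in_def hat_eq_0_iff)
      then show ?thesis by simp
    qed simp
    finally show ?thesis .
  qed
  have cmp': "\<psi>' y \<in> cmp F (j + 1) a" if "y \<in> ecmp K a (j + 1)" for a y
    unfolding \<psi>'[OF that] by (rule \<sigma>(2))
  have dif': "dif F (j + 1) (\<psi>' y) = koszul_sum \<psi> (j + 1) y" if y: "y \<in> ecmp K a (j + 1)" for a y
  proof -
    have "koszul_sum \<psi> (j + 1) y \<in> cmp F (j + 1 - 1) a"
      using cmp y by (intro koszul_sum_cmp) auto
    then have "koszul_sum \<psi> (j + 1) y \<in> dif F (j + 1) ` cmp F (j + 1) a"
      using lift[OF y] by (rule lift_dif_homogeneous)
    then show ?thesis unfolding \<psi>'[OF y] using \<sigma>(3) by auto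
  qed
  have lift': "koszul_sum \<psi>' (j + 2) y \<in> dif F (j + 2) ` cmod F (j + 2)" if y: "y \<in> ecmp K a (j + 2)" for a y
  proof -
    have e: "lact_gen K (j + 2) i y \<in> ecmp K (a - deg i) (j + 1)" for i
      using Kmod.lact_gen_ecmp[OF y, of i] by (simp add: add.commute)
    have in_cmod: "\<psi>' (lact_gen K (j + 2) i y) \<in> cmod F (j + 1)" for i
      using cmp'[OF e] by (rule cmp_cmod)
    let ?t = "\<lambda>i k. \<psi> (lact_gen K (j + 1) k (lact_gen K (j + 2) i y))"
    have anti: "?t i k = - ?t k i" for i k
    proof -
      obtain g where g: "y = hat g" using y unfolding ecmp_K by blast
      have "contr (j + 1) k (contr (j + 2) i g) = (\<lambda>J. - contr (j + 1) i (contr (j + 2) k g) J)"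
        using contr_anticommute[of "j + 2" k i g] by (simp add: fun_eq_iff add.commute)
      then have "hat (contr (j + 1) k (contr (j + 2) i g)) = - hat (contr (j + 1) i (contr (j + 2) k g))"
        by (simp add: hat_def fun_eq_iff sum_negf)
      then show ?thesis unfolding g lact_gen_hat by (simp add: \<psi>.neg)
    qed
    have diag: "?t i i = 0" for i
    proof -
      obtain g where g: "y = hat g" using y unfolding ecmp_K by blast
      have "contr (j + 1) i (contr (j + 2) i g) = (\<lambda>_. 0)"
        by (simp add: contr_def ext_sign_singleton fun_eq_iff)
      then show ?thesis unfolding g lact_gen_hat by (simp add: hat_0)
    qed
    have "dif F (j + 1) (koszul_sum \<psi>' (j + 2) y) =
        (\<Sum>i\<in>UNIV. scl F (Var i) (koszul_sum \<psi> (j + 1) (lact_gen K (j + 2) i y)))"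
      using in_cmod dif'[OF e] by (simp add: dif_sum dif_scale cmod_scale)
    also have "\<dots> = (\<Sum>i\<in>UNIV. \<Sum>k\<in>UNIV. scl F (Var i * Var k) (?t i k))"
      by (simp add: gr.scale_sum_right)
    also have "\<dots> = 0"
      by (rule sum_antisymmetric_0) (simp_all add: diag, subst anti, simp add: mult.commute)
    finally have "koszul_sum \<psi>' (j + 2) y \<in> {x \<in> cmod F (j + 1). dif F (j + 1) x = 0}"
      using in_cmod by (simp add: cmod_sum cmod_scale)
    then show ?thesis using exact[of "j + 1"] j by (simp add: add.assoc)
  qed
  have "liftable (j + 1) \<psi>'"
    using lin' cmp' lift' j by (simp add: liftable_def add.assoc)
  then show ?thesis using dif' by blast
qed

lemma lifting_exists:
  obtains \<psi> where "strand_data deg F K \<psi>"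
proof -
  have "\<exists>f. \<forall>n. liftable (int n) (f n) \<and> (\<forall>a. \<forall>y\<in>ecmp K a (int n + 1).
      dif F (int n + 1) (f (Suc n) y) = koszul_sum (f n) (int n + 1) y)"
  proof (rule dependent_nat_choice)
    show "\<exists>\<psi>. liftable (int 0) \<psi>" using liftable_0_exists by simp
    show "\<exists>\<psi>'. liftable (int (Suc n)) \<psi>' \<and> (\<forall>a. \<forall>y\<in>ecmp K a (int n + 1).
      dif F (int n + 1) (\<psi>' y) = koszul_sum \<psi> (int n + 1) y)" if "liftable (int n) \<psi>" for \<psi> n
      using liftable_step[OF _ that] by (simp add: add.commute)
  qed
  then obtain f where f: "\<And>n. liftable (int n) (f n)"
    "\<And>n a y. y \<in> ecmp K a (int n + 1) \<Longrightarrow>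
      dif F (int n + 1) (f (Suc n) y) = koszul_sum (f n) (int n + 1) y"
    by blast
  \<comment> \<open>Homological degrees are integers; F vanishes below 0, and \<psi> is continued by
    zero there.\<close>
  define \<psi> where "\<psi> j = (if j < 0 then (\<lambda>_. 0) else f (nat j))" for j
  have \<psi>_nonneg: "\<psi> j = f (nat j)" if "j \<ge> 0" for j using that by (simp add: \<psi>_def)
  have lin: "Vector_Spaces.linear (fun_kscale sM) gr.ks (\<psi> j)" for j
  proof (cases "j < 0")
    case True
    then show ?thesis unfolding \<psi>_def by simp (unfold_locales, auto)
  next
    case False
    then show ?thesis using f(1)[of "nat j"] by (simp add: \<psi>_def liftable_def)
  qed
  interpret \<psi>: Vector_Spaces.linear "fun_kscale sM" gr.ks "\<psi> j" for j by (rule lin)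
  have cmp: "\<psi> j y \<in> cmp F j a" if y: "y \<in> ecmp K a j" for a j y
  proof (cases "j < 0")
    case True
    then show ?thesis by (simp add: \<psi>_def gr.G_0)
  next
    case False
    then show ?thesis using f(1)[of "nat j"] y by (simp add: \<psi>_def liftable_def)
  qed
  have dif: "dif F j (\<psi> j y) = koszul_sum (\<psi> (j - 1)) j y" if y: "y \<in> ecmp K a j" for a j y
  proof (cases "j \<le> 0")
    case True
    \<comment> \<open>Both sides vanish: F_(j-1) is zero, and so is
      \<open>\<psi> (j - 1)\<close>.\<close>
    have "dif F j (\<psi> j y) \<in> cmod F (j - 1)"
      using dif_cmp[OF cmp[OF y]] by (rule cmp_cmod)
    then show ?thesis using True cmod_neg[of "j - 1"] by (simp add: \<psi>_def)
  next
    case False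
    define n where "n = nat (j - 1)"
    have n: "j = int n + 1" using False by (simp add: n_def)
    then show ?thesis using f(2)[of y a n] y by (simp add: \<psi>_nonneg nat_add_distrib)
  qed
  interpret sm: strand_map deg F K \<psi>
    using cmp dif by unfold_locales (simp_all add: \<psi>.add \<psi>.scale)
  have inj: "y = 0" if "y \<in> Kmod.layer (int n)" "\<psi> (int n) y \<in> gr.mm (cmod F (int n))" for n y
    using that
  proof (induction n arbitrary: y)
    case 0
    obtain g where g: "y = hat g" "\<And>I. g I \<in> M 0" "\<And>I. g I \<noteq> 0 \<Longrightarrow> int (card I) = int 0"
      using 0(1) by (rule layer_K_E) blast
    \<comment> \<open>The normalization of \<open>\<psi> 0\<close> puts the value of y on the unit
      into M_0 \<inter> mM = 0.\<close>
    have "g {} = \<epsilon> (\<psi> 0 y)" using f(1)[of 0] g(2) by (simp add: \<psi>_def liftable_def g(1))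
    then have "g {} \<in> mm (total sM M)" using \<epsilon>_mm 0(2) by simp
    then have "g {} = 0" using g(2) M_0_mm by blast
    moreover have "g I = 0" if "I \<noteq> {}" for I using g(3)[of I] that by auto
    ultimately show ?case unfolding g(1) hat_eq_0_iff by metis
  next
    case (Suc n)
    let ?j = "int (Suc n)"
    obtain B where B: "gr.independent B" "gr.span B = cmod F (int n)"
      using finite_basis[of "int n"] unfolding basis_of_def by blast
    have layer: "lact_gen K ?j i y \<in> Kmod.layer (int n)" for i
      using Kmod.lact_gen_layer[OF Suc.prems(1), of i] by simp
    have "koszul_sum (\<psi> (int n)) ?j y \<in> gr.mm (gr.mm (gr.span B))"
      using dif_mm[OF Suc.prems(2)] sm.dif_\<psi>_layer[OF Suc.prems(1)] B(2) by simp
    then have "\<psi> (int n) (lact_gen K ?j i y) \<in> gr.mm (gr.span B)" for i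
      using layer sm.\<psi>_cmod B(2) by (intro gr.sum_Var_mm_mm[OF B(1)]) auto
    then have "lact_gen K ?j i y = 0" for i
      unfolding B(2) by (rule Suc.IH[OF layer])
    then show ?case using layer_K_eq_0[OF Suc.prems(1)] by simp
  qed
  have "strand_data deg F K \<psi>"
  proof
    show "y = 0" if "y \<in> Kmod.layer j" "\<psi> j y \<in> gr.mm (cmod F j)" for y j
      using that inj[of y "nat j"] layer_K_neg[of j y] by (cases "j < 0") auto
  qed
  then show thesis by (rule that)
qed

end


section \<open>Strongly linear quasi-split subcomplexes\<close>

context mpol_module begin

text \<open>For a summand, C \<inter> mN = mC: mN lies in mC + D, and an element of C has no part in
  D. This is how quasi-splitness is exploited.\<close>

lemma mm_summand:
  assumes C: "subspace C" "subspace D" "C \<inter> D = {0}" "{x + y | x y. x \<in> C \<and> y \<in> D} = N"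
    and v: "v \<in> C" "v \<in> mm N"
  shows "v \<in> mm C"
proof -
  let ?S = "{x + y | x y. x \<in> mm C \<and> y \<in> D}"
  have eq: "span (mm C) = mm C" "span D = D" using C(2) subspace_mm by simp_all
  have "subspace ?S" using subspace_span[of "mm C \<union> D"] unfolding span_Un eq .
  moreover have "sc (Var i) y \<in> ?S" if "y \<in> N" for i y
  proof -
    obtain c d where y: "y = c + d" "c \<in> C" "d \<in> D" using \<open>y \<in> N\<close> C(4) by blast
    have "sc (Var i) c \<in> mm C" unfolding mm_def using y(2) by (intro span_base) blast
    moreover have "sc (Var i) d \<in> D" using C(2) y(3) by (rule subspace_scale)
    ultimately show ?thesis unfolding y(1) scale_right_distrib by blast
  qed
  ultimately have "mm N \<subseteq> ?S" unfolding mm_def[of N] by (intro span_minimal) auto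
  then obtain x y where xy: "v = x + y" "x \<in> mm C" "y \<in> D" using v(2) by blast
  have "y = v - x" using xy(1) by simp
  moreover have "v - x \<in> C" using v(1) xy(2) mm_subset[OF C(1)] by (blast intro: subspace_diff[OF C(1)])
  ultimately have "y \<in> C \<inter> D" using xy(3) by simp
  then show ?thesis using C(3) xy by simp
qed

text \<open>The coefficients of x_i x_k and x_i^2 are w_ik + w_ki and w_ii. As constant combinations
  of B they cannot lie in m times the span of B unless zero, so all vanish; the diagonal is read off
  directly, without dividing by 2.\<close>

lemma quadratic_relation:
  assumes B: "independent B" and w: "\<And>i k. w i k \<in> k.span B"
    and 0: "(\<Sum>i\<in>UNIV. \<Sum>k\<in>UNIV. sc (Var i * Var k) (w i k)) = 0"
  shows "w i k = - w k i" and "w i i = 0"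
proof -
  let ?x = "\<lambda>i. single i (1::nat)"
  define p where "p = (\<Sum>i\<in>UNIV. \<Sum>k\<in>UNIV. single (?x i + ?x k) (w i k))"
  have lookup_p: "lookup p u = (\<Sum>i\<in>UNIV. \<Sum>k\<in>UNIV. if ?x i + ?x k = u then w i k else 0)" for u
    by (simp add: p_def lookup_sum lookup_single when_def)
  have "lin_ext id p = 0"
    using 0 unfolding p_def by (simp add: lin_ext_sum lin_ext_single Var_def mult_single)
  have p_span: "lookup p u \<in> k.span B" for u
    unfolding lookup_p using w by (intro k.span_sum) (auto intro: k.span_zero)
  have "p = 0"
  proof (rule lin_ext_id_inject[OF B])
    fix u
    show u: "lookup p u \<in> span B" using p_span span_k_subset by blast
    show "lookup p u = 0" if "lookup p u \<in> mm (span B)"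
    proof -
      have "representation B (lookup p u) b = 0" for b
        using that by (subst representation_k_span[OF B p_span]) (simp add: mm_span_iff[OF B])
      then show ?thesis using sum_representation[OF B u] by simp
    qed
  qed fact
  then have sum_0: "(\<Sum>i'\<in>UNIV. \<Sum>k'\<in>UNIV. if ?x i' + ?x k' = ?x i + ?x k then w i' k' else 0) = 0" for i k
    using lookup_p[of "?x i + ?x k"] by simp
  \<comment> \<open>A quadratic monomial determines its two variables up to order.\<close>
  have eq: "?x i' + ?x k' = ?x i + ?x k \<longleftrightarrow> (i' = i \<and> k' = k) \<or> (i' = k \<and> k' = i)" for i' k' i k :: 'v
  proof
    assume "?x i' + ?x k' = ?x i + ?x k"
    then have x: "?x i' + ?x k' = ?x i + ?x k" .
    have inj: "a = b" if "?x a = ?x b" for a b :: 'v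
      using that by (metis lookup_single_eq lookup_single_not_eq zero_neq_one)
    show "(i' = i \<and> k' = k) \<or> (i' = k \<and> k' = i)"
    proof (cases "i' = i")
      case True
      then show ?thesis using x inj[of k' k] by simp
    next
      case False
      have "lookup (?x i' + ?x k') i = lookup (?x i + ?x k) i"
        by (simp only: x)
      then have "k' = i"
        using False by (auto simp: lookup_add lookup_single when_def split: if_splits)
      then have "?x i' + ?x i = ?x k + ?x i" using x by (simp only: add.commute[of "?x i" "?x k"])
      then show ?thesis using inj[of i' k] \<open>k' = i\<close> unfolding add_right_cancel by blast
    qed
  qed (auto simp: add.commute)
  show diag: "w i i = 0" for i
  proof -
    have "(\<Sum>i'\<in>UNIV. \<Sum>k'\<in>UNIV. if ?x i' + ?x k' = ?x i + ?x i then w i' k' else 0) =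
        (\<Sum>i'\<in>UNIV. if i' = i then w i i else 0)"
    proof (intro sum.cong refl)
      fix i'
      have "(\<Sum>k'\<in>UNIV. if ?x i' + ?x k' = ?x i + ?x i then w i' k' else 0) =
          (\<Sum>k'\<in>UNIV. if k' = i then (if i' = i then w i i else 0) else 0)"
        by (intro sum.cong refl) (simp only: eq, auto)
      then show "(\<Sum>k'\<in>UNIV. if ?x i' + ?x k' = ?x i + ?x i then w i' k' else 0) =
          (if i' = i then w i i else 0)" by simp
    qed
    then show ?thesis unfolding sum_0 by simp
  qed
  show "w i k = - w k i"
  proof (cases "i = k")
    case False
    have "(\<Sum>i'\<in>UNIV. \<Sum>k'\<in>UNIV. if ?x i' + ?x k' = ?x i + ?x k then w i' k' else 0) =
        (\<Sum>i'\<in>UNIV. (if i' = i then w i k else 0) + (if i' = k then w k i else 0))"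
    proof (intro sum.cong refl)
      fix i'
      have "(\<Sum>k'\<in>UNIV. if ?x i' + ?x k' = ?x i + ?x k then w i' k' else 0) =
          (\<Sum>k'\<in>UNIV. (if k' = k then (if i' = i then w i k else 0) else 0) +
            (if k' = i then (if i' = k then w k i else 0) else 0))"
        using False by (intro sum.cong refl) (simp only: eq, auto)
      then show "(\<Sum>k'\<in>UNIV. if ?x i' + ?x k' = ?x i + ?x k then w i' k' else 0) =
          (if i' = i then w i k else 0) + (if i' = k then w k i else 0)" by (simp add: sum.distrib)
    qed
    then have "w i k + w k i = 0" unfolding sum_0 by (simp add: sum.distrib)
    then show ?thesis by (simp add: eq_neg_iff_add_eq_0)
  qed (simp add: diag)
qed

end

locale linear_subcomplex = resolution sM deg M F \<epsilon>
  for sM :: "('v::{finite,linorder}, 'k::field) mpol \<Rightarrow> 'm::ab_group_add \<Rightarrow> 'm"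
    and deg :: "'v \<Rightarrow> 'a::ab_group_add" and M :: "'a \<Rightarrow> 'm set"
    and F :: "('v, 'k, 'a, 'f::ab_group_add) gcomplex" and \<epsilon> :: "'f \<Rightarrow> 'm" +
  fixes C :: "('v, 'k, 'a, 'f) gcomplex" and B :: "int \<Rightarrow> 'f set"
  assumes quasi_split: "quasi_split_subcomplex deg C F"
    and basis: "basis_of C j (B j)"
    and linear_entries: "b \<in> B j \<Longrightarrow> b' \<in> B (j - 1) \<Longrightarrow>
      module.representation (scl C) (B (j - 1)) (dif C j b) b' \<in> linear_forms"
begin

lemma C_simps [simp]: "scl C = scl F" "dif C = dif F"
  using quasi_split by (auto simp: quasi_split_subcomplex_def subcomplex_def)

lemma cmp_C: "x \<in> cmp C j a \<Longrightarrow> x \<in> cmp F j a"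
  using quasi_split by (auto simp: quasi_split_subcomplex_def subcomplex_def)

lemma graded_complex_C: "graded_complex deg C"
  using quasi_split by (simp add: quasi_split_subcomplex_def subcomplex_def)

sublocale c: graded_mod "scl F" deg "cmp C j" for j
proof -
  have "graded_module deg (scl F) (cmp C j)" for j
    using graded_complex_C by (simp add: graded_complex_def)
  then show "graded_mod (scl F) deg (cmp C j)" for j
    by (simp add: graded_mod_def graded_mod_axioms_def mpol_module_def graded_module_def)
qed

lemma independent_B: "gr.independent (B j)"
  and span_B: "gr.span (B j) = cmod C j"
  and B_cmp: "B j \<subseteq> (\<Union>a. cmp C j a)"
  using basis[of j] by (simp_all add: basis_of_def)

lemma cmod_C_subset: "cmod C j \<subseteq> cmod F j"
  unfolding cmod_def total_def C_simps using cmp_C by (intro gr.span_mono) blast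

section \<open>The span of the basis as a module over the exterior algebra\<close>

definition V :: "int \<Rightarrow> 'f set"
  where "V j = gr.k.span (B j)"

text \<open>Spanned by basis elements instead of cut out of \<open>V j\<close>, so that closure
  under \<delta> can be checked on basis elements.\<close>

definition VC :: "'a \<Rightarrow> int \<Rightarrow> 'f set"
  where "VC a j = gr.k.span (B j \<inter> cmp C j a)"

lemma subspace_V: "gr.k.subspace (V j)"
  by (simp add: V_def)

lemma VC_subset: "VC a j \<subseteq> V j"
  unfolding VC_def V_def by (intro gr.k.span_mono) auto

lemma VC_cmp: "VC a j \<subseteq> cmp C j a"
  unfolding VC_def by (intro gr.k.span_minimal c.subspace_G) auto

lemma V_cmod_C: "V j \<subseteq> cmod C j"
  unfolding V_def span_B[symmetric] by (rule gr.span_k_subset)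

lemma V_cmod: "v \<in> V j \<Longrightarrow> v \<in> cmod F j"
  using V_cmod_C cmod_C_subset by blast

text \<open>As C splits off F, such a v lies in mC. Its coordinates are then constants with zero
  constant term.\<close>

lemma V_mm:
  assumes v: "v \<in> V j" "v \<in> gr.mm (cmod F j)"
  shows "v = 0"
proof -
  obtain D where D: "gr.subspace D" "cmod C j \<inter> D = {0}"
    "{x + y | x y. x \<in> cmod C j \<and> y \<in> D} = cmod F j"
    using quasi_split unfolding quasi_split_subcomplex_def by fastforce
  have "gr.subspace (cmod C j)" by (simp add: cmod_def total_def)
  then have "v \<in> gr.mm (gr.span (B j))"
    unfolding span_B using v V_cmod_C D by (intro gr.mm_summand[OF _ D]) auto
  then have "gr.representation (B j) v b = 0" for b
    using v(1) gr.representation_k_span[OF independent_B[of j], of v b]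
    by (simp add: gr.mm_span_iff[OF independent_B] V_def)
  then show ?thesis
    using gr.sum_representation[OF independent_B[of j], of v] v(1) V_cmod_C[of j] span_B[of j] by auto
qed

abbreviation lcoeff :: "int \<Rightarrow> 'v \<Rightarrow> 'f \<Rightarrow> 'f \<Rightarrow> 'k"
  where "lcoeff j i b b' \<equiv> lookup (gr.representation (B (j - 1)) (dif F j b) b')
    (single i 1)"

text \<open>The coefficient of x_i in the differential, extended linearly from the basis to the
  whole type: d = \<Sum> x_i \<delta>_i on V, and \<delta>_i plays the role of e_i.\<close>

definition \<delta> :: "int \<Rightarrow> 'v \<Rightarrow> 'f \<Rightarrow> 'f"
  where "\<delta> j i = (SOME g. Vector_Spaces.linear gr.ks gr.ks g \<and> (\<forall>b\<in>B j. g b =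
    (\<Sum>b' | gr.representation (B (j - 1)) (dif F j b) b' \<noteq> 0.
      gr.ks (lcoeff j i b b') b')))"

lemma \<delta>: "Vector_Spaces.linear gr.ks gr.ks (\<delta> j i)"
  and \<delta>_basis: "b \<in> B j \<Longrightarrow> \<delta> j i b =
    (\<Sum>b' | gr.representation (B (j - 1)) (dif F j b) b' \<noteq> 0.
      gr.ks (lcoeff j i b b') b')"
proof -
  interpret p: vector_space_pair gr.ks gr.ks by unfold_locales
  from someI_ex[OF p.linear_independent_extend[OF gr.independent_k[OF independent_B[of j]]],
      of "\<lambda>b. \<Sum>b' | gr.representation (B (j - 1)) (dif F j b) b' \<noteq> 0.
      gr.ks (lcoeff j i b b') b'",
      folded \<delta>_def]
  show "Vector_Spaces.linear gr.ks gr.ks (\<delta> j i)"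
    "b \<in> B j \<Longrightarrow> \<delta> j i b =
    (\<Sum>b' | gr.representation (B (j - 1)) (dif F j b) b' \<noteq> 0.
      gr.ks (lcoeff j i b b') b')"
    by blast+
qed

sublocale \<delta>: Vector_Spaces.linear gr.ks gr.ks "\<delta> j i" for j i
  by (rule \<delta>)

lemma dif_basis_cmp: "b \<in> cmp C j a \<Longrightarrow> dif F j b \<in> cmp C (j - 1) a"
  using graded_complex_C by (simp add: graded_complex_def image_subset_iff)

lemma cmp_C_span: "x \<in> cmp C j a \<Longrightarrow> x \<in> gr.span (B j)"
  unfolding span_B cmod_def C_simps using c.G_subset_total by blast

text \<open>The entry at b' is homogeneous of degree \<open>a - dg b'\<close>, so x_i occurs in it
  only if \<open>dg b' = a - deg i\<close>.\<close>

lemma \<delta>_VC: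
  assumes v: "v \<in> VC a j" shows "\<delta> j i v \<in> VC (a - deg i) (j - 1)"
proof -
  have "\<delta> j i b \<in> VC (a - deg i) (j - 1)" if b: "b \<in> B j" "b \<in> cmp C j a" for b
    unfolding \<delta>_basis[OF b(1)]
  proof (rule gr.k.subspace_sum)
    show "gr.k.subspace (VC (a - deg i) (j - 1))" by (simp add: VC_def)
    fix b' assume "b' \<in> {b'. gr.representation (B (j - 1)) (dif F j b) b' \<noteq> 0}"
    then have b': "b' \<in> B (j - 1)" by (auto dest: gr.representation_ne_zero)
    let ?r = "gr.representation (B (j - 1)) (dif F j b) b'"
    have "\<forall>b'\<in>B (j - 1). \<exists>d. b' \<in> cmp C (j - 1) d" using B_cmp[of "j - 1"] by blast
    then obtain dg where dg: "\<And>b'. b' \<in> B (j - 1) \<Longrightarrow> b' \<in> cmp C (j - 1) (dg b')" by metis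
    show "gr.ks (lookup ?r (single i 1)) b' \<in> VC (a - deg i) (j - 1)"
    proof (cases "lookup ?r (single i 1) = 0")
      case False
      have "?r \<in> poly_comp deg (a - dg b')"
        using dif_basis_cmp[OF b(2)] b' dg
        by (intro c.representation_homogeneous[OF independent_B]) (auto intro: cmp_C_span)
      from lookup_poly_comp[OF this False] have "deg i = a - dg b'" by (simp only: mono_deg_single)
      then have "dg b' = a - deg i" by simp
      then show ?thesis unfolding VC_def using b' dg[OF b'] by (intro gr.k.span_scale gr.k.span_base) auto
    qed (simp add: VC_def gr.k.span_zero)
  qed
  then have "\<delta> j i ` (B j \<inter> cmp C j a) \<subseteq> VC (a - deg i) (j - 1)" by blast
  then have "gr.k.span (\<delta> j i ` (B j \<inter> cmp C j a)) \<subseteq> VC (a - deg i) (j - 1)"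
    by (intro gr.k.span_minimal) (simp_all add: VC_def)
  then show ?thesis using v unfolding \<delta>.span_image VC_def[of a j] by blast
qed

lemma \<delta>_V:
  assumes v: "v \<in> V j" shows "\<delta> j i v \<in> V (j - 1)"
proof -
  have "\<delta> j i b \<in> V (j - 1)" if b: "b \<in> B j" for b
  proof -
    obtain a where "b \<in> cmp C j a" using b B_cmp by blast
    then have "b \<in> VC a j" unfolding VC_def using b by (intro gr.k.span_base) auto
    then show ?thesis using \<delta>_VC VC_subset by blast
  qed
  then have "gr.k.span (\<delta> j i ` B j) \<subseteq> V (j - 1)"
    by (intro gr.k.span_minimal) (auto simp: V_def)
  then show ?thesis using v unfolding \<delta>.span_image V_def[of j] by blast
qed

lemma dif_\<delta>:
  assumes "v \<in> V j"
  shows "dif F j v = (\<Sum>i\<in>UNIV. scl F (Var i) (\<delta> j i v))"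
proof -
  let ?S = "{v \<in> cmod F j. dif F j v = (\<Sum>i\<in>UNIV. scl F (Var i) (\<delta> j i v))}"
  have "gr.k.subspace ?S"
  proof (rule gr.k.subspaceI)
    show "gr.ks c x \<in> ?S" if "x \<in> ?S" for c x
      using that by (auto simp: \<delta>.scale dif_ks gr.k.subspace_scale[OF gr.subspace_k[OF cmod_subspace]]
        gr.k.scale_sum_right) (simp add: gr.ks_def mult.commute)
  qed (auto simp: dif_0 dif_add \<delta>.add gr.scale_right_distrib sum.distrib
    cmod_0 cmod_add)
  moreover have "B j \<subseteq> ?S"
  proof
    fix b assume b: "b \<in> B j"
    then obtain a where a: "b \<in> cmp C j a" using B_cmp by blast
    let ?r = "gr.representation (B (j - 1)) (dif F j b)"
    have entry: "?r b' = (\<Sum>i\<in>UNIV. Const (lookup (?r b') (single i 1)) * Var i)"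
      if "?r b' \<noteq> 0" for b'
      using linear_entries[OF b gr.representation_ne_zero[OF that]] by (intro linear_form_expand) simp
    have "dif F j b = (\<Sum>b' | ?r b' \<noteq> 0. scl F (?r b') b')"
      using dif_basis_cmp[OF a] by (intro gr.sum_representation independent_B cmp_C_span)
    also have "\<dots> = (\<Sum>b' | ?r b' \<noteq> 0. \<Sum>i\<in>UNIV.
        scl F (Var i) (gr.ks (lookup (?r b') (single i 1)) b'))"
    proof (intro sum.cong refl)
      fix b' assume "b' \<in> {b'. ?r b' \<noteq> 0}"
      then have "scl F (?r b') b' = scl F (\<Sum>i\<in>UNIV.
          Const (lookup (?r b') (single i 1)) * Var i) b'"
        using entry[of b'] by simp
      then show "scl F (?r b') b' = (\<Sum>i\<in>UNIV.
          scl F (Var i) (gr.ks (lookup (?r b') (single i 1)) b'))"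
        by (simp add: gr.scale_sum_left gr.ks_def mult.commute)
    qed
    also have "\<dots> = (\<Sum>i\<in>UNIV. scl F (Var i) (\<delta> j i b))"
      by (subst sum.swap) (simp only: \<delta>_basis[OF b] gr.scale_sum_right)
    finally show "b \<in> ?S" using V_cmod[of b j] b by (simp add: V_def gr.k.span_base)
  qed
  ultimately have "V j \<subseteq> ?S" unfolding V_def by (intro gr.k.span_minimal)
  then show ?thesis using assms by blast
qed

text \<open>Comparison of the quadratic monomials in d d = 0; these are the relations of the
  exterior algebra.\<close>

lemma \<delta>_anticommute:
  assumes v: "v \<in> V j"
  shows "\<delta> (j - 1) k (\<delta> j i v) = - \<delta> (j - 1) i (\<delta> j k v)" and "\<delta> (j - 1) i (\<delta> j i v) = 0"
proof -
  let ?w = "\<lambda>i k. \<delta> (j - 1) k (\<delta> j i v)"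
  have w: "?w i k \<in> gr.k.span (B (j - 1 - 1))" for i k
    using \<delta>_V[OF \<delta>_V[OF v]] by (simp only: V_def)
  have \<delta>_cmod: "\<delta> j i v \<in> cmod F (j - 1)" for i using \<delta>_V[OF v] by (rule V_cmod)
  have "0 = dif F (j - 1) (dif F j v)" using dif_dif[OF V_cmod[OF v]] by simp
  also have "\<dots> = (\<Sum>i\<in>UNIV. scl F (Var i) (dif F (j - 1) (\<delta> j i v)))"
    by (simp add: dif_\<delta>[OF v] dif_sum dif_scale \<delta>_cmod cmod_scale)
  also have "\<dots> = (\<Sum>i\<in>UNIV. \<Sum>k\<in>UNIV. scl F (Var i * Var k) (?w i k))"
    by (simp add: dif_\<delta>[OF \<delta>_V[OF v]] gr.scale_sum_right)
  finally have 0: "(\<Sum>i\<in>UNIV. \<Sum>k\<in>UNIV. scl F (Var i * Var k) (?w i k)) = 0" by simp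
  show "?w i k = - ?w k i" "?w i i = 0"
    using gr.quadratic_relation[OF independent_B, of ?w "j - 1 - 1", OF w 0] by blast+
qed

section \<open>The embedding of V into K\<close>

definition \<epsilon>' :: "'f \<Rightarrow> 'm"
  where "\<epsilon>' = (SOME g. Vector_Spaces.linear gr.ks ks g \<and> (\<forall>x\<in>cmod F 0. g x = \<epsilon> x))"

text \<open>Linearity on the whole type keeps the recursion for \<open>func\<close> free of
  membership conditions.\<close>

lemma \<epsilon>': "Vector_Spaces.linear gr.ks ks \<epsilon>'" and \<epsilon>'_eq: "x \<in> cmod F 0 \<Longrightarrow> \<epsilon>' x = \<epsilon> x"
proof -
  interpret p: vector_space_pair gr.ks ks by unfold_locales
  have "\<exists>g. Vector_Spaces.linear gr.ks ks g \<and> (\<forall>x\<in>cmod F 0. g x = \<epsilon> x)"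
    using p.linear_extension_on[OF gr.subspace_k[OF cmod_subspace[of 0]], of \<epsilon>] \<epsilon>_add \<epsilon>_ks by metis
  from someI_ex[OF this, folded \<epsilon>'_def]
  show "Vector_Spaces.linear gr.ks ks \<epsilon>'" "x \<in> cmod F 0 \<Longrightarrow> \<epsilon>' x = \<epsilon> x" by blast+
qed

sublocale \<epsilon>': Vector_Spaces.linear gr.ks ks \<epsilon>'
  by (rule \<epsilon>')

text \<open>On \<open>e\<^sub>I\<close> with \<open>I = {i\<^sub>1 < \<dots> < i\<^sub>n}\<close>, the functional attached to \<open>v\<close> takes the value
  \<open>\<plusminus>\<epsilon>(\<delta>\<^bsub>i\<^sub>n\<^esub> \<cdots> \<delta>\<^bsub>i\<^sub>1\<^esub> v)\<close>.\<close>

fun func :: "nat \<Rightarrow> 'f \<Rightarrow> 'v set \<Rightarrow> 'm"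
  where "func 0 v I = (if I = {} then \<epsilon>' v else 0)"
  | "func (Suc n) v I = (if I = {} then 0
      else ks (aux_sign (int (Suc n))) (func n (\<delta> (int (Suc n)) (Min I) v) (I - {Min I})))"

lemma func_add: "func n (x + y) I = func n x I + func n y I"
  by (induction n arbitrary: x y I) (auto simp: \<epsilon>'.add \<delta>.add k.scale_right_distrib)

lemma func_scale: "func n (gr.ks c x) I = ks c (func n x I)"
  by (induction n arbitrary: x I) (auto simp: \<epsilon>'.scale \<delta>.scale mult.commute)

lemma func_0 [simp]: "func n 0 I = 0"
  using func_add[of n 0 0 I] by simp

lemma func_neg: "func n (- x) I = - func n x I"
  using func_add[of n x "- x" I] by (simp add: eq_neg_iff_add_eq_0 add.commute)

text \<open>Outside degree 0 the components of F_0 lie in mF_0, which contains no basis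
  element.\<close>

lemma VC_0: "a \<noteq> 0 \<Longrightarrow> VC a 0 = {0}"
proof -
  assume a: "a \<noteq> 0"
  have False if b: "b \<in> B 0" "b \<in> cmp C 0 a" for b
  proof -
    have "b \<in> gr.mm (cmod F 0)" using cmp_0_mm[OF cmp_C[OF b(2)] a] .
    moreover have "b \<in> V 0" unfolding V_def using b(1) by (rule gr.k.span_base)
    ultimately have "b = 0" by (intro V_mm)
    then show False using independent_B[of 0] b(1) gr.dependent_zero by blast
  qed
  then have "B 0 \<inter> cmp C 0 a = {}" by blast
  then show ?thesis by (simp add: VC_def)
qed

lemma support_in_func:
  assumes "v \<in> VC a (int n)" shows "support_in a (int n) (func n v)"
  using assms
proof (induction n arbitrary: a v)
  case 0
  show ?case
  proof (cases "a = 0")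
    case True
    have v: "v \<in> cmp F 0 0" using 0 VC_cmp[of a 0] cmp_C True by auto
    then have "\<epsilon>' v \<in> M 0" using \<epsilon>_cmp \<epsilon>'_eq cmp_cmod by metis
    then show ?thesis using True by (auto simp: support_in_def G_0)
  next
    case False
    then have "v = 0" using 0 VC_0 by simp
    then show ?thesis by (simp add: support_in_def G_0)
  qed
next
  case (Suc n)
  let ?f = "\<lambda>I. func n (\<delta> (int (Suc n)) (Min I) v) (I - {Min I})"
  have IH: "support_in (a - deg i) (int n) (func n (\<delta> (int (Suc n)) i v))" for i
    using \<delta>_VC[OF Suc.prems, of i] by (intro Suc.IH) simp
  show ?case
    unfolding support_in_def
  proof (intro allI conjI impI)
    fix I
    show "func (Suc n) v I \<in> M 0"
      using IH[of "Min I"] by (simp add: support_in_def G_0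
        G_ks)
    assume "func (Suc n) v I \<noteq> 0"
    then have I: "I \<noteq> {}" "?f I \<noteq> 0" by (auto split: if_splits)
    have "Min I \<in> I" using I(1) by (intro Min_in) auto
    then have "(\<Sum>i\<in>I. deg i) = deg (Min I) + (\<Sum>i\<in>I - {Min I}. deg i)" "card I = Suc (card (I - {Min I}))"
      using sum.remove[of I "Min I" deg] card.remove[of I "Min I"] by simp_all
    then show "(\<Sum>i\<in>I. deg i) = a" "int (card I) = int (Suc n)"
      using IH[of "Min I"] I(2) by (simp_all add: support_in_def)
  qed
qed

text \<open>Here i is the minimum that \<open>func\<close> removes first, the product e_i e_J needs
  no sign, and the two auxiliary signs cancel.\<close>

lemma contr_func_less:
  assumes "\<And>k. k \<in> J \<Longrightarrow> i < k"
  shows "contr (int (Suc n)) i (func (Suc n) v) J = func n (\<delta> (int (Suc n)) i v) J"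
proof -
  have "Min (insert i J) = i" using assms by (intro Min_eqI) (auto intro: less_imp_le)
  moreover have "ext_sign {i} J = (1 :: 'k)"
  proof -
    have "i \<notin> J" "{k \<in> J. k < i} = {}" using assms by force+
    then show ?thesis by (simp only: ext_sign_singleton if_False card.empty power_0)
  qed
  moreover have "insert i J - {i} = J" using assms by blast
  moreover have "ks (aux_sign (int (Suc n))) (ks (aux_sign (int (Suc n))) x) = x" for x
    by (simp del: of_nat_Suc)
  ultimately show ?thesis by (simp add: contr_def del: of_nat_Suc)
qed

text \<open>Compatibility of the embedding with e_i. Unless i lies below J, the minimum m of J is
  removed first on both sides; passing e_i over e_m and \<delta>_i over \<delta>_m each costs a
  factor -1, and induction applies to \<delta>_m v.\<close>

lemma contr_func:
  assumes "v \<in> V (int (Suc n))"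
  shows "contr (int (Suc n)) i (func (Suc n) v) J = func n (\<delta> (int (Suc n)) i v) J"
  using assms
proof (induction n arbitrary: v i J)
  case 0
  show ?case
  proof (cases "J = {}")
    case True
    then show ?thesis by (intro contr_func_less) auto
  next
    case False
    \<comment> \<open>The set \<open>insert i J\<close> has at least two elements, so the recursion
      ends in a nonempty set with value 0.\<close>
    have ne: "insert i J - {x} \<noteq> {}" if "i \<notin> J" for x
      using that False by blast
    have "func (Suc 0) v (insert i J) = 0" if "i \<notin> J"
      using ne[OF that, of "Min (insert i J)"] by (simp only: func.simps insert_not_empty if_False k.scale_zero_right)
    then have "contr (int (Suc 0)) i (func (Suc 0) v) J = 0"
      unfolding contr_def by (cases "i \<in> J") (simp_all add: ext_sign_singleton del: func.simps)
    moreover have "func 0 (\<delta> (int (Suc 0)) i v) J = 0" using False by simp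
    ultimately show ?thesis by (simp only:)
  qed
next
  case (Suc n)
  let ?j = "int (Suc (Suc n))"
  have j1: "?j - 1 = int (Suc n)" by simp
  show ?case
  proof (cases "\<forall>k\<in>J. i < k")
    case True
    then show ?thesis by (intro contr_func_less) auto
  next
    case False
    define m where "m = Min J"
    define J' where "J' = J - {m}"
    have J: "J \<noteq> {}" using False by auto
    then have m: "m \<in> J" "m \<le> i" using False Min_in[of J] Min_le[of J]
      by (auto simp: m_def) (metis Min_le finite not_le order_trans less_imp_le)
    have J_eq: "J = insert m J'" "m \<notin> J'" using m by (auto simp: J'_def)
    have \<delta>V: "\<delta> ?j m v \<in> V (int (Suc n))" using \<delta>_V[OF Suc.prems, of m] unfolding j1 .
    note anti = \<delta>_anticommute[OF Suc.prems, unfolded j1]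
    have rhs: "func (Suc n) (\<delta> ?j i v) J =
        ks (aux_sign (int (Suc n))) (func n (\<delta> (int (Suc n)) m (\<delta> ?j i v)) J')"
      using J by (simp add: m_def J'_def del: of_nat_Suc)
    show ?thesis
    proof (cases "i = m")
      case True
      \<comment> \<open>Both sides vanish: i lies in J on the left, and \<delta>_m \<delta>_m v = 0
        on the right.\<close>
      then show ?thesis using m anti(2)[of m] unfolding rhs by (simp add: contr_def ext_sign_singleton del: of_nat_Suc)
    next
      case False
      then have "m < i" using m by simp
      have "Min (insert i J) = m"
      proof (rule Min_eqI)
        show "m \<le> k" if "k \<in> insert i J" for k using that \<open>m < i\<close> by (auto simp: m_def)
      qed (use m in auto)
      moreover have "insert i J - {m} = insert i J'" using False by (auto simp: J'_def)
      ultimately have "func (Suc (Suc n)) v (insert i J) =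
          ks (aux_sign ?j) (func (Suc n) (\<delta> ?j m v) (insert i J'))" by simp
      then have "contr ?j i (func (Suc (Suc n)) v) J =
          ks (aux_sign ?j * aux_sign ?j * ext_sign {i} J) (func (Suc n) (\<delta> ?j m v) (insert i J'))"
        unfolding contr_def by (simp only: k.scale_scale mult_ac)
      also have "\<dots> = - ks (ext_sign {i} J') (func (Suc n) (\<delta> ?j m v) (insert i J'))"
        unfolding aux_sign_square J_eq(1) ext_sign_insert_less[OF \<open>m < i\<close> J_eq(2)] by simp
      also have "\<dots> = - ks (aux_sign (int (Suc n)))
          (contr (int (Suc n)) i (func (Suc n) (\<delta> ?j m v)) J')"
        by (simp add: contr_def mult.assoc[symmetric] del: of_nat_Suc func.simps)
      also have "\<dots> = - ks (aux_sign (int (Suc n))) (func n (\<delta> (int (Suc n)) i (\<delta> ?j m v)) J')"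
        unfolding Suc.IH[OF \<delta>V] ..
      also have "\<dots> = func (Suc n) (\<delta> ?j i v) J"
        unfolding rhs anti(1)[of m i] func_neg by simp
      finally show ?thesis .
    qed
  qed
qed

text \<open>The start is \<epsilon>(d v) = 0. In the step, removing the minimum m of J and
  anticommuting \<delta>_m with \<delta>_i leads back to the claim for \<delta>_m v.\<close>

lemma sum_Var_func:
  assumes "v \<in> V (int (Suc n))"
  shows "(\<Sum>i\<in>UNIV. sM (Var i) (func n (\<delta> (int (Suc n)) i v) J)) = 0"
  using assms
proof (induction n arbitrary: v J)
  case 0
  have 1: "\<delta> 1 i v \<in> cmod F 0" for i using \<delta>_V[of v 1 i] 0 V_cmod by simp
  have "v \<in> cmod F 1" using 0 V_cmod[of v 1] by simp
  then have "dif F 1 v \<in> {x \<in> cmod F 0. \<epsilon> x = 0}" unfolding exact_0 by blast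
  then have "0 = \<epsilon> (\<Sum>i\<in>UNIV. scl F (Var i) (\<delta> 1 i v))" using dif_\<delta>[of v 1] 0 by simp
  also have "\<dots> = (\<Sum>i\<in>UNIV. sM (Var i) (\<epsilon>' (\<delta> 1 i v)))"
    using 1 by (simp add: \<epsilon>_sum \<epsilon>_scale \<epsilon>'_eq cmod_scale)
  finally show ?case by (cases "J = {}") simp_all
next
  case (Suc n)
  let ?j = "int (Suc (Suc n))"
  have j1: "?j - 1 = int (Suc n)" by simp
  show ?case
  proof (cases "J = {}")
    case False
    let ?m = "Min J" and ?J = "J - {Min J}"
    have \<delta>V: "\<delta> ?j ?m v \<in> V (int (Suc n))" using \<delta>_V[OF Suc.prems, of ?m] unfolding j1 .
    note anti = \<delta>_anticommute[OF Suc.prems, unfolded j1]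
    have "sM (Var i) (func (Suc n) (\<delta> ?j i v) J) = - ks (aux_sign (int (Suc n)))
        (sM (Var i) (func n (\<delta> (int (Suc n)) i (\<delta> ?j ?m v)) ?J))" for i
    proof -
      have "func (Suc n) (\<delta> ?j i v) J = ks (aux_sign (int (Suc n))) (func n (\<delta> (int (Suc n)) ?m (\<delta> ?j i v)) ?J)"
        using False by simp
      then show ?thesis
        unfolding anti(1)[of ?m i] func_neg by (simp add: ks_def mult.commute del: of_nat_Suc)
    qed
    then have "(\<Sum>i\<in>UNIV. sM (Var i) (func (Suc n) (\<delta> ?j i v) J)) = - ks (aux_sign (int (Suc n)))
        (\<Sum>i\<in>UNIV. sM (Var i) (func n (\<delta> (int (Suc n)) i (\<delta> ?j ?m v)) ?J))"
      by (simp only: sum_negf k.scale_sum_right)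
    then show ?thesis by (simp only: Suc.IH[OF \<delta>V]) simp
  qed simp
qed

lemma cycle_func:
  assumes "v \<in> V (int n)" shows "cycle (int n) (func n v)"
proof (cases n)
  case 0
  then show ?thesis by (simp add: cycle_def contr_def)
next
  case (Suc n')
  then show ?thesis using assms contr_func sum_Var_func by (simp add: cycle_def del: of_nat_Suc)
qed

definition \<Phi> :: "int \<Rightarrow> 'f \<Rightarrow> ('v, 'k) ext \<Rightarrow> 'm"
  where "\<Phi> j v = (if j < 0 then 0 else hat (func (nat j) v))"

sublocale \<Phi>: Vector_Spaces.linear gr.ks "fun_kscale sM" "\<Phi> j" for j
proof
  show "\<Phi> j (x + y) = \<Phi> j x + \<Phi> j y" for x y
    unfolding \<Phi>_def by (simp add: func_add[abs_def] hat_add)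
  show "\<Phi> j (gr.ks c x) = fun_kscale sM c (\<Phi> j x)" for c x
    unfolding \<Phi>_def by (simp add: func_scale[abs_def] hat_scale)
qed

lemma \<Phi>_nat: "\<Phi> (int n) v = hat (func n v)"
  by (simp add: \<Phi>_def)

lemma V_neg: "j < 0 \<Longrightarrow> v \<in> V j \<Longrightarrow> v = 0"
  using V_cmod[of v j] cmod_neg[of j] by simp

lemma \<Phi>_VC: "v \<in> VC a j \<Longrightarrow> \<Phi> j v \<in> ecmp K a j"
proof (cases "j < 0")
  case True
  then show ?thesis using Kmod.ecmp_0 by (simp add: \<Phi>_def)
next
  case False
  assume v: "v \<in> VC a j"
  then have "v \<in> V j" using VC_subset by blast
  then show ?thesis using False v support_in_func[of v a "nat j"] cycle_func[of v "nat j"]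
    by (auto simp: \<Phi>_def ecmp_K)
qed

lemma lact_gen_\<Phi>:
  assumes "v \<in> V j" shows "lact_gen K j i (\<Phi> j v) = \<Phi> (j - 1) (\<delta> j i v)"
proof -
  interpret l: Vector_Spaces.linear "fun_kscale sM" "fun_kscale sM" "lact_gen K j i"
    using Kmod.linear_lact_gen by simp
  consider "j < 0" | "j = 0" | n where "j = int (Suc n)"
    by (metis not0_implies_Suc not_less of_nat_0 zero_le_imp_eq_int)
  then show ?thesis
  proof cases
    case 1
    then show ?thesis by (simp add: \<Phi>_def)
  next
    case 2
    have "contr 0 i (func 0 v) = (\<lambda>_. 0)" by (simp add: contr_def fun_eq_iff)
    then show ?thesis using 2 by (simp add: \<Phi>_def lact_gen_hat hat_0)
  next
    case 3
    have "contr j i (func (Suc n) v) = func n (\<delta> j i v)"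
      using contr_func assms unfolding 3 by blast
    then show ?thesis using 3 by (simp add: \<Phi>_def lact_gen_hat nat_add_distrib)
  qed
qed

text \<open>Compatibility with the generators and induction give \<delta>_i v = 0 for all i, hence d
  v = 0. By exactness and minimality v lies in mF, which V meets trivially. In degree 0, \<epsilon>
  takes the place of d.\<close>

lemma \<Phi>_eq_0:
  assumes "v \<in> V j" "\<Phi> j v = 0" shows "v = 0"
proof (cases "j < 0")
  case True
  then show ?thesis using assms(1) by (rule V_neg)
next
  case False
  have "v = 0" if "v \<in> V (int n)" "\<Phi> (int n) v = 0" for n v
    using that
  proof (induction n arbitrary: v)
    case 0
    have "v \<in> cmod F 0" using 0(1) V_cmod by simp
    moreover have "func 0 v {} = 0" using 0(2) unfolding \<Phi>_nat hat_eq_0_iff by blast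
    then have "\<epsilon> v = 0" using \<epsilon>'_eq[OF \<open>v \<in> cmod F 0\<close>] by simp
    ultimately have "v \<in> gr.mm (cmod F 0)" by (rule kernel_\<epsilon>_mm)
    then show ?case using V_mm[of v 0] 0(1) by simp
  next
    case (Suc n)
    let ?j = "int (Suc n)"
    interpret l: Vector_Spaces.linear "fun_kscale sM" "fun_kscale sM" "lact_gen K ?j i" for i
      using Kmod.linear_lact_gen by simp
    have j1: "?j - 1 = int n" by simp
    have "\<delta> ?j i v = 0" for i
    proof (rule Suc.IH)
      show "\<delta> ?j i v \<in> V (int n)" using \<delta>_V[OF Suc.prems(1), of i] unfolding j1 .
      show "\<Phi> (int n) (\<delta> ?j i v) = 0"
        using lact_gen_\<Phi>[OF Suc.prems(1), of i] unfolding Suc.prems(2) l.zero j1 by (rule sym)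
    qed
    then have "dif F ?j v = 0" using dif_\<delta>[OF Suc.prems(1)] by simp
    then have "v \<in> gr.mm (cmod F ?j)" using V_cmod[OF Suc.prems(1)] by (intro kernel_dif_mm) auto
    then show ?case by (rule V_mm[OF Suc.prems(1)])
  qed
  from this[of v "nat j"] show ?thesis using False assms by simp
qed

lemma inj_on_\<Phi>: "inj_on (\<Phi> j) (V j)"
  using \<Phi>_eq_0 by (simp add: \<Phi>.inj_on_iff_eq_0[OF subspace_V])

text \<open>K with its components cut down to the image of V; equality with K is then a question
  about components only.\<close>

abbreviation N :: "('v, 'k, 'a, ('v, 'k) ext \<Rightarrow> 'm) emodule"
  where "N \<equiv> K\<lparr>ecmp := \<lambda>a j. \<Phi> j ` VC a j\<rparr>"

lemma lact_gen_N: "lact_gen N j i = lact_gen K j i"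
  by (intro ext) (simp add: lact_gen_def)

lemma linear_emodule_N: "linear_emodule deg N"
proof (rule linear_emodule.intro)
  show "module.subspace (kscl N) (ecmp N a j)" for a j
    using \<Phi>.subspace_image[of "VC a j" j] by (simp add: VC_def)
  show "lact_gen N j i y \<in> ecmp N (a - deg i) (j - 1)" if y: "y \<in> ecmp N a j" for y a j i
  proof -
    obtain v where v: "v \<in> VC a j" "y = \<Phi> j v" using y by auto
    then show ?thesis
      unfolding lact_gen_N using lact_gen_\<Phi>[of v j i] VC_subset[of a j] \<delta>_VC[OF v(1), of i] by auto
  qed
qed (simp_all add: vector_space_fun_kscale fun_eq_iff fun_kscale_def)

sublocale Nmod: linear_emodule deg N
  by (rule linear_emodule_N)

lemma layer_N: "Nmod.layer j \<subseteq> \<Phi> j ` V j"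
proof -
  have "fk.span (\<Union>a. \<Phi> j ` VC a j) \<subseteq> \<Phi> j ` V j"
    using VC_subset by (intro fk.span_minimal \<Phi>.subspace_image subspace_V) blast
  then show ?thesis by (simp add: Nmod.layer_def)
qed

text \<open>A left inverse of \<Phi> sends N back to V and meets the conditions of
  \<open>strand_data\<close>; the strand that it defines is C itself.\<close>

lemma complex_iso_LL_N: "complex_iso (LL deg N) C"
proof -
  interpret p: vector_space_pair gr.ks "fun_kscale sM" by unfold_locales
  have "\<exists>g. Vector_Spaces.linear (fun_kscale sM) gr.ks g \<and> (\<forall>v\<in>V j. g (\<Phi> j v) = v)" for j
    using p.linear_exists_left_inverse_on[OF \<Phi>.linear_axioms subspace_V inj_on_\<Phi>, of j] by blast
  then obtain \<psi> where \<psi>: "\<And>j. Vector_Spaces.linear (fun_kscale sM) gr.ks (\<psi> j)"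
    "\<And>j v. v \<in> V j \<Longrightarrow> \<psi> j (\<Phi> j v) = v" by metis
  interpret sd: strand_data deg F N \<psi>
  proof (intro strand_data.intro strand_map.intro strand_map_axioms.intro strand_data_axioms.intro)
    show "free_complex deg F" by unfold_locales
    show "linear_emodule deg N" by (rule linear_emodule_N)
    show "Vector_Spaces.linear (kscl N) gr.ks (\<psi> j)" for j using \<psi>(1) by simp
  next
    fix y a j assume "y \<in> ecmp N a j"
    then obtain v where v: "v \<in> VC a j" "y = \<Phi> j v" by auto
    then have "v \<in> V j" using VC_subset by blast
    have "v \<in> cmp F j a" using v VC_cmp cmp_C by blast
    then show "\<psi> j y \<in> cmp F j a" using v \<psi>(2)[OF \<open>v \<in> V j\<close>] by simp
    show "dif F j (\<psi> j y) = (\<Sum>i\<in>UNIV. scl F (Var i) (\<psi> (j - 1) (lact_gen N j i y)))"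
      unfolding v(2) lact_gen_N lact_gen_\<Phi>[OF \<open>v \<in> V j\<close>] \<psi>(2)[OF \<open>v \<in> V j\<close>]
        \<psi>(2)[OF \<delta>_V[OF \<open>v \<in> V j\<close>]] by (rule dif_\<delta>[OF \<open>v \<in> V j\<close>])
  next
    fix y j assume y: "y \<in> Nmod.layer j" "\<psi> j y \<in> gr.mm (cmod F j)"
    then obtain v where v: "v \<in> V j" "y = \<Phi> j v" using layer_N by blast
    then have "v = 0" using y(2) \<psi>(2) by (intro V_mm) simp_all
    then show "y = 0" using v(2) by simp
  qed
  have "cmp sd.strand j a = cmp C j a" for j a
  proof
    show "cmp sd.strand j a \<subseteq> cmp C j a"
    proof
      fix x assume "x \<in> cmp sd.strand j a"
      then obtain p where p: "p \<in> cmp (LL deg N) j a" "x = sd.\<phi> j p" by auto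
      have "\<psi> j (lookup p u) \<in> cmp C j (a - mono_deg deg u)" for u
      proof -
        have "lookup p u \<in> \<Phi> j ` VC (a - mono_deg deg u) j"
          using p(1) unfolding Nmod.cmp_LL by simp
        then obtain v where v: "v \<in> VC (a - mono_deg deg u) j" "lookup p u = \<Phi> j v" by blast
        then have "v \<in> V j" using VC_subset by blast
        then show ?thesis using v VC_cmp[of "a - mono_deg deg u" j] \<psi>(2)[of v j] by auto
      qed
      then show "x \<in> cmp C j a"
        unfolding p(2) gr.lin_ext_def by (intro gr.k.subspace_sum[OF c.subspace_G] c.G_mon)
    qed
    show "cmp C j a \<subseteq> cmp sd.strand j a"
    proof
      fix x assume x: "x \<in> cmp C j a"
      let ?r = "gr.representation (B j) x"
      have "\<forall>b\<in>B j. \<exists>d. b \<in> cmp C j d" using B_cmp[of j] by blast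
      then obtain dg where dg: "\<And>b. b \<in> B j \<Longrightarrow> b \<in> cmp C j (dg b)" by metis
      \<comment> \<open>The coordinates of x, attached to the images of the basis elements in
        N.\<close>
      define p where "p = (\<Sum>b | ?r b \<noteq> 0. tensor_poly (fun_kscale sM) (?r b) (\<Phi> j b))"
      have rB: "b \<in> B j" if "?r b \<noteq> 0" for b using that by (rule gr.representation_ne_zero)
      have BV: "b \<in> V j" if "b \<in> B j" for b unfolding V_def using that by (rule gr.k.span_base)
      have "sd.\<phi> j p = (\<Sum>b | ?r b \<noteq> 0. sd.\<phi> j (tensor_poly (fun_kscale sM) (?r b) (\<Phi> j b)))"
        unfolding p_def by (rule sd.\<phi>.sum)
      also have "\<dots> = (\<Sum>b | ?r b \<noteq> 0. scl F (?r b) b)"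
        using rB BV \<psi> by (intro sum.cong) (auto simp: gr.lin_ext_tensor_poly[OF \<psi>(1)])
      also have "\<dots> = x"
        using gr.sum_representation[OF independent_B cmp_C_span[OF x]] by simp
      finally have "x = sd.\<phi> j p" by simp
      moreover have "p \<in> cmp (LL deg N) j a"
        unfolding Nmod.cmp_LL
      proof (intro CollectI allI)
        fix u
        have "fun_kscale sM (lookup (?r b) u) (\<Phi> j b) \<in> ecmp N (a - mono_deg deg u) j"
          if b: "?r b \<noteq> 0" for b
        proof (cases "lookup (?r b) u = 0")
          case True
          then show ?thesis using Nmod.ecmp_0 by simp
        next
          case False
          have "?r b \<in> poly_comp deg (a - dg b)"
            using x rB[OF b] dg by (intro c.representation_homogeneous[OF independent_B]) (auto intro: cmp_C_span)
          then have "mono_deg deg u = a - dg b" using False by (rule lookup_poly_comp)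
          then have "b \<in> VC (a - mono_deg deg u) j"
            unfolding VC_def using rB[OF b] dg by (intro gr.k.span_base) auto
          then have "\<Phi> j b \<in> ecmp N (a - mono_deg deg u) j" by simp
          then show ?thesis using Nmod.ecmp_scale by simp
        qed
        then show "lookup p u \<in> ecmp N (a - mono_deg deg u) j"
          unfolding p_def lookup_sum lookup_tensor_poly[OF vector_space_fun_kscale]
          by (intro Nmod.ecmp_sum) simp
      qed
      ultimately show "x \<in> cmp sd.strand j a" by auto
    qed
  qed
  then have "sd.strand = C"
    by (intro gcomplex.equality ext) simp_all
  then show ?thesis using sd.complex_iso_strand by simp
qed

end


section \<open>Maximality and uniqueness\<close>

lemma complex_iso_E:
  assumes "complex_iso C C'"
  obtains f where "\<And>j. linear_on (scl C) (scl C') (cmod C j) (f j)"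
    "\<And>j. bij_betw (f j) (cmod C j) (cmod C' j)" "\<And>j a. f j ` cmp C j a = cmp C' j a"
    "\<And>j x. x \<in> cmod C j \<Longrightarrow> f (j - 1) (dif C j x) = dif C' j (f j x)"
proof -
  obtain f where f: "\<forall>j. linear_on (scl C) (scl C') (cmod C j) (f j) \<and>
    bij_betw (f j) (cmod C j) (cmod C' j) \<and> (\<forall>a. f j ` cmp C j a = cmp C' j a) \<and>
    (\<forall>x\<in>cmod C j. f (j - 1) (dif C j x) = dif C' j (f j x))"
    using assms unfolding complex_iso_def by (rule exE)
  show thesis by (rule that[of f]) (simp_all add: f)
qed

lemma complex_iso_trans:
  assumes "complex_iso C C'" "complex_iso C' C''"
  shows "complex_iso C C''"
proof -
  obtain f where f: "\<And>j. linear_on (scl C) (scl C') (cmod C j) (f j)"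
    "\<And>j. bij_betw (f j) (cmod C j) (cmod C' j)" "\<And>j a. f j ` cmp C j a = cmp C' j a"
    "\<And>j x. x \<in> cmod C j \<Longrightarrow> f (j - 1) (dif C j x) = dif C' j (f j x)"
    by (rule complex_iso_E[OF assms(1)], rule that) blast+
  obtain g where g: "\<And>j. linear_on (scl C') (scl C'') (cmod C' j) (g j)"
    "\<And>j. bij_betw (g j) (cmod C' j) (cmod C'' j)" "\<And>j a. g j ` cmp C' j a = cmp C'' j a"
    "\<And>j x. x \<in> cmod C' j \<Longrightarrow> g (j - 1) (dif C' j x) = dif C'' j (g j x)"
    by (rule complex_iso_E[OF assms(2)], rule that) blast+
  have fC: "f j x \<in> cmod C' j" if "x \<in> cmod C j" for j x
    using bij_betwE[OF f(2)] that by blast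
  show ?thesis
    unfolding complex_iso_def
  proof (intro exI[of _ "\<lambda>j. g j \<circ> f j"] allI conjI ballI)
    fix j
    show "linear_on (scl C) (scl C'') (cmod C j) (g j \<circ> f j)"
      using f(1)[of j] g(1)[of j] fC by (simp add: linear_on_def)
    show "bij_betw (g j \<circ> f j) (cmod C j) (cmod C'' j)"
      by (rule bij_betw_trans[OF f(2) g(2)])
    show "(g j \<circ> f j) ` cmp C j a = cmp C'' j a" for a
      by (simp only: image_comp[symmetric] f(3) g(3))
    show "(g (j - 1) \<circ> f (j - 1)) (dif C j x) = dif C'' j ((g j \<circ> f j) x)" if "x \<in> cmod C j" for x
      by (simp add: f(4)[OF that] g(4)[OF fC[OF that]])
  qed
qed

lemma linear_on_inv_into:
  assumes f: "linear_on s s' X f" "bij_betw f X Y" and X: "module.subspace s X" and s: "module s"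
  shows "linear_on s' s Y (inv_into X f)"
proof -
  interpret module s by fact
  have gf: "inv_into X f (f x) = x" if "x \<in> X" for x
    using bij_betw_inv_into_left[OF f(2) that] .
  have surj: "\<exists>x\<in>X. y = f x" if "y \<in> Y" for y
    using bij_betw_imp_surj_on[OF f(2)] that by blast
  show ?thesis
    unfolding linear_on_def
  proof (intro conjI ballI allI)
    fix x y assume "x \<in> Y" "y \<in> Y"
    then obtain x' y' where *: "x' \<in> X" "y' \<in> X" "x = f x'" "y = f y'" using surj by metis
    moreover have "f (x' + y') = f x' + f y'" using f(1) * by (simp add: linear_on_def)
    ultimately show "inv_into X f (x + y) = inv_into X f x + inv_into X f y"
      using gf[OF subspace_add[OF X *(1,2)]] by (simp add: gf)
  next
    fix r x assume "x \<in> Y"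
    then obtain x' where *: "x' \<in> X" "x = f x'" using surj by metis
    moreover have "f (s r x') = s' r (f x')" using f(1) * by (simp add: linear_on_def)
    ultimately show "inv_into X f (s' r x) = s r (inv_into X f x)"
      using gf[OF subspace_scale[OF X *(1), of r]] by (simp add: gf)
  qed
qed

lemma complex_iso_sym:
  assumes iso: "complex_iso C C'" and "module (scl C)"
    and dif: "\<And>j x. x \<in> cmod C j \<Longrightarrow> dif C j x \<in> cmod C (j - 1)"
  shows "complex_iso C' C"
proof -
  interpret C: module "scl C" by fact
  obtain f where f: "\<And>j. linear_on (scl C) (scl C') (cmod C j) (f j)"
    "\<And>j. bij_betw (f j) (cmod C j) (cmod C' j)" "\<And>j a. f j ` cmp C j a = cmp C' j a"
    "\<And>j x. x \<in> cmod C j \<Longrightarrow> f (j - 1) (dif C j x) = dif C' j (f j x)"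
    by (rule complex_iso_E[OF iso], rule that) blast+
  define g where "g j = inv_into (cmod C j) (f j)" for j
  have sub: "C.subspace (cmod C j)" for j by (simp add: cmod_def total_def)
  have gf: "g j (f j x) = x" if "x \<in> cmod C j" for j x
    unfolding g_def using bij_betw_inv_into_left[OF f(2) that] .
  have surj: "\<exists>x\<in>cmod C j. y = f j x" if "y \<in> cmod C' j" for j y
    using bij_betw_imp_surj_on[OF f(2)] that by blast
  show ?thesis
    unfolding complex_iso_def
  proof (intro exI[of _ g] allI conjI ballI)
    fix j
    show "linear_on (scl C') (scl C) (cmod C' j) (g j)"
      unfolding g_def by (rule linear_on_inv_into[OF f(1,2) sub assms(2)])
    show "bij_betw (g j) (cmod C' j) (cmod C j)"
      unfolding g_def by (rule bij_betw_inv_into[OF f(2)])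
    show "g j ` cmp C' j a = cmp C j a" for a
    proof -
      have "cmp C j a \<subseteq> cmod C j" unfolding cmod_def total_def by (auto intro: C.span_base)
      then have "g j ` f j ` cmp C j a = cmp C j a" using gf by (force simp: image_iff)
      then show ?thesis by (simp add: f(3))
    qed
    show "g (j - 1) (dif C' j x) = dif C j (g j x)" if x: "x \<in> cmod C' j" for x
    proof -
      obtain x' where *: "x' \<in> cmod C j" "x = f j x'" using surj[OF x] by blast
      then show ?thesis using f(4)[OF *(1)] gf[OF dif[OF *(1)]] by (simp add: gf)
    qed
  qed
qed

text \<open>Otherwise a vector outside \<open>W\<close> could be added to the independent image of
  \<open>X\<close>, giving more independent vectors in \<open>span X\<close> than \<open>X\<close>
  has elements.\<close>

lemma (in vector_space) injective_endomorphism_onto: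
  assumes X: "finite X" "independent X" and W: "subspace W" "W \<subseteq> span X"
    and f: "\<And>x y. x \<in> span X \<Longrightarrow> y \<in> span X \<Longrightarrow> f (x + y) = f x + f y"
      "\<And>c x. x \<in> span X \<Longrightarrow> f (scale c x) = scale c (f x)"
      "\<And>x. x \<in> span X \<Longrightarrow> f x \<in> W" "\<And>x. x \<in> span X \<Longrightarrow> f x = 0 \<Longrightarrow> x = 0"
  shows "W = span X"
proof (rule ccontr)
  interpret p: vector_space_pair scale scale by unfold_locales
  obtain g where g: "Vector_Spaces.linear scale scale g" "\<And>x. x \<in> span X \<Longrightarrow> g x = f x"
    using p.linear_extension_on[of "span X" f] f(1,2) subspace_span by metis
  interpret g: Vector_Spaces.linear scale scale g by (rule g(1))
  have inj: "inj_on g (span X)"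
    using f(4) g(2) by (simp add: g.inj_on_iff_eq_0[OF subspace_span])
  then have inj_X: "inj_on g X" by (rule inj_on_subset) (rule span_superset)
  have gX: "independent (g ` X)" by (rule g.independent_injective_image[OF X(2) inj])
  have gW: "g ` X \<subseteq> W" using f(3) g(2) span_superset by fastforce
  assume "W \<noteq> span X"
  then obtain y where y: "y \<in> span X" "y \<notin> W" using W(2) by blast
  have "y \<notin> span (g ` X)" using y(2) span_minimal[OF gW W(1)] by blast
  then have "independent (insert y (g ` X))" by (rule independent_insertI[OF _ gX])
  moreover have "insert y (g ` X) \<subseteq> span X" using y(1) gW W(2) by blast
  ultimately have "card (insert y (g ` X)) \<le> card X"
    using independent_span_bound[OF X(1)] by blast
  moreover have "card (insert y (g ` X)) = Suc (card X)"
    using X(1) y(2) gW card_image[OF inj_X] by (subst card_insert_disjoint) auto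
  ultimately show False by simp
qed

section \<open>L(N) modulo the irrelevant ideal\<close>

context linear_emodule begin

lemma tensor_poly_scale_single:
  "tensor_poly_scale (kscl N) (single w c) (single u y) =
    single (w + u) (kscl N c y)"
  by (rule tensor_poly_scale_single_single[OF vector_space_kscl])

lemma subspace_cmod_LL: "tp.subspace (cmod (LL deg N) j)"
  by (simp add: cmod_def total_def)

lemma single_cmod_LL:
  assumes "y \<in> layer j"
  shows "single u y \<in> cmod (LL deg N) j"
proof -
  let ?S = "{y. single u y \<in> cmod (LL deg N) j}"
  note sub = subspace_cmod_LL[of j]
  have "n.subspace ?S"
  proof (rule n.subspaceI)
    show "kscl N c x \<in> ?S" if "x \<in> ?S" for c x
      using that tp.subspace_scale[OF sub, of "single u x" "Const c"]
      by (simp add: Const_def tensor_poly_scale_single)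
  qed (auto simp: single_add intro: tp.subspace_0[OF sub] tp.subspace_add[OF sub])
  moreover have "(\<Union>a. ecmp N a j) \<subseteq> ?S"
  proof
    fix y assume "y \<in> (\<Union>a. ecmp N a j)"
    then obtain a where "y \<in> ecmp N a j" by blast
    then have "single u y \<in> cmp (LL deg N) j (a + mono_deg deg u)"
      by (auto simp: cmp_LL lookup_single when_def ecmp_0)
    then show "y \<in> ?S" unfolding cmod_def total_def by (auto intro: tp.span_base)
  qed
  ultimately have "layer j \<subseteq> ?S" unfolding layer_def by (intro n.span_minimal)
  then show ?thesis using assms by blast
qed

lemma cmod_LL: "cmod (LL deg N) j = {p. \<forall>u. lookup p u \<in> layer j}"
proof
  show "{p. \<forall>u. lookup p u \<in> layer j} \<subseteq> cmod (LL deg N) j"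
  proof
    fix p :: "('v \<Rightarrow>\<^sub>0 nat) \<Rightarrow>\<^sub>0 'n" assume "p \<in> {p. \<forall>u. lookup p u \<in> layer j}"
    then have "(\<Sum>u\<in>keys p. single u (lookup p u)) \<in> cmod (LL deg N) j"
      using single_cmod_LL by (intro tp.subspace_sum[OF subspace_cmod_LL]) auto
    then show "p \<in> cmod (LL deg N) j" using poly_mapping_sum_singles[of p] by simp
  qed
qed (rule cmod_LL_subset)

lemma dif_LL_cmod:
  assumes "p \<in> cmod (LL deg N) j" shows "dif (LL deg N) j p \<in> cmod (LL deg N) (j - 1)"
proof -
  have "dif (LL deg N) j p = (\<Sum>i\<in>UNIV. \<Sum>u\<in>keys p.
      single (single i 1 + u) (lact_gen N j i (lookup p u)))"
    by (simp add: LL_def)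
  also have "\<dots> \<in> cmod (LL deg N) (j - 1)"
    using assms by (intro tp.subspace_sum[OF subspace_cmod_LL] single_cmod_LL lact_gen_layer)
      (simp add: cmod_LL)
  finally show ?thesis .
qed

lemma complex_iso_LL_sym:
  "complex_iso (LL deg N) C \<Longrightarrow> complex_iso C (LL deg N)"
  by (rule complex_iso_sym) (auto intro: tp.module_axioms dif_LL_cmod)

sublocale tm: mpol_module "tensor_poly_scale (kscl N) :: ('v, 'k) mpol \<Rightarrow> _"
  by unfold_locales

text \<open>Identifies L(N)_j modulo m with N_j: the coefficient at 1 vanishes on every multiple of
  a variable, and all other monomials are such multiples.\<close>

lemma mm_LL:
  assumes "p \<in> cmod (LL deg N) j"
  shows "p \<in> tm.mm (cmod (LL deg N) j) \<longleftrightarrow> lookup p 0 = 0"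
proof
  let ?S = "{p. lookup p 0 = 0}"
  have lookup_0: "lookup (tensor_poly_scale (kscl N) s q) 0 =
      kscl N (lookup s 0) (lookup q 0)" for s and q :: "('v \<Rightarrow>\<^sub>0 nat) \<Rightarrow>\<^sub>0 _"
  proof (induction s rule: poly_mapping_additive_induct)
    case s: (single u c)
    show ?case
      by (induction q rule: poly_mapping_additive_induct)
         (auto simp: tensor_poly_scale_single lookup_single when_def monomial_add_eq_0_iff
           tensor_poly_scale_add_right[OF vector_space_kscl] n.scale_right_distrib lookup_add)
  qed (simp add: tensor_poly_scale_add_left[OF vector_space_kscl] n.scale_left_distrib lookup_add)
  have "tp.subspace ?S" by (intro tp.subspaceI) (auto simp: lookup_add lookup_0)
  then have "tm.mm (cmod (LL deg N) j) \<subseteq> ?S"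
    unfolding tm.mm_def by (intro tp.span_minimal) (auto simp: lookup_0 lookup_Var_0)
  then show "p \<in> tm.mm (cmod (LL deg N) j) \<Longrightarrow> lookup p 0 = 0" by blast
next
  assume 0: "lookup p 0 = 0"
  have "single u (lookup p u) \<in> tm.mm (cmod (LL deg N) j)"
    if u: "u \<in> keys p" for u
  proof -
    have "u \<noteq> 0" using 0 u by (auto simp: in_keys_iff)
    then obtain i w where w: "u = single i 1 + w" by (rule monomial_nonzero_E)
    have "single w (lookup p u) \<in> cmod (LL deg N) j"
      using assms by (intro single_cmod_LL) (simp add: cmod_LL)
    moreover have "single u (lookup p u) =
        tensor_poly_scale (kscl N) (Var i) (single w (lookup p u))"
      by (simp add: w Var_def tensor_poly_scale_single)
    ultimately show ?thesis unfolding tm.mm_def by (intro tp.span_base) blast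
  qed
  then have "(\<Sum>u\<in>keys p. single u (lookup p u)) \<in> tm.mm (cmod (LL deg N) j)"
    by (rule tp.subspace_sum[OF tm.subspace_mm])
  then show "p \<in> tm.mm (cmod (LL deg N) j)" using poly_mapping_sum_singles[of p] by simp
qed

end

context resolution begin

lemma module_scl_F: "module (scl F)"
  by unfold_locales

lemma linear_subcomplex_E:
  assumes C: "strongly_linear deg C" "quasi_split_subcomplex deg C F"
  obtains Nc where "\<forall>a j. Nc a j \<subseteq> ecmp K a j" "linear_emodule deg (K\<lparr>ecmp := Nc\<rparr>)"
    "complex_iso (LL deg (K\<lparr>ecmp := Nc\<rparr>)) C"
proof -
  obtain B where B: "\<And>j. basis_of C j (B j)" "\<And>j b b'. b \<in> B j \<Longrightarrow> b' \<in> B (j - 1) \<Longrightarrow>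
      module.representation (scl C) (B (j - 1)) (dif C j b) b' \<in> linear_forms"
    using C(1) unfolding strongly_linear_def by blast
  interpret C: linear_subcomplex sM deg M F \<epsilon> C B
    using C(2) B by unfold_locales
  show thesis
    by (rule that[OF _ C.linear_emodule_N C.complex_iso_LL_N]) (use C.\<Phi>_VC in auto)
qed

end

locale maximal_strand_data = resolution sM deg M F \<epsilon> + kd: strand_data deg F K \<psi>
  for sM :: "('v::{finite,linorder}, 'k::field) mpol \<Rightarrow> 'm::ab_group_add \<Rightarrow> 'm"
    and deg :: "'v \<Rightarrow> 'a::ab_group_add" and M :: "'a \<Rightarrow> 'm set"
    and F :: "('v, 'k, 'a, 'f::ab_group_add) gcomplex" and \<epsilon> :: "'f \<Rightarrow> 'm"
    and \<psi> :: "int \<Rightarrow> (('v, 'k) ext \<Rightarrow> 'm) \<Rightarrow> 'f"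
begin

text \<open>The same \<psi>, restricted to N, has its strand inside that of K. A complement in F,
  intersected with the strand of K, is a complement there by the modular law.\<close>

lemma sub_strand:
  assumes N: "\<forall>a j. Nc a j \<subseteq> ecmp K a j" "linear_emodule deg (K\<lparr>ecmp := Nc\<rparr>)"
  obtains C' where "quasi_split_subcomplex deg C' kd.strand" "complex_iso (LL deg (K\<lparr>ecmp := Nc\<rparr>)) C'"
proof -
  let ?N = "K\<lparr>ecmp := Nc\<rparr>"
  interpret N: linear_emodule deg ?N by (rule N(2))
  have lact: "lact_gen ?N j i = lact_gen K j i" for i j
    by (intro ext) (simp add: lact_gen_def)
  have layer: "N.layer j \<subseteq> Kmod.layer j" for j
    unfolding N.layer_def Kmod.layer_def using N(1) by (simp, intro fk.span_mono) auto
  interpret nd: strand_data deg F ?N \<psi>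
  proof (intro strand_data.intro strand_map.intro strand_map_axioms.intro strand_data_axioms.intro)
    show "free_complex deg F" by unfold_locales
    show "linear_emodule deg ?N" by (rule N(2))
    show "Vector_Spaces.linear (kscl ?N) gr.ks (\<psi> j)" for j using kd.linear_\<psi>[of j] by simp
  next
    fix y a j assume "y \<in> ecmp ?N a j"
    then have y: "y \<in> ecmp K a j" using N(1) by auto
    then show "\<psi> j y \<in> cmp F j a" by (rule kd.\<psi>_cmp)
    show "dif F j (\<psi> j y) = (\<Sum>i\<in>UNIV. scl F (Var i) (\<psi> (j - 1) (lact_gen ?N j i y)))"
      unfolding lact using y by (rule kd.dif_\<psi>)
  next
    show "y = 0" if "y \<in> N.layer j" "\<psi> j y \<in> gr.mm (cmod F j)" for y j
      using that layer kd.\<psi>_mod_mm by blast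
  qed
  have cmp: "cmp nd.strand j a \<subseteq> cmp kd.strand j a" for j a
    using N(1) by (auto simp: N.cmp_LL Kmod.cmp_LL intro!: imageI)
  then have cmod: "cmod nd.strand j \<subseteq> cmod kd.strand j" for j
    unfolding cmod_def total_def nd.strand_simps(1) kd.strand_simps(1)
    by (intro gr.span_mono) blast
  have "\<exists>D. gr.subspace D \<and> cmod nd.strand j \<inter> D = {0} \<and>
      {x + y |x y. x \<in> cmod nd.strand j \<and> y \<in> D} = cmod kd.strand j" for j
  proof -
    obtain D where D: "gr.subspace D" "cmod nd.strand j \<inter> D = {0}"
      "{x + y |x y. x \<in> cmod nd.strand j \<and> y \<in> D} = cmod F j"
      by (rule nd.split_strand)
    have sub: "gr.subspace (cmod kd.strand j)" "gr.subspace (cmod nd.strand j)"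
      by (simp_all add: cmod_def total_def)
    show ?thesis
    proof (intro exI[of _ "D \<inter> cmod kd.strand j"] conjI)
      show "gr.subspace (D \<inter> cmod kd.strand j)" using D(1) sub(1) by (rule gr.subspace_inter)
      show "cmod nd.strand j \<inter> (D \<inter> cmod kd.strand j) = {0}"
        using D(2) gr.subspace_0[OF sub(1)] by blast
      show "{x + y |x y. x \<in> cmod nd.strand j \<and> y \<in> D \<inter> cmod kd.strand j} = cmod kd.strand j"
      proof safe
        fix x y assume "x \<in> cmod nd.strand j" "y \<in> cmod kd.strand j"
        then show "x + y \<in> cmod kd.strand j" using cmod gr.subspace_add[OF sub(1)] by blast
      next
        fix z assume z: "z \<in> cmod kd.strand j"
        then have "z \<in> cmod F j" using kd.cmod_strand_subset by blast
        then obtain x y where xy: "z = x + y" "x \<in> cmod nd.strand j" "y \<in> D" unfolding D(3)[symmetric] by blast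
        have "z - x \<in> cmod kd.strand j" using z xy(2) cmod by (intro gr.subspace_diff[OF sub(1)]) auto
        then have "y \<in> cmod kd.strand j" using xy(1) by simp
        then show "\<exists>x y. z = x + y \<and> x \<in> cmod nd.strand j \<and> y \<in> D \<inter> cmod kd.strand j"
          using xy by blast
      qed
    qed
  qed
  then have "quasi_split_subcomplex deg nd.strand kd.strand"
    using nd.graded_complex_strand cmp by (simp add: quasi_split_subcomplex_def subcomplex_def)
  then show thesis using nd.complex_iso_strand by (rule that)
qed

lemma maximal_strand_strand: "maximal_strand deg F kd.strand"
  unfolding maximal_strand_def
proof (intro conjI allI impI)
  show "strongly_linear deg kd.strand" by (rule kd.strongly_linear_strand)
  show "quasi_split_subcomplex deg kd.strand F" by (rule kd.quasi_split_strand)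
  fix C assume C: "strongly_linear deg C \<and> quasi_split_subcomplex deg C F"
  obtain Nc where N: "\<forall>a j. Nc a j \<subseteq> ecmp K a j" "linear_emodule deg (K\<lparr>ecmp := Nc\<rparr>)"
    "complex_iso (LL deg (K\<lparr>ecmp := Nc\<rparr>)) C"
    by (rule linear_subcomplex_E[OF conjunct1[OF C] conjunct2[OF C]])
  obtain C' where C': "quasi_split_subcomplex deg C' kd.strand"
    "complex_iso (LL deg (K\<lparr>ecmp := Nc\<rparr>)) C'"
    by (rule sub_strand[OF N(1,2)])
  have "complex_iso C (LL deg (K\<lparr>ecmp := Nc\<rparr>))"
    by (rule linear_emodule.complex_iso_LL_sym[OF N(2,3)])
  then have "complex_iso C C'" using C'(2) by (rule complex_iso_trans)
  with C'(1) show "\<exists>C'. quasi_split_subcomplex deg C' kd.strand \<and> complex_iso C C'" by blast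
qed

text \<open>Finite dimension comes from F: \<psi> followed by reduction modulo m embeds the
  component into the span of a finite basis of F_j.\<close>

lemma ecmp_K_finite_basis:
  obtains X where "finite X" "fk.independent X" "fk.span X = ecmp K a j"
proof -
  have sub: "fk.subspace (ecmp K a j)" using Kmod.subspace_ecmp[of a j] by simp
  obtain X where X: "X \<subseteq> ecmp K a j" "fk.independent X" "ecmp K a j \<subseteq> fk.span X"
    by (rule fk.basis_exists[of "ecmp K a j"])
  then have span: "fk.span X = ecmp K a j" using fk.span_minimal[OF X(1) sub] by blast
  obtain B where B: "finite B" "gr.independent B" "gr.span B = cmod F j"
    using finite_basis[of j] unfolding basis_of_def by blast
  obtain \<kappa> where \<kappa>: "Vector_Spaces.linear gr.ks gr.ks \<kappa>"
    "\<And>x. x \<in> gr.span B \<Longrightarrow> \<kappa> x = (\<Sum>b\<in>B. gr.ks (gr.ccoeff B x b) b)"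
    "\<And>b. b \<in> B \<Longrightarrow> \<kappa> b = b"
    "\<And>x. x \<in> gr.span B \<Longrightarrow> \<kappa> x = 0 \<longleftrightarrow> x \<in> gr.mm (gr.span B)"
    by (rule gr.constant_part[OF B(2,1)], rule that) blast+
  interpret \<psi>: Vector_Spaces.linear "fun_kscale sM" gr.ks "\<psi> j" using kd.linear_\<psi>[of j] by simp
  interpret \<kappa>\<psi>: Vector_Spaces.linear "fun_kscale sM" gr.ks "\<kappa> \<circ> \<psi> j"
    by (rule Vector_Spaces.linear_compose[OF \<psi>.linear_axioms \<kappa>(1)])
  have \<psi>B: "\<psi> j y \<in> gr.span B" if "y \<in> ecmp K a j" for y
    using kd.\<psi>_cmod[OF Kmod.ecmp_layer[OF that]] B(3) by simp
  have inj: "inj_on (\<kappa> \<circ> \<psi> j) (fk.span X)"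
    unfolding span \<kappa>\<psi>.inj_on_iff_eq_0[OF sub]
    using \<psi>B \<kappa>(4) B(3) kd.\<psi>_mod_mm[OF Kmod.ecmp_layer] by simp
  have "gr.k.independent ((\<kappa> \<circ> \<psi> j) ` X)" by (rule \<kappa>\<psi>.independent_injective_image[OF X(2) inj])
  moreover have "(\<kappa> \<circ> \<psi> j) ` X \<subseteq> gr.k.span B"
  proof
    fix z assume "z \<in> (\<kappa> \<circ> \<psi> j) ` X"
    then obtain y where "y \<in> ecmp K a j" "z = \<kappa> (\<psi> j y)" using X(1) by auto
    then show "z \<in> gr.k.span B"
      using \<kappa>(2)[OF \<psi>B] by (simp add: gr.k.span_sum gr.k.span_scale gr.k.span_base)
  qed
  ultimately have "finite ((\<kappa> \<circ> \<psi> j) ` X)" using gr.k.independent_span_bound[OF B(1)] by blast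
  moreover have "inj_on (\<kappa> \<circ> \<psi> j) X" using inj by (rule inj_on_subset) (rule fk.span_superset)
  ultimately have "finite X" by (rule finite_imageD)
  then show thesis using X(2) span by (rule that)
qed

text \<open>If \<open>L \<cong> \<^bold>L(N)\<close> with \<open>N \<subseteq> K\<close> is maximal, it contains a quasi-split copy of \<open>\<^bold>L(K)\<close>; reducing modulo
  the irrelevant ideal embeds \<open>K\<close> into \<open>N\<close>, and \<open>N = K\<close> by dimension count.\<close>

lemma complex_iso_maximal_strand:
  assumes L: "maximal_strand deg F L"
  shows "complex_iso (LL deg K) L"
proof -
  have L': "strongly_linear deg L" "quasi_split_subcomplex deg L F"
    using L by (simp_all add: maximal_strand_def)
  have scl_L: "scl L = scl F" using L'(2) by (simp add: quasi_split_subcomplex_def subcomplex_def)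
  obtain Nc where N: "\<forall>a j. Nc a j \<subseteq> ecmp K a j" "linear_emodule deg (K\<lparr>ecmp := Nc\<rparr>)"
    "complex_iso (LL deg (K\<lparr>ecmp := Nc\<rparr>)) L"
    by (rule linear_subcomplex_E[OF L'])
  let ?N = "K\<lparr>ecmp := Nc\<rparr>"
  interpret N: linear_emodule deg ?N by (rule N(2))
  \<comment> \<open>Maximality of L, applied to the strand of K.\<close>
  obtain C' where C': "quasi_split_subcomplex deg C' L" "complex_iso kd.strand C'"
    using L kd.strongly_linear_strand kd.quasi_split_strand unfolding maximal_strand_def by blast
  have scl_C': "scl C' = scl F"
    using C'(1) scl_L by (simp add: quasi_split_subcomplex_def subcomplex_def)
  have KC': "complex_iso (LL deg K) C'"
    using kd.complex_iso_strand C'(2) by (rule complex_iso_trans)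
  have LN: "complex_iso L (LL deg ?N)"
    by (rule N.complex_iso_LL_sym[OF N(3)])
  obtain \<chi> where \<chi>: "\<And>j. linear_on (scl (LL deg K)) (scl F) (cmod (LL deg K) j) (\<chi> j)"
    "\<And>j. bij_betw (\<chi> j) (cmod (LL deg K) j) (cmod C' j)"
    "\<And>j a. \<chi> j ` cmp (LL deg K) j a = cmp C' j a"
    by (rule complex_iso_E[OF KC', unfolded scl_C'], rule that) blast+
  obtain \<beta> where \<beta>: "\<And>j. linear_on (scl F) (scl (LL deg ?N)) (cmod L j) (\<beta> j)"
    "\<And>j. bij_betw (\<beta> j) (cmod L j) (cmod (LL deg ?N) j)"
    "\<And>j a. \<beta> j ` cmp L j a = cmp (LL deg ?N) j a"
    by (rule complex_iso_E[OF LN, unfolded scl_L], rule that) blast+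
  have cmp_sub: "cmp C' j a \<subseteq> cmp L j a" for j a
    using C'(1) by (auto simp: quasi_split_subcomplex_def subcomplex_def)
  have mF: "mpol_module (scl F)" by unfold_locales
  have sub: "gr.subspace (cmod C' j)" "gr.subspace (cmod L j)" for j
    by (simp_all add: cmod_def total_def scl_C' scl_L)
  have "Nc a j = ecmp K a j" for a j
  proof -
    obtain X where X: "finite X" "fk.independent X" "fk.span X = ecmp K a j"
      by (rule ecmp_K_finite_basis)
    \<comment> \<open>The composite K \<rightarrow> L(K) \<cong> C' \<subseteq> L \<cong> L(N); its
      coefficient at 1 is the injection of K into N.\<close>
    define h where "h y = \<beta> j (\<chi> j (single 0 y))" for y
    have K_LL: "single 0 y \<in> cmp (LL deg K) j a" if "y \<in> ecmp K a j" for y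
      using that by (rule Kmod.single_cmp_LL)
    have K_cmod: "single 0 y \<in> cmod (LL deg K) j" if "y \<in> ecmp K a j" for y
      using Kmod.single_cmod_LL[OF Kmod.ecmp_layer[OF that]] .
    have \<chi>_cmp: "\<chi> j (single 0 y) \<in> cmp C' j a" if "y \<in> ecmp K a j" for y
      using \<chi>(3) K_LL[OF that] by blast
    have cmp_L: "\<chi> j (single 0 y) \<in> cmp L j a" if "y \<in> ecmp K a j" for y
      using \<chi>_cmp[OF that] cmp_sub by blast
    have \<chi>_C': "\<chi> j (single 0 y) \<in> cmod C' j" if "y \<in> ecmp K a j" for y
      using bij_betwE[OF \<chi>(2)] K_cmod[OF that] by blast
    have \<chi>_L: "\<chi> j (single 0 y) \<in> cmod L j" if "y \<in> ecmp K a j" for y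
      using cmp_L[OF that] unfolding cmod_def total_def scl_L by (auto intro: gr.span_base)
    have h_cmp: "h y \<in> cmp (LL deg ?N) j a" if "y \<in> ecmp K a j" for y
      unfolding h_def using \<beta>(3) cmp_L[OF that] by blast
    have h_cmod: "h y \<in> cmod (LL deg ?N) j" if "y \<in> ecmp K a j" for y
      unfolding h_def using bij_betwE[OF \<beta>(2)] \<chi>_L[OF that] by blast
    have "Nc a j = fk.span X"
    proof (rule fk.injective_endomorphism_onto[OF X(1,2), where f = "\<lambda>y. lookup (h y) 0"])
      show "fk.subspace (Nc a j)" using N.subspace_ecmp[of a j] by simp
      show "Nc a j \<subseteq> fk.span X" using N(1) X(3) by simp
    next
      fix x y assume xy: "x \<in> fk.span X" "y \<in> fk.span X"
      then have xy: "x \<in> ecmp K a j" "y \<in> ecmp K a j" unfolding X(3) .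
      have "h (x + y) = h x + h y"
        using \<chi>(1)[of j] \<beta>(1)[of j] K_cmod[OF xy(1)] K_cmod[OF xy(2)] \<chi>_L[OF xy(1)] \<chi>_L[OF xy(2)]
        by (simp add: h_def linear_on_def single_add)
      then show "lookup (h (x + y)) 0 = lookup (h x) 0 + lookup (h y) 0"
        by (simp only: lookup_add)
    next
      fix c x assume "x \<in> fk.span X"
      then have x: "x \<in> ecmp K a j" unfolding X(3) .
      have "single (0 :: 'v \<Rightarrow>\<^sub>0 nat) (fun_kscale sM c x) =
          tensor_poly_scale (kscl K) (Const c) (single 0 x)"
        using Kmod.tensor_poly_scale_single[of "0 :: 'v \<Rightarrow>\<^sub>0 nat" c 0 x] by (simp add: Const_def)
      then have "h (fun_kscale sM c x) = tensor_poly_scale (kscl ?N) (Const c) (h x)"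
        using \<chi>(1)[of j] \<beta>(1)[of j] K_cmod[OF x] \<chi>_L[OF x]
        by (simp add: h_def linear_on_def)
      then show "lookup (h (fun_kscale sM c x)) 0 = fun_kscale sM c (lookup (h x) 0)"
        using N.lookup_tensor_poly_scale_Const[of c "h x" 0] by simp
    next
      fix x assume "x \<in> fk.span X"
      then have "x \<in> ecmp K a j" unfolding X(3) .
      from h_cmp[OF this] show "lookup (h x) 0 \<in> Nc a j"
        unfolding N.cmp_LL by (auto dest: spec[of _ 0])
    next
      fix x assume "x \<in> fk.span X" and 0: "lookup (h x) 0 = 0"
      then have x: "x \<in> ecmp K a j" unfolding X(3) by blast
      let ?z = "\<chi> j (single 0 x)"
      \<comment> \<open>The image lies in mL(N). This is carried back to mL, from there to mC'
        because C' splits off L, and then to mL(K), whose elements have coefficient 0 at 1; here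
        that coefficient is x.\<close>
      have hx: "h x \<in> N.tm.mm (cmod (LL deg ?N) j)" using N.mm_LL[OF h_cmod[OF x]] 0 by blast
      obtain \<alpha> where \<alpha>: "linear_on (scl (LL deg ?N)) (scl F) (cmod (LL deg ?N) j) \<alpha>"
        "\<alpha> ` cmod (LL deg ?N) j \<subseteq> cmod L j" "\<alpha> (h x) = ?z"
      proof
        let ?\<alpha> = "inv_into (cmod L j) (\<beta> j)"
        have bij: "bij_betw ?\<alpha> (cmod (LL deg ?N) j) (cmod L j)" by (rule bij_betw_inv_into[OF \<beta>(2)])
        show "?\<alpha> ` cmod (LL deg ?N) j \<subseteq> cmod L j" using bij by (auto simp: bij_betw_def)
        show "?\<alpha> (h x) = ?z" unfolding h_def by (rule bij_betw_inv_into_left[OF \<beta>(2) \<chi>_L[OF x]])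
        show "linear_on (scl (LL deg ?N)) (scl F) (cmod (LL deg ?N) j) ?\<alpha>"
          by (rule linear_on_inv_into[OF \<beta>(1,2) sub(2) module_scl_F])
      qed
      have "?z \<in> gr.mm (cmod L j)"
        using linear_on_mm[OF N.tm.mpol_module_axioms mF N.subspace_cmod_LL
          \<alpha>(1)[unfolded N.scl_LL] \<alpha>(2) hx] unfolding \<alpha>(3) .
      moreover have "\<exists>D. gr.subspace D \<and> cmod C' j \<inter> D = {0} \<and>
          {x + y |x y. x \<in> cmod C' j \<and> y \<in> D} = cmod L j"
        using C'(1) by (simp add: quasi_split_subcomplex_def scl_L)
      ultimately have z: "?z \<in> gr.mm (cmod C' j)"
        using gr.mm_summand[OF sub(1) _ _ _ \<chi>_C'[OF x]] by (elim exE conjE) simp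
      have "inv_into (cmod (LL deg K) j) (\<chi> j) ?z \<in> Kmod.tm.mm (cmod (LL deg K) j)"
      proof (rule linear_on_mm[OF mF Kmod.tm.mpol_module_axioms sub(1) _ _ z])
        show "linear_on (scl F) (tensor_poly_scale (kscl K)) (cmod C' j) (inv_into (cmod (LL deg K) j) (\<chi> j))"
          using linear_on_inv_into[OF \<chi>(1)[unfolded Kmod.scl_LL] \<chi>(2) Kmod.subspace_cmod_LL
            Kmod.tp.module_axioms] .
        show "inv_into (cmod (LL deg K) j) (\<chi> j) ` cmod C' j \<subseteq> cmod (LL deg K) j"
          using bij_betw_inv_into[OF \<chi>(2)] by (auto simp: bij_betw_def)
      qed
      also have "inv_into (cmod (LL deg K) j) (\<chi> j) ?z = single 0 x"
        by (rule bij_betw_inv_into_left[OF \<chi>(2) K_cmod[OF x]])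
      finally show "x = 0" using Kmod.mm_LL[OF K_cmod[OF x]] by simp
    qed
    then show ?thesis using X(3) by simp
  qed
  then have "?N = K" by (intro emodule.equality) (auto simp: fun_eq_iff)
  then show ?thesis using N(3) by simp
qed

lemma complex_iso_maximal_strand': "maximal_strand deg F L \<Longrightarrow> complex_iso L (LL deg K)"
  by (rule Kmod.complex_iso_LL_sym[OF complex_iso_maximal_strand])

end

theorem theorem1p3:
  fixes deg :: "'v::{finite,linorder} \<Rightarrow> 'a::ab_group_add"
    and sM :: "('v, 'k::field) mpol \<Rightarrow> 'm::ab_group_add \<Rightarrow> 'm"
    and M :: "'a \<Rightarrow> 'm set"
    and F :: "('v, 'k, 'a, 'f::ab_group_add) gcomplex"
    and \<epsilon> :: "'f \<Rightarrow> 'm"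
  assumes "positively_graded TYPE('k) deg"
    and "graded_module deg sM M"
    and "finitely_generated sM M"
    and "generated_in_degree 0 sM M"
    and "minimal_free_resolution deg sM M F \<epsilon>"
  shows "(\<exists>L. maximal_strand deg F L) \<and>
    (\<forall>L L'. maximal_strand deg F L \<and> maximal_strand deg F L' \<longrightarrow> complex_iso L L') \<and>
    (\<forall>L. maximal_strand deg F L \<longrightarrow> complex_iso L (LL deg (K_module deg sM M)))"
proof -
  interpret resolution sM deg M F \<epsilon>
    using assms by (simp add: resolution_def resolution_axioms_def koszul_def graded_mod_def
      graded_mod_axioms_def mpol_module_def graded_module_def)
  obtain \<psi> where "strand_data deg F K \<psi>" by (rule lifting_exists)
  then interpret maximal_strand_data sM deg M F \<epsilon> \<psi>
    by (intro maximal_strand_data.intro resolution_axioms)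
  \<comment> \<open>Uniqueness holds because every maximal strand is isomorphic to L(K).\<close>
  have "complex_iso L L'" if "maximal_strand deg F L" "maximal_strand deg F L'" for L L'
    using complex_iso_maximal_strand'[OF that(1)] complex_iso_maximal_strand[OF that(2)]
    by (rule complex_iso_trans)
  then show ?thesis using maximal_strand_strand complex_iso_maximal_strand' by blast
qed

end
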